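(* Consider an oriented projective structure on a smooth manifold $M$ of dimension $n\geq 2$, a normal chart $U$ on $M$ with corresponding normal coordinates $x_1,\dots,x_n$, let $\{\xi_1,\dots,\xi_n\}$ be the normal frame of $TM(-1)$ determined by $U$, and let $X^0,\dots,X^n\in\Gamma(\mathcal E(1)|_U)$ be the generalised homogeneous coordinates determined by $U$. Then: (1) For $1\le r<n$, any normal solution of the first BGG operator defined on $\Lambda^rTM(-r)$ restricts on $U$ to a linear combination with constant coefficients of the sections $$\xi_{i_1}\wedge\dots\wedge\xi_{i_r}\quad (1\le i_1<i_2<\dots<i_r\le n),\qquad \sum_jx_j\,\xi_j\wedge\xi_{i_1}\wedge\dots\wedge\xi_{i_{r-1}}\quad (1\le i_1<\dots<i_{r-1}\le n).$$ In the case of the homogeneous model $S^n$, $\{\xi_i\}$ is the coordinate frame associated to a choice of basis of $\mathfrak g_-$ (that is, $X^0\xi_i=\partial/\partial x_i$), each of the sections listed above is the restriction of a solution, and they form a basis for the space of solutions of the first BGG operator on $U$. (2) For $k\ge2$, any normal solution of the ($k$th order) first BGG operator defined on $\mathcal E(k-1)$ is, over $U$, a homogeneous polynomial of degree $k-1$ in the generalised homogeneous coordinates $\{X^0,\dots,X^n\}$. In the case of $S^n$, all such polynomials arise as solutions. (3) For $k\ge2$ and $1\le r<n$, any normal solution of the ($k$th order) first BGG operator acting on $\Lambda^rTM(k-r-1)$ can be written over $U$ as a linear combination of the sections listed in (1) with coefficients which are homogeneous polynomials of degree $k-1$ in the generalised homogeneous coordinates $\{X^0,\dots,X^n\}$.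
   Context: Setting: $G=SL(n+1,\mathbb R)$, $P\subset G$ the stabiliser of the ray $\mathbb R_{>0}e_0$, where $e_0,\dots,e_n$ is the standard basis of $\mathbb R^{n+1}$. $\mathfrak g=\mathfrak{sl}(n+1,\mathbb R)$ consists of block matrices $\begin{pmatrix} -\mathrm{tr}(A) & Z \\ X & A \end{pmatrix}$, with $X\in\mathbb R^n$, $A\in\mathfrak{gl}(n,\mathbb R)$, $Z\in\mathbb R^{n*}$ representing $\mathfrak g_{-1}=\mathfrak g_-$, $\mathfrak g_0$, $\mathfrak g_1=\mathfrak p_+$. An oriented projective structure on an $n$-manifold $M$ determines its canonical normal Cartan geometry $(p:\mathcal G\to M,\omega)$ of type $(G,P)$. The homogeneous model is $G/P\cong S^n$ (the space of rays in $\mathbb R^{n+1}$) with the Maurer–Cartan form. Normal data: fix $u_0\in\mathcal G$. For $X\in\mathfrak g_{-1}$ let $\tilde X$ be the vector field on $\mathcal G$ with $\omega(\tilde X)=X$; for $X$ in a small neighbourhood of $0$ put $\Phi(X)=\mathrm{Fl}^{\tilde X}_1(u_0)$ and $\varphi=p\circ\Phi$, a diffeomorphism onto an open set $U\subset M$, the normal chart. The components $x_1,\dots,x_n$ of $X\in\mathbb R^n$ are the normal coordinates on $U$; the normal section is $\sigma(\varphi(X))=\Phi(X)$. For a $P$-representation $\mathbb W$ with basis $\{w_i\}$, the associated normal frame of $\mathcal G\times_P\mathbb W$ over $U$ is $x\mapsto[(\sigma(x),w_i)]$. On the homogeneous model one uses $u_0=e$, so $\varphi(X)=\exp(X)P$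 on all of $\mathfrak g_{-1}$. Bundles: $\mathcal TM=\mathcal G\times_P\mathbb R^{n+1}$; $\mathcal E(-1)=\mathcal G\times_P(\mathbb Re_0)$, $\mathcal E(1)=\mathcal E(-1)^*$, $\mathcal E(w)$ the $w$-th power of $\mathcal E(1)$; "$(w)$" denotes tensoring with $\mathcal E(w)$; $\mathcal G\times_P(\mathbb R^{n+1}/\mathbb Re_0)\cong TM(-1)$. $X^0\in\Gamma(\mathcal E(1)|_U)$ is the non-vanishing section dual to the normal frame of $\mathcal E(-1)$ given by $e_0$; $\{\xi_i\}$ is the normal frame of $TM(-1)$ given by the images of $e_1,\dots,e_n$; the generalised homogeneous coordinates are $X^0$ and $X^i:=x_iX^0$, $i=1,\dots,n$. BGG operators: for an irreducible representation $\mathbb V$ of $G$, let $\mathcal VM=\mathcal G\times_P\mathbb V$ carry the tractor connection $\nabla$ (if $s$ corresponds to the equivariant function $\tilde f:\mathcal G\to\mathbb V$, then for $\xi=T_up\cdot\omega_u^{-1}(X)$, $\nabla_\xi s$ at $p(u)$ is represented by $(u,(\omega_u^{-1}(X)\cdot\tilde f)(u)+X\cdot\tilde f(u))$). Let $\Pi:\mathcal VM\to\mathcal H_0M$ be the projection to the bundle induced by $\mathbb V/(\mathfrak p_+\cdot\mathbb V)$, the $P$-irreducible quotient. Let $\partial^*$ be the bundle maps $\Lambda^kT^*M\otimes\mathcal VM\to\Lambda^{k-1}T^*M\otimes\mathcal VM$ induced by the Lie algebra homology differential of $\mathfrak p_+\cong(\mathfrak g/\mathfrak p)^*$ with values in $\mathbb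 V$. For $\alpha\in\Gamma(\mathcal H_0M)$ there is a unique $S(\alpha)\in\Gamma(\mathcal VM)$ with $\Pi(S(\alpha))=\alpha$ and $\partial^*\nabla S(\alpha)=0$; the first BGG operator maps $\alpha$ to the class of $\nabla S(\alpha)$ in $\ker\partial^*/\mathrm{im}\,\partial^*$ (inside $T^*M\otimes\mathcal VM$). Solutions are elements of its kernel; normal solutions are those of the form $\Pi(s)$ with $\nabla s=0$. The operators in (1), (2), (3) are those determined respectively by $\mathbb V=\Lambda^r\mathbb R^{n+1}$ (with $\mathcal H_0M=\Lambda^rTM(-r)$), $\mathbb V=S^{k-1}\mathbb R^{(n+1)*}$ (with $\mathcal H_0M=\mathcal E(k-1)$), and the Cartan product (highest weight component) $\mathbb V=S^{k-1}\mathbb R^{(n+1)*}\odot\Lambda^r\mathbb R^{n+1}$ (with $\mathcal H_0M=\Lambda^rTM(k-r-1)$). *)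

theory Defs
  imports "HOL-Analysis.Analysis"
begin

section \<open>Smooth manifolds\<close>

text \<open>For open \<open>S\<close>; derivatives of all orders are taken as iterated directional derivatives.\<close>

primrec Ck_on :: "nat \<Rightarrow> 'a::euclidean_space set \<Rightarrow> ('a \<Rightarrow> 'b::real_normed_vector) \<Rightarrow> bool" where
  "Ck_on 0 S f \<longleftrightarrow> continuous_on S f"
| "Ck_on (Suc k) S f \<longleftrightarrow>
     (\<exists>f'. (\<forall>x\<in>S. (f has_derivative f' x) (at x)) \<and> (\<forall>v. Ck_on k S (\<lambda>x. f' x v)))"

definition smooth_on :: "'a::euclidean_space set \<Rightarrow> ('a \<Rightarrow> 'b::real_normed_vector) \<Rightarrow> bool" where
  "smooth_on S f \<longleftrightarrow> (\<forall>k. Ck_on k S f)"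

record ('a, 'e) manifold =
  mtop :: "'a topology"
  charts :: "('a set \<times> ('a \<Rightarrow> 'e)) set"

abbreviation pts :: "('a, 'e) manifold \<Rightarrow> 'a set" where
  "pts N \<equiv> topspace (mtop N)"

definition smooth_chart :: "('a, 'e::euclidean_space) manifold \<Rightarrow> 'a set \<times> ('a \<Rightarrow> 'e) \<Rightarrow> bool" where
  "smooth_chart N = (\<lambda>(D, \<kappa>). openin (mtop N) D \<and> open (\<kappa> ` D) \<and>
     homeomorphic_map (subtopology (mtop N) D) (top_of_set (\<kappa> ` D)) \<kappa> \<and>
     (\<forall>(D', \<kappa>')\<in>charts N.
        smooth_on (\<kappa> ` (D \<inter> D')) (\<kappa>' \<circ> inv_into D \<kappa>) \<and>
        smooth_on (\<kappa>' ` (D \<inter> D')) (\<kappa> \<circ> inv_into D' \<kappa>')))"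

definition smooth_manifold :: "('a, 'e::euclidean_space) manifold \<Rightarrow> bool" where
  "smooth_manifold N \<longleftrightarrow> Hausdorff_space (mtop N) \<and> second_countable (mtop N) \<and>
     (\<Union>(D, \<kappa>)\<in>charts N. D) = pts N \<and> (\<forall>c\<in>charts N. smooth_chart N c)"

text \<open>Functions are total, but only their values on \<open>pts N\<close> near \<open>x\<close> matter here.\<close>

definition smooth_near :: "('a, 'e::euclidean_space) manifold \<Rightarrow> 'a \<Rightarrow> ('a \<Rightarrow> 'b::real_normed_vector) \<Rightarrow> bool" where
  "smooth_near N x f \<longleftrightarrow> (\<exists>(D, \<kappa>)\<in>charts N. x \<in> D \<and>
     (\<exists>W. open W \<and> \<kappa> x \<in> W \<and> W \<subseteq> \<kappa> ` D \<and> smooth_on W (f \<circ> inv_into D \<kappa>)))"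

text \<open>Smoothness of maps through pullback of germs of smooth functions; this includes continuity,
  since the indicator function of a neighbourhood of \<open>h x\<close> is smooth near \<open>h x\<close>.\<close>

definition smooth_map :: "('a, 'e::euclidean_space) manifold \<Rightarrow> ('b, 'f::euclidean_space) manifold \<Rightarrow>
    'a set \<Rightarrow> ('a \<Rightarrow> 'b) \<Rightarrow> bool" where
  "smooth_map N N' W h \<longleftrightarrow> h ` W \<subseteq> pts N' \<and>
     (\<forall>x\<in>W. \<forall>f :: 'b \<Rightarrow> real. smooth_near N' (h x) f \<longrightarrow> smooth_near N x (f \<circ> h))"

definition prod_manifold ::
    "('a, 'e) manifold \<Rightarrow> ('b, 'f) manifold \<Rightarrow> ('a \<times> 'b, 'e \<times> 'f) manifold" where
  "prod_manifold N N' = \<lparr> mtop = prod_topology (mtop N) (mtop N'),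
     charts = {(D \<times> D', map_prod \<kappa> \<kappa>') | D \<kappa> D' \<kappa>'. (D, \<kappa>) \<in> charts N \<and> (D', \<kappa>') \<in> charts N'} \<rparr>"

definition eucl_manifold :: "('e::euclidean_space, 'e) manifold" where
  "eucl_manifold = \<lparr> mtop = euclidean, charts = {(UNIV, id)} \<rparr>"

text \<open>The embedded submanifold structure on a subset \<open>S\<close> of a Euclidean space.\<close>

definition embedded :: "'a::euclidean_space set \<Rightarrow> ('a, 'e::euclidean_space) manifold" where
  "embedded S = \<lparr> mtop = top_of_set S,
     charts = {(D, \<kappa>). openin (top_of_set S) D \<and> open (\<kappa> ` D) \<and> inj_on \<kappa> D \<and>
       (\<forall>x\<in>D. \<exists>W f. open W \<and> x \<in> W \<and> smooth_on W f \<and> (\<forall>y\<in>W \<inter> D. \<kappa> y = f y)) \<and>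
       smooth_on (\<kappa> ` D) (inv_into D \<kappa>)} \<rparr>"

text \<open>Tangent vectors are the operators on germs of smooth functions given by a directional derivative
  in a chart. Off smooth germs they take the value 0, so that they are determined as functions.\<close>

type_synonym 'a tvec = "('a \<Rightarrow> real) \<Rightarrow> real"

definition tangent_space :: "('a, 'e::euclidean_space) manifold \<Rightarrow> 'a \<Rightarrow> 'a tvec set" where
  "tangent_space N x = {(\<lambda>f. if smooth_near N x f
       then frechet_derivative (f \<circ> inv_into D \<kappa>) (at (\<kappa> x)) w else 0) | D \<kappa> w.
     (D, \<kappa>) \<in> charts N \<and> x \<in> D}"

definition push :: "('a, 'e::euclidean_space) manifold \<Rightarrow> ('b, 'f::euclidean_space) manifold \<Rightarrow>
    ('a \<Rightarrow> 'b) \<Rightarrow> 'a \<Rightarrow> 'a tvec \<Rightarrow> 'b tvec" where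
  "push N N' h x v = (\<lambda>f. if smooth_near N' (h x) f then v (f \<circ> h) else 0)"

definition vderiv :: "'a tvec \<Rightarrow> ('a \<Rightarrow> 'v::euclidean_space) \<Rightarrow> 'v" where
  "vderiv v s = (\<Sum>b\<in>Basis. v (\<lambda>x. s x \<bullet> b) *\<^sub>R b)"

definition vector_fields :: "('a, 'e::euclidean_space) manifold \<Rightarrow> 'a set \<Rightarrow> ('a \<Rightarrow> 'a tvec) set" where
  "vector_fields N W = {\<xi>. \<forall>x\<in>W. \<xi> x \<in> tangent_space N x \<and>
     (\<forall>f. smooth_near N x f \<longrightarrow> smooth_near N x (\<lambda>y. \<xi> y f))}"

definition lie_bracket :: "('a, 'e::euclidean_space) manifold \<Rightarrow>
    ('a \<Rightarrow> 'a tvec) \<Rightarrow> ('a \<Rightarrow> 'a tvec) \<Rightarrow> 'a \<Rightarrow> 'a tvec" where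
  "lie_bracket N \<xi> \<eta> x =
     (\<lambda>f. if smooth_near N x f then \<xi> x (\<lambda>y. \<eta> y f) - \<eta> x (\<lambda>y. \<xi> y f) else 0)"


section \<open>The groups \<open>G\<close> and \<open>P\<close> and the Lie algebra\<close>

text \<open>The index \<open>None\<close> stands for 0 and \<open>Some i\<close> for the indices \<open>1, \<dots>, n\<close>. A triple \<open>(X, A, Z)\<close>
  stands for the trace-free block matrix with rows \<open>(- tr A, Z)\<close> and \<open>(X, A)\<close>.\<close>

type_synonym 'n mat = "real^('n option)^('n option)"
type_synonym 'n sl = "(real^'n) \<times> (real^'n^'n) \<times> (real^'n)"

definition sl_mat :: "'n::finite sl \<Rightarrow> 'n mat" where
  "sl_mat = (\<lambda>(X, A, Z). \<chi> a b. case (a, b) of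
      (None, None) \<Rightarrow> - trace A | (None, Some j) \<Rightarrow> Z $ j
    | (Some i, None) \<Rightarrow> X $ i | (Some i, Some j) \<Rightarrow> A $ i $ j)"

definition mat_block :: "'n::finite mat \<Rightarrow> real^'n^'n" where
  "mat_block g = (\<chi> i j. g $ Some i $ Some j)"

definition mat_sl :: "'n::finite mat \<Rightarrow> 'n sl" where
  "mat_sl m = ((\<chi> i. m $ Some i $ None), mat_block m, (\<chi> j. m $ None $ Some j))"

abbreviation gm :: "real^'n::finite \<Rightarrow> 'n sl" where "gm X \<equiv> (X, 0, 0)"
abbreviation gp :: "real^'n::finite \<Rightarrow> 'n sl" where "gp Z \<equiv> (0, 0, Z)"

definition sl_bracket :: "'n::finite sl \<Rightarrow> 'n sl \<Rightarrow> 'n sl" where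
  "sl_bracket Y Y' = mat_sl (sl_mat Y ** sl_mat Y' - sl_mat Y' ** sl_mat Y)"

definition Ad :: "'n::finite mat \<Rightarrow> 'n sl \<Rightarrow> 'n sl" where
  "Ad g Y = mat_sl (g ** sl_mat Y ** matrix_inv g)"

definition mexp :: "real^'i^'i::finite \<Rightarrow> real^'i^'i" where
  "mexp A = (\<Sum>k. (1 / fact k) *\<^sub>R (((**) A ^^ k) (mat 1)))"

definition SL :: "'n::finite mat set" where
  "SL = {g. det g = 1}"

definition Pgrp :: "'n::finite mat set" where
  "Pgrp = {g \<in> SL. \<exists>c>0. g *v axis None 1 = c *\<^sub>R axis None 1}"

text \<open>Both \<open>SL\<close> and \<open>P\<close> carry their structure as submanifolds of the space of matrices; the type
  constraint on \<open>P\<close> fixes its dimension.\<close>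

definition P_manifold :: "('n::finite mat, (real^'n^'n) \<times> (real^'n)) manifold" where
  "P_manifold = embedded Pgrp"

definition SL_manifold :: "('n::finite mat, 'n sl) manifold" where
  "SL_manifold = embedded SL"


section \<open>Cartan geometries of type \<open>(G, P)\<close>\<close>

record ('g, 'm, 'n) cartan_geometry =
  tot :: "('g, 'n sl) manifold"
  base :: "('m, real^'n) manifold"
  prj :: "'g \<Rightarrow> 'm"
  ract :: "'g \<Rightarrow> 'n mat \<Rightarrow> 'g"
  cform :: "'g \<Rightarrow> 'g tvec \<Rightarrow> 'n sl"

definition over :: "('g, 'm, 'n::finite) cartan_geometry \<Rightarrow> 'm set \<Rightarrow> 'g set" where
  "over C U = {u \<in> pts (tot C). prj C u \<in> U}"

definition principal_bundle :: "('g, 'm, 'n::finite) cartan_geometry \<Rightarrow> bool" where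
  "principal_bundle C \<longleftrightarrow>
     smooth_manifold (tot C) \<and> smooth_manifold (base C) \<and>
     smooth_map (tot C) (base C) (pts (tot C)) (prj C) \<and>
     smooth_map (prod_manifold (tot C) P_manifold) (tot C) (pts (tot C) \<times> Pgrp)
       (\<lambda>(u, g). ract C u g) \<and>
     (\<forall>u\<in>pts (tot C). ract C u (mat 1) = u \<and>
       (\<forall>g\<in>Pgrp. prj C (ract C u g) = prj C u \<and>
         (\<forall>h\<in>Pgrp. ract C (ract C u g) h = ract C u (g ** h)))) \<and>
     (\<forall>x\<in>pts (base C). \<exists>W \<tau>. let triv = (\<lambda>(y, g). ract C (\<tau> y) g) in
       openin (mtop (base C)) W \<and> x \<in> W \<and>
       (\<forall>y\<in>W. \<tau> y \<in> pts (tot C) \<and> prj C (\<tau> y) = y) \<and>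
       bij_betw triv (W \<times> Pgrp) (over C W) \<and>
       smooth_map (prod_manifold (base C) P_manifold) (tot C) (W \<times> Pgrp) triv \<and>
       smooth_map (tot C) (prod_manifold (base C) P_manifold) (over C W)
         (inv_into (W \<times> Pgrp) triv))"

text \<open>\<open>cvf C Y\<close> is the constant vector field \<open>\<omega>\<^sup>-\<^sup>1(Y)\<close>.\<close>

definition cvf :: "('g, 'm, 'n::finite) cartan_geometry \<Rightarrow> 'n sl \<Rightarrow> 'g \<Rightarrow> 'g tvec" where
  "cvf C Y u = inv_into (tangent_space (tot C) u) (cform C u) Y"

definition fundamental_field :: "('g, 'm, 'n::finite) cartan_geometry \<Rightarrow> 'n sl \<Rightarrow> 'g \<Rightarrow> 'g tvec" where
  "fundamental_field C Y u = (\<lambda>f. if smooth_near (tot C) u f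
     then deriv (\<lambda>t. f (ract C u (mexp (t *\<^sub>R sl_mat Y)))) 0 else 0)"

definition cartan_geometry :: "('g, 'm, 'n::finite) cartan_geometry \<Rightarrow> bool" where
  "cartan_geometry C \<longleftrightarrow> principal_bundle C \<and>
     (\<forall>u\<in>pts (tot C). bij_betw (cform C u) (tangent_space (tot C) u) UNIV \<and>
       (\<forall>v\<in>tangent_space (tot C) u. \<forall>w\<in>tangent_space (tot C) u. \<forall>a b.
          cform C u (\<lambda>f. a * v f + b * w f) = a *\<^sub>R cform C u v + b *\<^sub>R cform C u w)) \<and>
     (\<forall>W \<xi>. openin (mtop (tot C)) W \<longrightarrow> \<xi> \<in> vector_fields (tot C) W \<longrightarrow>
       (\<forall>u\<in>W. smooth_near (tot C) u (\<lambda>u'. cform C u' (\<xi> u')))) \<and>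
     (\<forall>u\<in>pts (tot C). \<forall>g\<in>Pgrp. \<forall>v\<in>tangent_space (tot C) u.
       cform C (ract C u g) (push (tot C) (tot C) (\<lambda>u'. ract C u' g) u v)
         = Ad (matrix_inv g) (cform C u v)) \<and>
     (\<forall>u\<in>pts (tot C). \<forall>A Z. cform C u (fundamental_field C (0, A, Z) u) = (0, A, Z))"

text \<open>The curvature function \<open>d\<omega>(\<omega>\<^sup>-\<^sup>1(Y), \<omega>\<^sup>-\<^sup>1(Y')) + [Y, Y']\<close>, using
  \<open>d\<omega>(\<xi>, \<eta>) = - \<omega>([\<xi>, \<eta>])\<close> for constant vector fields.\<close>

definition curvature :: "('g, 'm, 'n::finite) cartan_geometry \<Rightarrow> 'g \<Rightarrow> 'n sl \<Rightarrow> 'n sl \<Rightarrow> 'n sl" where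
  "curvature C u Y Y' =
     sl_bracket Y Y' - cform C u (lie_bracket (tot C) (cvf C Y) (cvf C Y') u)"

text \<open>The homology differentials in degrees 1 and 2, for an action \<open>a\<close> of \<open>\<gg>\<close>. Here \<open>\<Lambda>\<^sup>k\<pp>\<^sub>+ \<otimes> V\<close> is
  identified with alternating \<open>k\<close>-linear maps \<open>\<gg>\<^sub>-\<^sub>1 \<rightarrow> V\<close> through the trace form, for which the
  \<open>gp (axis i 1)\<close> are dual to the \<open>gm (axis i 1)\<close>. In these terms
  \<open>Z \<otimes> v \<mapsto> - Z \<cdot> v\<close> and \<open>Z \<and> Z' \<otimes> v \<mapsto> Z \<otimes> Z' \<cdot> v - Z' \<otimes> Z \<cdot> v\<close>; there are no
  bracket terms because \<open>\<pp>\<^sub>+\<close> is abelian.\<close>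

definition codiff1 :: "('n::finite sl \<Rightarrow> 'v \<Rightarrow> 'v) \<Rightarrow> (real^'n \<Rightarrow> 'v::real_vector) \<Rightarrow> 'v" where
  "codiff1 a \<phi> = - (\<Sum>i\<in>UNIV. a (gp (axis i 1)) (\<phi> (axis i 1)))"

definition codiff2 :: "('n::finite sl \<Rightarrow> 'v \<Rightarrow> 'v) \<Rightarrow> (real^'n \<Rightarrow> real^'n \<Rightarrow> 'v::real_vector) \<Rightarrow> real^'n \<Rightarrow> 'v" where
  "codiff2 a \<psi> = (\<lambda>X. \<Sum>i\<in>UNIV. a (gp (axis i 1)) (\<psi> X (axis i 1)))"

definition normal_geometry :: "('g, 'm, 'n::finite) cartan_geometry \<Rightarrow> bool" where
  "normal_geometry C \<longleftrightarrow> (\<forall>u\<in>pts (tot C). \<forall>X.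
     codiff2 sl_bracket (\<lambda>X Y. curvature C u (gm X) (gm Y)) X = 0)"


section \<open>Oriented projective structures\<close>

definition oriented_atlas :: "('m, real^'n::finite) manifold \<Rightarrow> ('m set \<times> ('m \<Rightarrow> real^'n)) set \<Rightarrow> bool" where
  "oriented_atlas M ori \<longleftrightarrow> ori \<subseteq> Collect (smooth_chart M) \<and> (\<Union>(D, \<kappa>)\<in>ori. D) = pts M \<and>
     (\<forall>(D, \<kappa>)\<in>ori. \<forall>(D', \<kappa>')\<in>ori. \<forall>x\<in>D \<inter> D'.
        0 < det (matrix (frechet_derivative (\<kappa>' \<circ> inv_into D \<kappa>) (at (\<kappa> x)))))"

type_synonym 'm connection = "('m \<Rightarrow> 'm tvec) \<Rightarrow> ('m \<Rightarrow> 'm tvec) \<Rightarrow> 'm \<Rightarrow> 'm tvec"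

definition torsion_free_connection :: "('m, real^'n::finite) manifold \<Rightarrow> 'm connection \<Rightarrow> bool" where
  "torsion_free_connection M D \<longleftrightarrow>
    (\<forall>\<xi>\<in>vector_fields M (pts M). \<forall>\<eta>\<in>vector_fields M (pts M).
      D \<xi> \<eta> \<in> vector_fields M (pts M) \<and>
      (\<forall>x\<in>pts M. \<forall>f. D \<xi> \<eta> x f - D \<eta> \<xi> x f = lie_bracket M \<xi> \<eta> x f) \<and>
      (\<forall>\<zeta>\<in>vector_fields M (pts M). \<forall>x\<in>pts M. \<forall>f.
        D (\<lambda>y f. \<xi> y f + \<zeta> y f) \<eta> x f = D \<xi> \<eta> x f + D \<zeta> \<eta> x f \<and>
        D \<eta> (\<lambda>y f. \<xi> y f + \<zeta> y f) x f = D \<eta> \<xi> x f + D \<eta> \<zeta> x f) \<and>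
      (\<forall>h. (\<forall>x\<in>pts M. smooth_near M x h) \<longrightarrow> (\<forall>x\<in>pts M. \<forall>f.
        D (\<lambda>y f. h y * \<xi> y f) \<eta> x f = h x * D \<xi> \<eta> x f \<and>
        D \<xi> (\<lambda>y f. h y * \<eta> y f) x f = \<xi> x h * \<eta> x f + h x * D \<xi> \<eta> x f)))"

definition one_form :: "('m, real^'n::finite) manifold \<Rightarrow> (('m \<Rightarrow> 'm tvec) \<Rightarrow> 'm \<Rightarrow> real) \<Rightarrow> bool" where
  "one_form M \<Upsilon> \<longleftrightarrow> (\<forall>\<xi>\<in>vector_fields M (pts M).
      (\<forall>x\<in>pts M. smooth_near M x (\<Upsilon> \<xi>)) \<and>
      (\<forall>\<zeta>\<in>vector_fields M (pts M). \<forall>x\<in>pts M. \<Upsilon> (\<lambda>y f. \<xi> y f + \<zeta> y f) x = \<Upsilon> \<xi> x + \<Upsilon> \<zeta> x) \<and>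
      (\<forall>h. (\<forall>x\<in>pts M. smooth_near M x h) \<longrightarrow>
        (\<forall>x\<in>pts M. \<Upsilon> (\<lambda>y f. h y * \<xi> y f) x = h x * \<Upsilon> \<xi> x)))"

definition projectively_equivalent :: "('m, real^'n::finite) manifold \<Rightarrow> 'm connection \<Rightarrow> 'm connection \<Rightarrow> bool" where
  "projectively_equivalent M D D' \<longleftrightarrow> (\<exists>\<Upsilon>. one_form M \<Upsilon> \<and>
     (\<forall>\<xi>\<in>vector_fields M (pts M). \<forall>\<eta>\<in>vector_fields M (pts M). \<forall>x\<in>pts M. \<forall>f.
        D' \<xi> \<eta> x f = D \<xi> \<eta> x f + \<Upsilon> \<xi> x * \<eta> x f + \<Upsilon> \<eta> x * \<xi> x f))"

definition oriented_projective_structure ::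
    "('m, real^'n::finite) manifold \<Rightarrow> ('m set \<times> ('m \<Rightarrow> real^'n)) set \<Rightarrow> 'm connection set \<Rightarrow> bool" where
  "oriented_projective_structure M ori cls \<longleftrightarrow> smooth_manifold M \<and> oriented_atlas M ori \<and>
     (\<exists>D. torsion_free_connection M D \<and>
       cls = {D'. torsion_free_connection M D' \<and> projectively_equivalent M D D'})"

text \<open>The equivariant function \<open>\<G> \<rightarrow> \<gg>/\<pp>\<close> of a vector field on the base, under the isomorphism
  \<open>TM \<cong> \<G> \<times>\<^sub>P \<gg>/\<pp>\<close> given by the Cartan connection.\<close>

definition soldered :: "('g, 'm, 'n::finite) cartan_geometry \<Rightarrow> ('m \<Rightarrow> 'm tvec) \<Rightarrow> 'g \<Rightarrow> real^'n" where
  "soldered C \<xi> u = (THE X. push (tot C) (base C) (prj C) u (cvf C (gm X) u) = \<xi> (prj C u))"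

text \<open>Every local section through \<open>u\<close> of the total space induces a connection on the base, via the
  \<open>\<gg>\<^sub>0\<close>-component of \<open>\<omega>\<close>. By equivariance, the value at \<open>u\<close> of the function representing the
  derivative of \<open>\<eta>\<close> in direction \<open>\<xi>\<close> is \<open>\<omega>\<^sub>u\<^sup>-\<^sup>1(X) \<cdot> h\<close>, where \<open>X\<close> represents
  \<open>\<xi>\<close> at \<open>u\<close> and \<open>h\<close> is the function of \<open>\<eta>\<close>. The projective class underlying the Cartan
  geometry consists of the torsion-free connections that differ from this by a projective change.\<close>

definition induces_class :: "('g, 'm, 'n::finite) cartan_geometry \<Rightarrow> 'm connection set \<Rightarrow> bool" where
  "induces_class C cls \<longleftrightarrow> (\<forall>D\<in>cls. \<forall>u\<in>pts (tot C). \<exists>\<upsilon> :: real^'n.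
     \<forall>\<xi>\<in>vector_fields (base C) (pts (base C)). \<forall>\<eta>\<in>vector_fields (base C) (pts (base C)).
       soldered C (D \<xi> \<eta>) u = vderiv (cvf C (gm (soldered C \<xi> u)) u) (soldered C \<eta>)
         + (\<upsilon> \<bullet> soldered C \<xi> u) *\<^sub>R soldered C \<eta> u + (\<upsilon> \<bullet> soldered C \<eta> u) *\<^sub>R soldered C \<xi> u)"

definition induces_orientation ::
    "('g, 'm, 'n::finite) cartan_geometry \<Rightarrow> ('m set \<times> ('m \<Rightarrow> real^'n)) set \<Rightarrow> bool" where
  "induces_orientation C ori \<longleftrightarrow> (\<forall>u\<in>pts (tot C). \<forall>(D, \<kappa>)\<in>ori. prj C u \<in> D \<longrightarrow>
     0 < det (\<chi> i j. push (tot C) (base C) (prj C) u (cvf C (gm (axis j 1)) u) (\<lambda>y. \<kappa> y $ i)))"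

definition canonical_cartan_geometry :: "('g, 'm, 'n::finite) cartan_geometry \<Rightarrow>
    ('m set \<times> ('m \<Rightarrow> real^'n)) set \<Rightarrow> 'm connection set \<Rightarrow> bool" where
  "canonical_cartan_geometry C ori cls \<longleftrightarrow> cartan_geometry C \<and> normal_geometry C \<and>
     induces_orientation C ori \<and> induces_class C cls"


section \<open>The homogeneous model\<close>

text \<open>The sphere of rays in \<open>\<real>\<^sup>n\<^sup>+\<^sup>1\<close>, with the Maurer--Cartan form \<open>g\<^sup>-\<^sup>1 dg\<close>.\<close>

definition flat_model :: "('n::finite mat, real^('n option), 'n) cartan_geometry" where
  "flat_model = \<lparr> tot = SL_manifold, base = embedded (sphere 0 1),
     prj = (\<lambda>g. sgn (g *v axis None 1)), ract = (**),
     cform = (\<lambda>g v. mat_sl (matrix_inv g ** (\<chi> a b. v (\<lambda>h. h $ a $ b)))) \<rparr>"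


section \<open>Associated bundles and normal data\<close>

text \<open>Sections over \<open>U\<close> of the bundle associated to a representation \<open>\<tau>\<close> on the subspace
  \<open>F\<close>, as equivariant functions on the part of the total space over \<open>U\<close>. Values of these functions
  at other points are irrelevant.\<close>

definition sections :: "('g, 'm, 'n::finite) cartan_geometry \<Rightarrow> 'm set \<Rightarrow>
    'w::euclidean_space set \<Rightarrow> ('n mat \<Rightarrow> 'w \<Rightarrow> 'w) \<Rightarrow> ('g \<Rightarrow> 'w) set" where
  "sections C U F \<tau> = {s. \<forall>u\<in>over C U. s u \<in> F \<and> smooth_near (tot C) u s \<and>
     (\<forall>g\<in>Pgrp. s (ract C u g) = \<tau> (matrix_inv g) (s u))}"

text \<open>\<open>flow1 C Y u u'\<close> says that the flow of \<open>\<omega>\<^sup>-\<^sup>1(Y)\<close> at time 1 maps \<open>u\<close> to \<open>u'\<close>.\<close>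

definition flow1 :: "('g, 'm, 'n::finite) cartan_geometry \<Rightarrow> 'n sl \<Rightarrow> 'g \<Rightarrow> 'g \<Rightarrow> bool" where
  "flow1 C Y u u' \<longleftrightarrow> (\<exists>c :: real \<Rightarrow> 'g. c 0 = u \<and> c 1 = u' \<and>
     (\<forall>t\<in>{0..1}. c t \<in> pts (tot C) \<and> (\<forall>f. smooth_near (tot C) (c t) f \<longrightarrow>
        ((f \<circ> c) has_real_derivative cvf C Y (c t) f) (at t within {0..1}))))"

definition normal_chart :: "('g, 'm, 'n::finite) cartan_geometry \<Rightarrow> 'g \<Rightarrow> (real^'n) set \<Rightarrow> (real^'n \<Rightarrow> 'g) \<Rightarrow> bool" where
  "normal_chart C u\<^sub>0 B \<Phi> \<longleftrightarrow> u\<^sub>0 \<in> pts (tot C) \<and> open B \<and> 0 \<in> B \<and>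
     (\<forall>X\<in>B. flow1 C (gm X) u\<^sub>0 (\<Phi> X)) \<and>
     inj_on (prj C \<circ> \<Phi>) B \<and> openin (mtop (base C)) ((prj C \<circ> \<Phi>) ` B) \<and>
     smooth_map eucl_manifold (base C) B (prj C \<circ> \<Phi>) \<and>
     smooth_map (base C) eucl_manifold ((prj C \<circ> \<Phi>) ` B) (inv_into B (prj C \<circ> \<Phi>))"

text \<open>In the following, \<open>\<Phi>\<close> on \<open>B\<close> is the lift of a normal chart.\<close>

definition chart_dom :: "('g, 'm, 'n::finite) cartan_geometry \<Rightarrow> (real^'n) set \<Rightarrow> (real^'n \<Rightarrow> 'g) \<Rightarrow> 'm set" where
  "chart_dom C B \<Phi> = (prj C \<circ> \<Phi>) ` B"

definition ncoord :: "('g, 'm, 'n::finite) cartan_geometry \<Rightarrow> (real^'n) set \<Rightarrow> (real^'n \<Rightarrow> 'g) \<Rightarrow> 'm \<Rightarrow> real^'n" where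
  "ncoord C B \<Phi> x = inv_into B (prj C \<circ> \<Phi>) x"

definition normal_section :: "('g, 'm, 'n::finite) cartan_geometry \<Rightarrow> (real^'n) set \<Rightarrow> (real^'n \<Rightarrow> 'g) \<Rightarrow> 'm \<Rightarrow> 'g" where
  "normal_section C B \<Phi> x = \<Phi> (ncoord C B \<Phi> x)"

text \<open>The equivariant function of the section \<open>x \<mapsto> [(\<sigma>(x), w)]\<close>, \<open>\<sigma>\<close> the normal section.\<close>

definition normal_frame :: "('g, 'm, 'n::finite) cartan_geometry \<Rightarrow> (real^'n) set \<Rightarrow> (real^'n \<Rightarrow> 'g) \<Rightarrow>
    ('n mat \<Rightarrow> 'w \<Rightarrow> 'w) \<Rightarrow> 'w \<Rightarrow> 'g \<Rightarrow> 'w" where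
  "normal_frame C B \<Phi> \<tau> w u =
     \<tau> (matrix_inv (THE g. g \<in> Pgrp \<and> u = ract C (normal_section C B \<Phi> (prj C u)) g)) w"

text \<open>The fibre representations of \<open>\<E>(w)\<close> and of \<open>TM(-1)\<close>, the latter on
  \<open>\<real>\<^sup>n\<^sup>+\<^sup>1/\<real>e\<^sub>0\<close> in the basis of the classes of \<open>e\<^sub>1, \<dots>, e\<^sub>n\<close>.\<close>

definition density_act :: "int \<Rightarrow> 'n::finite mat \<Rightarrow> real \<Rightarrow> real" where
  "density_act w g y = (g $ None $ None) powi (- w) * y"

definition quotient_act :: "'n::finite mat \<Rightarrow> real^'n \<Rightarrow> real^'n" where
  "quotient_act g y = mat_block g *v y"

definition nframe_TM :: "('g, 'm, 'n::finite) cartan_geometry \<Rightarrow> (real^'n) set \<Rightarrow> (real^'n \<Rightarrow> 'g) \<Rightarrow>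
    'n \<Rightarrow> 'g \<Rightarrow> real^'n" where
  "nframe_TM C B \<Phi> i = normal_frame C B \<Phi> quotient_act (axis i 1)"

definition hom_coord :: "('g, 'm, 'n::finite) cartan_geometry \<Rightarrow> (real^'n) set \<Rightarrow> (real^'n \<Rightarrow> 'g) \<Rightarrow>
    'n option \<Rightarrow> 'g \<Rightarrow> real" where
  "hom_coord C B \<Phi> a u = (case a of None \<Rightarrow> 1 | Some i \<Rightarrow> ncoord C B \<Phi> (prj C u) $ i)
     * normal_frame C B \<Phi> (density_act 1) 1 u"

definition coord_field :: "('g, 'm, 'n::finite) cartan_geometry \<Rightarrow> (real^'n) set \<Rightarrow> (real^'n \<Rightarrow> 'g) \<Rightarrow>
    'n \<Rightarrow> 'm \<Rightarrow> 'm tvec" where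
  "coord_field C B \<Phi> i x = (\<lambda>f. if smooth_near (base C) x f
     then frechet_derivative (f \<circ> (prj C \<circ> \<Phi>)) (at (ncoord C B \<Phi> x)) (axis i 1) else 0)"

definition homogeneous_polynomial :: "nat \<Rightarrow> (('i::finite \<Rightarrow> real) \<Rightarrow> real) \<Rightarrow> bool" where
  "homogeneous_polynomial d q \<longleftrightarrow> (\<exists>c :: ('i \<Rightarrow> nat) \<Rightarrow> real.
     q = (\<lambda>y. \<Sum>m | (\<Sum>i\<in>UNIV. m i) = d. c m * (\<Prod>i\<in>UNIV. y i ^ m i)))"


section \<open>Tensor representations\<close>

text \<open>\<open>\<otimes>\<^sup>r \<real>\<^sup>m\<close> is the space of arrays indexed by \<open>r\<close>-tuples of indices, where the number \<open>r\<close> is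
  given as the cardinality of a type \<open>'r\<close> and a tuple as a map on \<open>'r\<close>.\<close>

definition tensor_act :: "real^'i^'i \<Rightarrow> real^('r::finite \<Rightarrow> 'i::finite) \<Rightarrow> real^('r \<Rightarrow> 'i)" where
  "tensor_act g t = (\<chi> s. \<Sum>s'\<in>UNIV. (\<Prod>a\<in>UNIV. g $ s a $ s' a) * t $ s')"

definition alternating :: "(real^('r::finite \<Rightarrow> 'i::finite)) set" where
  "alternating = {t. \<forall>p s. p permutes UNIV \<longrightarrow> t $ (s \<circ> p) = of_int (sign p) * t $ s}"

definition symmetric :: "(real^('r::finite \<Rightarrow> 'i::finite)) set" where
  "symmetric = {t. \<forall>p s. p permutes UNIV \<longrightarrow> t $ (s \<circ> p) = t $ s}"

text \<open>\<open>v\<^sub>1 \<and> \<dots> \<and> v\<^sub>r\<close> for a list of \<open>r\<close> vectors, \<open>r\<close> being determined by the type of the result;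
  the determinant is \<open>\<Sum>\<^sub>p sign p \<Prod>\<^sub>b (v\<^sub>b)\<^sub>s\<^sub>(\<^sub>p\<^sub>(\<^sub>b\<^sub>)\<^sub>)\<close>.\<close>

definition wedge :: "(real^'i) list \<Rightarrow> real^('r::{finite,linorder} \<Rightarrow> 'i::finite)" where
  "wedge vs = (\<chi> s. det (\<chi> a b. vs ! card {c::'r. c < b} $ s a))"

definition dual_mat :: "real^'i^'i \<Rightarrow> real^'i^'i::finite" where
  "dual_mat g = transpose (matrix_inv g)"

text \<open>\<open>\<otimes>\<^sup>k (\<real>\<^sup>m)\<^sup>* \<otimes> \<otimes>\<^sup>r \<real>\<^sup>m\<close>\<close>

definition mixed_act :: "real^'i^'i \<Rightarrow> real^(('k::finite \<Rightarrow> 'i::finite) \<times> ('r::finite \<Rightarrow> 'i)) \<Rightarrow>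
    real^(('k \<Rightarrow> 'i) \<times> ('r \<Rightarrow> 'i))" where
  "mixed_act g t = (\<chi> q. \<Sum>q'\<in>UNIV. (\<Prod>a\<in>UNIV. dual_mat g $ fst q a $ fst q' a)
     * (\<Prod>b\<in>UNIV. g $ snd q b $ snd q' b) * t $ q')"

text \<open>The tensor product of the highest weight vectors \<open>(e\<^sub>n\<^sup>*)\<^sup>k\<close> of \<open>S\<^sup>k \<real>\<^sup>(\<^sup>n\<^sup>+\<^sup>1\<^sup>)\<^sup>*\<close> and
  \<open>e\<^sub>0 \<and> \<dots> \<and> e\<^sub>r\<^sub>-\<^sub>1\<close> of \<open>\<Lambda>\<^sup>r \<real>\<^sup>n\<^sup>+\<^sup>1\<close>, for the Borel subgroup of upper triangular matrices. It
  generates the Cartan product.\<close>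

definition highest_weight_vector ::
    "real^(('k::finite \<Rightarrow> 'n::{finite,linorder} option) \<times> ('r::{finite,linorder} \<Rightarrow> 'n option))" where
  "highest_weight_vector = (\<chi> q. (\<Prod>a\<in>UNIV. axis (Some (Max UNIV)) 1 $ fst q a)
     * (wedge (take CARD('r) (map (\<lambda>a. axis a 1)
          (None # map Some (sorted_list_of_set UNIV)))) :: real^('r \<Rightarrow> 'n option)) $ snd q)"

definition cartan_product ::
    "(real^(('k::finite \<Rightarrow> 'n::{finite,linorder} option) \<times> ('r::{finite,linorder} \<Rightarrow> 'n option))) set" where
  "cartan_product = span ((\<lambda>g. mixed_act g highest_weight_vector) ` SL)"


section \<open>BGG operators\<close>

text \<open>A representation \<open>\<V>\<close> of \<open>G\<close>, given by a subspace and an action, a representation of \<open>P\<close>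
  given in the same way, and an isomorphism onto it from \<open>\<V>/(\<pp>\<^sub>+ \<cdot> \<V>)\<close>. Elements of the
  quotient are cosets.\<close>

record ('n, 'v, 'w) bgg_data =
  bgg_space :: "'v set"
  bgg_act :: "'n mat \<Rightarrow> 'v \<Rightarrow> 'v"
  h0_space :: "'w set"
  h0_act :: "'n mat \<Rightarrow> 'w \<Rightarrow> 'w"
  h0_iso :: "'v set \<Rightarrow> 'w"

definition inf_act :: "('n::finite, 'v::euclidean_space, 'w) bgg_data \<Rightarrow> 'n sl \<Rightarrow> 'v \<Rightarrow> 'v" where
  "inf_act V Y v = vector_derivative (\<lambda>t. bgg_act V (mexp (t *\<^sub>R sl_mat Y)) v) (at 0)"

definition h0_class :: "('n::finite, 'v::euclidean_space, 'w) bgg_data \<Rightarrow> 'v \<Rightarrow> 'v set" where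
  "h0_class V v = {v' \<in> bgg_space V. v' - v \<in> span {inf_act V (gp Z) w | Z w. w \<in> bgg_space V}}"

definition h0_proj :: "('n::finite, 'v::euclidean_space, 'w) bgg_data \<Rightarrow> 'v \<Rightarrow> 'w" where
  "h0_proj V v = h0_iso V (h0_class V v)"

text \<open>The map induced on cosets by a map \<open>f\<close> that is constant on cosets.\<close>

definition coset_map :: "('v \<Rightarrow> 'w) \<Rightarrow> 'v set \<Rightarrow> 'w" where
  "coset_map f Q = (THE w. \<forall>v\<in>Q. f v = w)"

definition tractor_sections :: "('g, 'm, 'n::finite) cartan_geometry \<Rightarrow>
    ('n, 'v::euclidean_space, 'w) bgg_data \<Rightarrow> 'm set \<Rightarrow> ('g \<Rightarrow> 'v) set" where
  "tractor_sections C V U = sections C U (bgg_space V) (bgg_act V)"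

definition h0_sections :: "('g, 'm, 'n::finite) cartan_geometry \<Rightarrow>
    ('n, 'v, 'w::euclidean_space) bgg_data \<Rightarrow> 'm set \<Rightarrow> ('g \<Rightarrow> 'w) set" where
  "h0_sections C V U = sections C U (h0_space V) (h0_act V)"

text \<open>\<open>\<nabla>s\<close> as a function on the total space with values in \<open>L(\<gg>/\<pp>, \<V>)\<close>, where \<open>\<gg>/\<pp>\<close> is
  represented by \<open>\<gg>\<^sub>-\<^sub>1\<close>.\<close>

definition tractor_conn :: "('g, 'm, 'n::finite) cartan_geometry \<Rightarrow>
    ('n, 'v::euclidean_space, 'w) bgg_data \<Rightarrow> ('g \<Rightarrow> 'v) \<Rightarrow> 'g \<Rightarrow> real^'n \<Rightarrow> 'v" where
  "tractor_conn C V s u X = vderiv (cvf C (gm X) u) s + inf_act V (gm X) (s u)"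

definition codiff_image :: "('n::finite, 'v::euclidean_space, 'w) bgg_data \<Rightarrow> (real^'n \<Rightarrow> 'v) set" where
  "codiff_image V = {codiff2 (inf_act V) \<psi> | \<psi>. bilinear \<psi> \<and>
     (\<forall>X Y. \<psi> X Y \<in> bgg_space V \<and> \<psi> Y X = - \<psi> X Y)}"

text \<open>The class in \<open>ker \<partial>\<^sup>*/im \<partial>\<^sup>*\<close> of an element of \<open>ker \<partial>\<^sup>*\<close>, as a coset.\<close>

definition homology_class :: "('n::finite, 'v::euclidean_space, 'w) bgg_data \<Rightarrow>
    (real^'n \<Rightarrow> 'v) \<Rightarrow> (real^'n \<Rightarrow> 'v) set" where
  "homology_class V \<phi> = {(\<lambda>X. \<phi> X + \<theta> X) | \<theta>. \<theta> \<in> codiff_image V}"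

definition BGG_splitting :: "('g, 'm, 'n::finite) cartan_geometry \<Rightarrow>
    ('n, 'v::euclidean_space, 'w::euclidean_space) bgg_data \<Rightarrow> 'm set \<Rightarrow> ('g \<Rightarrow> 'w) \<Rightarrow> ('g \<Rightarrow> 'v) \<Rightarrow> bool" where
  "BGG_splitting C V U \<alpha> s \<longleftrightarrow> s \<in> tractor_sections C V U \<and>
     (\<forall>u\<in>over C U. h0_proj V (s u) = \<alpha> u \<and> codiff1 (inf_act V) (tractor_conn C V s u) = 0)"

definition first_BGG :: "('g, 'm, 'n::finite) cartan_geometry \<Rightarrow>
    ('n, 'v::euclidean_space, 'w::euclidean_space) bgg_data \<Rightarrow> 'm set \<Rightarrow> ('g \<Rightarrow> 'w) \<Rightarrow>
    ('g \<Rightarrow> (real^'n \<Rightarrow> 'v) set) \<Rightarrow> bool" where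
  "first_BGG C V U \<alpha> \<beta> \<longleftrightarrow> \<alpha> \<in> h0_sections C V U \<and> (\<exists>s. BGG_splitting C V U \<alpha> s \<and>
     (\<forall>u\<in>over C U. \<beta> u = homology_class V (tractor_conn C V s u)))"

definition BGG_solution :: "('g, 'm, 'n::finite) cartan_geometry \<Rightarrow>
    ('n, 'v::euclidean_space, 'w::euclidean_space) bgg_data \<Rightarrow> 'm set \<Rightarrow> ('g \<Rightarrow> 'w) \<Rightarrow> bool" where
  "BGG_solution C V U \<alpha> \<longleftrightarrow> first_BGG C V U \<alpha> (\<lambda>u. homology_class V (\<lambda>X. 0))"

definition normal_BGG_solution :: "('g, 'm, 'n::finite) cartan_geometry \<Rightarrow>
    ('n, 'v::euclidean_space, 'w::euclidean_space) bgg_data \<Rightarrow> 'm set \<Rightarrow> ('g \<Rightarrow> 'w) \<Rightarrow> bool" where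
  "normal_BGG_solution C V U \<alpha> \<longleftrightarrow> \<alpha> \<in> h0_sections C V U \<and> (\<exists>s\<in>tractor_sections C V U.
     \<forall>u\<in>over C U. h0_proj V (s u) = \<alpha> u \<and> (\<forall>X. tractor_conn C V s u X = 0))"

text \<open>\<open>\<V> = \<Lambda>\<^sup>r \<real>\<^sup>n\<^sup>+\<^sup>1\<close>, with \<open>\<Lambda>\<^sup>r TM(-r) = \<Lambda>\<^sup>r(TM(-1))\<close>.\<close>

definition ext_bgg :: "('n::finite, real^('r::finite \<Rightarrow> 'n option), real^('r \<Rightarrow> 'n)) bgg_data" where
  "ext_bgg = \<lparr> bgg_space = alternating, bgg_act = tensor_act,
     h0_space = alternating, h0_act = (\<lambda>g. tensor_act (mat_block g)),
     h0_iso = coset_map (\<lambda>t. \<chi> s. t $ (Some \<circ> s)) \<rparr>"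

text \<open>\<open>\<V> = S\<^sup>d \<real>\<^sup>(\<^sup>n\<^sup>+\<^sup>1\<^sup>)\<^sup>*\<close> with \<open>d = CARD('k)\<close>; a symmetric form is evaluated on \<open>e\<^sub>0\<close>.\<close>

definition sym_bgg :: "('n::finite, real^('k::finite \<Rightarrow> 'n option), real) bgg_data" where
  "sym_bgg = \<lparr> bgg_space = symmetric, bgg_act = (\<lambda>g. tensor_act (dual_mat g)),
     h0_space = UNIV, h0_act = density_act (int CARD('k)),
     h0_iso = coset_map (\<lambda>t. t $ (\<lambda>_. None)) \<rparr>"

definition mixed_bgg :: "('n::{finite,linorder},
    real^(('k::finite \<Rightarrow> 'n option) \<times> ('r::{finite,linorder} \<Rightarrow> 'n option)), real^('r \<Rightarrow> 'n)) bgg_data" where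
  "mixed_bgg = \<lparr> bgg_space = cartan_product, bgg_act = mixed_act,
     h0_space = alternating,
     h0_act = (\<lambda>g t. density_act (int CARD('k)) g 1 *\<^sub>R tensor_act (mat_block g) t),
     h0_iso = coset_map (\<lambda>t. \<chi> s. t $ ((\<lambda>_. None), Some \<circ> s)) \<rparr>"


section \<open>The distinguished sections\<close>

text \<open>\<open>\<xi>\<^sub>i\<^sub>1 \<and> \<dots> \<and> \<xi>\<^sub>i\<^sub>r\<close> for \<open>I = {i\<^sub>1 < \<dots> < i\<^sub>r}\<close>, and
  \<open>\<Sum>\<^sub>j x\<^sub>j \<xi>\<^sub>j \<and> \<xi>\<^sub>i\<^sub>1 \<and> \<dots> \<and> \<xi>\<^sub>i\<^sub>r\<^sub>-\<^sub>1\<close> for \<open>J = {i\<^sub>1 < \<dots> < i\<^sub>r\<^sub>-\<^sub>1}\<close>.\<close>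

definition frame_wedge :: "('g, 'm, 'n::{finite,linorder}) cartan_geometry \<Rightarrow> (real^'n::_) set \<Rightarrow>
    (real^'n::_ \<Rightarrow> 'g) \<Rightarrow> 'n set \<Rightarrow> 'g \<Rightarrow> real^('r::{finite,linorder} \<Rightarrow> 'n)" where
  "frame_wedge C B \<Phi> I u = wedge (map (\<lambda>i. nframe_TM C B \<Phi> i u) (sorted_list_of_set I))"

definition euler_wedge :: "('g, 'm, 'n::{finite,linorder}) cartan_geometry \<Rightarrow> (real^'n::_) set \<Rightarrow>
    (real^'n::_ \<Rightarrow> 'g) \<Rightarrow> 'n set \<Rightarrow> 'g \<Rightarrow> real^('r::{finite,linorder} \<Rightarrow> 'n)" where
  "euler_wedge C B \<Phi> J u = (\<Sum>j\<in>UNIV. ncoord C B \<Phi> (prj C u) $ j *\<^sub>R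
     wedge (nframe_TM C B \<Phi> j u # map (\<lambda>i. nframe_TM C B \<Phi> i u) (sorted_list_of_set J)))"

definition idx :: "'r::finite itself \<Rightarrow> 'n::finite set set" where
  "idx _ = {I. card I = CARD('r)}"

definition idx' :: "'r::finite itself \<Rightarrow> 'n::finite set set" where
  "idx' _ = {J. Suc (card J) = CARD('r)}"

text \<open>The linear combination with coefficient functions \<open>c\<close>, \<open>d\<close> on the total space.\<close>

definition wedge_comb :: "('g, 'm, 'n::{finite,linorder}) cartan_geometry \<Rightarrow> (real^'n::_) set \<Rightarrow>
    (real^'n::_ \<Rightarrow> 'g) \<Rightarrow> ('n set \<Rightarrow> 'g \<Rightarrow> real) \<Rightarrow> ('n set \<Rightarrow> 'g \<Rightarrow> real) \<Rightarrow>
    'g \<Rightarrow> real^('r::{finite,linorder} \<Rightarrow> 'n)" where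
  "wedge_comb C B \<Phi> c d u = (\<Sum>I\<in>idx TYPE('r). c I u *\<^sub>R frame_wedge C B \<Phi> I u)
     + (\<Sum>J\<in>idx' TYPE('r). d J u *\<^sub>R euler_wedge C B \<Phi> J u)"

text \<open>The normal data of the homogeneous model: \<open>u\<^sub>0\<close> is the unit element and \<open>\<Phi> = exp\<close> on all of
  \<open>\<gg>\<^sub>-\<^sub>1\<close>.\<close>

definition flat_lift :: "real^'n::finite \<Rightarrow> 'n mat" where
  "flat_lift X = mexp (sl_mat (gm X))"

abbreviation flat_dom :: "(real^('n::finite option)) set" where
  "flat_dom \<equiv> chart_dom (flat_model :: ('n mat, real^('n option), 'n) cartan_geometry) UNIV flat_lift"

end

theory Submission
  imports Defs
begin

text \<open>
  Write \<open>m = (exp(X) g)\<^sup>-\<^sup>1\<close> for a point \<open>u = \<Phi>(X) g\<close> over the normal chart, with \<open>g\<close> in \<open>P\<close>. The whole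
  theorem rests on one formula: a parallel section \<open>s\<close> of a tractor bundle is \<open>s(u) = m \<cdot> v\<close> with the
  constant vector \<open>v = s(u\<^sub>0)\<close>. Indeed, along the flow line of the constant vector field of \<open>X\<close> in
  \<open>\<gg>\<^sub>-\<^sub>1\<close> the equation \<open>\<nabla>s = 0\<close> is the linear differential equation \<open>y' = - X \<cdot> y\<close>, so
  \<open>s(\<Phi>(X)) = exp(-X) \<cdot> v\<close> (\<open>parallel_along_flow\<close>), and equivariance gives the rest
  (\<open>normal_solution_form\<close>).

  A normal solution is the projection of \<open>m \<cdot> v\<close> to the quotient, so (1), (2), (3) become statements about
  the single matrix \<open>m\<close>. Since \<open>exp(X) e\<^sub>0 = e\<^sub>0 + X\<close> and \<open>exp(X)\<close> fixes the other basis vectors, the first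
  column of \<open>exp(X) g\<close> consists of the values of the \<open>X\<^sup>a\<close> (\<open>normal_data_hom_coord\<close>), while modulo \<open>e\<^sub>0\<close> the
  matrix \<open>m\<close> sends \<open>e\<^sub>i\<close> to \<open>\<xi>\<^sub>i\<close> and \<open>e\<^sub>0\<close> to \<open>- \<Sum>\<^sub>j x\<^sub>j \<xi>\<^sub>j\<close>. Hence \<open>e\<^sub>I\<close> goes to \<open>\<xi>\<^sub>I\<close> and
  \<open>e\<^sub>0 \<and> e\<^sub>J\<close> to the negative of the second kind of section in (1) (\<open>wedge_comb_comb_tensor\<close>); a symmetric
  form \<open>t\<close> goes to its value at \<open>exp(X) g e\<^sub>0\<close>, a polynomial in the \<open>X\<^sup>a\<close> (\<open>sym_act_hom_coord\<close>); and for
  (3) one applies both to an element of \<open>S\<^sup>k\<^sup>-\<^sup>1 \<otimes> \<Lambda>\<^sup>r\<close> (\<open>mixed_act_hom_coord\<close>).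

  On the homogeneous model the flow of a constant vector field is right multiplication by \<open>exp(tX)\<close>
  (\<open>cvf_flat_deriv\<close>, by means of an explicit chart of \<open>SL\<close>). So \<open>u \<mapsto> u\<^sup>-\<^sup>1 \<cdot> v\<close> is parallel for every \<open>v\<close>,
  and all sections of the above form are solutions (\<open>flat_solution\<close>). Conversely, let \<open>\<sigma>\<close> be a solution on
  \<open>\<Lambda>\<^sup>r TM(-r)\<close> in the normal frame. The image of \<open>\<partial>\<^sup>*\<close> lies in the maps with values in \<open>e\<^sub>0 \<and> \<Lambda>\<^sup>r\<^sup>-\<^sup>1\<close>, so the
  equation says that \<open>d\<sigma>(X) = - X \<and> \<rho>\<close> for some function \<open>\<rho>\<close>. For \<open>r < n\<close> this forces \<open>\<sigma>\<close> to be
  \<open>\<sigma>(0) - x \<and> \<rho>(0)\<close> (\<open>affine_from_gradient\<close>), which is again the projection of some \<open>u\<^sup>-\<^sup>1 \<cdot> v\<close>.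
\<close>

section \<open>Calculus of smooth maps\<close>

lemma Ck_on_continuous: "Ck_on k S f \<Longrightarrow> continuous_on S f"
proof (cases k)
  case (Suc m)
  assume "Ck_on k S f"
  then obtain f' where "\<forall>x\<in>S. (f has_derivative f' x) (at x)"
    unfolding Suc Ck_on.simps(2) by blast
  then show ?thesis
    by (meson continuous_at_imp_continuous_on has_derivative_continuous)
qed simp

lemma Ck_on_SucI:
  "(\<And>x. x \<in> S \<Longrightarrow> (f has_derivative f' x) (at x)) \<Longrightarrow> (\<And>v. Ck_on k S (\<lambda>x. f' x v)) \<Longrightarrow> Ck_on (Suc k) S f"
  by auto

lemma Ck_on_SucE:
  assumes "Ck_on (Suc k) S f"
  obtains f' where "\<forall>x\<in>S. (f has_derivative f' x) (at x)" "\<forall>v. Ck_on k S (\<lambda>x. f' x v)"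
  using assms unfolding Ck_on.simps(2) by blast

lemma Ck_on_Suc_imp: "Ck_on (Suc k) S f \<Longrightarrow> Ck_on k S f"
proof (induction k arbitrary: f)
  case 0 then show ?case unfolding Ck_on.simps(1)[of S f] by (rule Ck_on_continuous)
next
  case (Suc k)
  obtain f' where A: "\<forall>x\<in>S. (f has_derivative f' x) (at x)" and B: "\<forall>v. Ck_on (Suc k) S (\<lambda>x. f' x v)"
    using Suc.prems by (rule Ck_on_SucE)
  note A = A[rule_format] and B = B[rule_format]
  show ?case by (rule Ck_on_SucI, erule A, rule Suc.IH, rule B)
qed

lemma Ck_on_subset: "Ck_on k S f \<Longrightarrow> T \<subseteq> S \<Longrightarrow> Ck_on k T f"
proof (induction k arbitrary: f)
  case (Suc k)
  obtain f' where A: "\<forall>x\<in>S. (f has_derivative f' x) (at x)" and B: "\<forall>v. Ck_on k S (\<lambda>x. f' x v)"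
    using Suc.prems(1) by (rule Ck_on_SucE)
  note A = A[rule_format] and B = B[rule_format]
  show ?case by (rule Ck_on_SucI, rule A, erule subsetD[OF Suc.prems(2)], rule Suc.IH, rule B, rule Suc.prems(2))
qed (simp, erule (1) continuous_on_subset)

lemma Ck_on_cong:
  assumes "open S" "\<And>x. x \<in> S \<Longrightarrow> f x = g x" "Ck_on k S f"
  shows "Ck_on k S g"
proof (cases k)
  case 0 with assms show ?thesis by (simp cong: continuous_on_cong)
next
  case (Suc m)
  obtain f' where A: "\<forall>x\<in>S. (f has_derivative f' x) (at x)" and B: "\<forall>v. Ck_on m S (\<lambda>x. f' x v)"
    using assms(3)[unfolded Suc] by (rule Ck_on_SucE)
  note A = A[rule_format] and B = B[rule_format]
  have A': "(g has_derivative f' x) (at x)" if "x \<in> S" for x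
    by (rule has_derivative_transform_within_open[OF A[OF that] assms(1) that assms(2)])
  show ?thesis unfolding Suc by (rule Ck_on_SucI, erule A', rule B)
qed

lemma Ck_on_const: "Ck_on k S (\<lambda>x. c)"
proof (induction k arbitrary: c)
  case (Suc k)
  show ?case by (rule Ck_on_SucI, rule has_derivative_const, rule Suc.IH)
qed simp

lemma Ck_on_linear_image:
  assumes "bounded_linear L" "Ck_on k S f"
  shows "Ck_on k S (\<lambda>x. L (f x))"
  using assms(2)
proof (induction k arbitrary: f)
  case 0 then show ?case using assms(1) by (simp add: bounded_linear.continuous_on)
next
  case (Suc k)
  obtain f' where A: "\<forall>x\<in>S. (f has_derivative f' x) (at x)" and B: "\<forall>v. Ck_on k S (\<lambda>x. f' x v)"
    using Suc.prems by (rule Ck_on_SucE)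
  note A = A[rule_format] and B = B[rule_format]
  show ?case
    by (rule Ck_on_SucI, rule bounded_linear.has_derivative[OF assms(1)], erule A, rule Suc.IH, rule B)
qed

lemma Ck_on_ident: "Ck_on k S (\<lambda>x. x)"
proof (cases k)
  case (Suc m)
  show ?thesis unfolding Suc by (rule Ck_on_SucI, rule has_derivative_ident, rule Ck_on_const)
qed (simp add: continuous_on_id)

lemma Ck_on_add:
  assumes "Ck_on k S f" "Ck_on k S g"
  shows "Ck_on k S (\<lambda>x. f x + g x)"
  using assms
proof (induction k arbitrary: f g)
  case 0 then show ?case by (simp add: continuous_on_add)
next
  case (Suc k)
  obtain f' where A: "\<forall>x\<in>S. (f has_derivative f' x) (at x)" and B: "\<forall>v. Ck_on k S (\<lambda>x. f' x v)"
    using Suc.prems(1) by (rule Ck_on_SucE)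
  note A = A[rule_format] and B = B[rule_format]
  obtain g' where A': "\<forall>x\<in>S. (g has_derivative g' x) (at x)" and B': "\<forall>v. Ck_on k S (\<lambda>x. g' x v)"
    using Suc.prems(2) by (rule Ck_on_SucE)
  note A' = A'[rule_format] and B' = B'[rule_format]
  show ?case
    by (rule Ck_on_SucI, rule has_derivative_add, erule A, erule A', rule Suc.IH, rule B, rule B')
qed

lemma Ck_on_bilinear:
  assumes "bounded_bilinear \<beta>" "Ck_on k S f" "Ck_on k S g"
  shows "Ck_on k S (\<lambda>x. \<beta> (f x) (g x))"
  using assms(2,3)
proof (induction k arbitrary: f g)
  case 0 then show ?case using assms(1) by (simp add: bounded_bilinear.continuous_on)
next
  case (Suc k)
  obtain f' where A: "\<forall>x\<in>S. (f has_derivative f' x) (at x)" and B: "\<forall>v. Ck_on k S (\<lambda>x. f' x v)"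
    using Suc.prems(1) by (rule Ck_on_SucE)
  note A = A[rule_format] and B = B[rule_format]
  obtain g' where A': "\<forall>x\<in>S. (g has_derivative g' x) (at x)" and B': "\<forall>v. Ck_on k S (\<lambda>x. g' x v)"
    using Suc.prems(2) by (rule Ck_on_SucE)
  note A' = A'[rule_format] and B' = B'[rule_format]
  have D: "Ck_on k S (\<lambda>x. \<beta> (f x) (g' x v) + \<beta> (f' x v) (g x))" for v
    by (rule Ck_on_add; rule Suc.IH) (rule B B' Suc.prems[THEN Ck_on_Suc_imp])+
  show ?case
    by (rule Ck_on_SucI, rule bounded_bilinear.FDERIV[OF assms(1)], erule A, erule A', rule D)
qed

lemma Ck_on_sum:
  assumes "\<And>i. i \<in> I \<Longrightarrow> Ck_on k S (f i)"
  shows "Ck_on k S (\<lambda>x. \<Sum>i\<in>I. f i x)"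
  using assms by (induction I rule: infinite_finite_induct) (simp_all add: Ck_on_const Ck_on_add)

text \<open>The chain rule gives \<open>f' (g x) (g' x v)\<close>, where both the function and its argument depend on \<open>x\<close>.
  Expanding the argument in the standard basis turns this into a sum of products of \<open>C\<^sup>k\<close> functions, to
  which the induction hypothesis applies.\<close>

lemma Ck_on_compose:
  fixes g :: "'a::euclidean_space \<Rightarrow> 'b::euclidean_space"
  assumes "Ck_on k T f" "Ck_on k S g" "g ` S \<subseteq> T"
  shows "Ck_on k S (\<lambda>x. f (g x))"
  using assms(1,2)
proof (induction k arbitrary: f)
  case 0
  then have "continuous_on T f" "continuous_on S g" by simp_all
  then show ?case using continuous_on_compose2 assms(3) by (simp, blast)
next
  case (Suc k)
  obtain f' where A: "\<forall>x\<in>T. (f has_derivative f' x) (at x)" and B: "\<forall>v. Ck_on k T (\<lambda>x. f' x v)"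
    using Suc.prems(1) by (rule Ck_on_SucE)
  note A = A[rule_format] and B = B[rule_format]
  obtain g' where A': "\<forall>x\<in>S. (g has_derivative g' x) (at x)" and B': "\<forall>v. Ck_on k S (\<lambda>x. g' x v)"
    using Suc.prems(2) by (rule Ck_on_SucE)
  note A' = A'[rule_format] and B' = B'[rule_format]
  have df: "(f has_derivative f' (g x)) (at (g x))" if "x \<in> S" for x
    using that assms(3) by (intro A) blast
  have eq: "f' (g x) (g' x v) = (\<Sum>b\<in>Basis. (g' x v \<bullet> b) *\<^sub>R f' (g x) b)" if "x \<in> S" for x v
  proof -
    have lin: "linear (f' (g x))"
      by (rule has_derivative_linear[OF df[OF that]])
    have "f' (g x) (g' x v) = f' (g x) (\<Sum>b\<in>Basis. (g' x v \<bullet> b) *\<^sub>R b)"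
      unfolding euclidean_representation ..
    then show ?thesis
      unfolding linear_sum[OF lin] linear_cmul[OF lin] .
  qed
  have D: "Ck_on k S (\<lambda>x. \<Sum>b\<in>Basis. (g' x v \<bullet> b) *\<^sub>R f' (g x) b)" for v
  proof (intro Ck_on_sum Ck_on_bilinear[OF bounded_bilinear_scaleR])
    fix b :: 'b
    show "Ck_on k S (\<lambda>x. f' (g x) b)"
      by (rule Suc.IH[of "\<lambda>y. f' y b"], rule B, rule Ck_on_Suc_imp[OF Suc.prems(2)])
    show "Ck_on k S (\<lambda>x. g' x v \<bullet> b)"
      by (rule Ck_on_linear_image[OF bounded_linear_inner_left], rule B')
  qed
  have E: "((\<lambda>x. f (g x)) has_derivative (\<lambda>v. \<Sum>b\<in>Basis. (g' x v \<bullet> b) *\<^sub>R f' (g x) b)) (at x)"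
    if "x \<in> S" for x
    using has_derivative_compose[OF A'[OF that] df[OF that]] unfolding eq[OF that] .
  show ?case by (rule Ck_on_SucI, erule E, rule D)
qed

lemma Ck_on_inverse: "Ck_on k {x. x \<noteq> 0} (inverse :: real \<Rightarrow> real)"
proof (induction k)
  case 0 show ?case by (simp add: continuous_on_inverse)
next
  case (Suc k)
  have B: "Ck_on k {x. x \<noteq> 0} (\<lambda>x. (- v) *\<^sub>R (inverse x * inverse x :: real))" for v
    by (intro Ck_on_linear_image[OF bounded_linear_scaleR_right]
        Ck_on_bilinear[OF bounded_bilinear_mult] Suc)
  have A: "((inverse :: real \<Rightarrow> real) has_derivative (\<lambda>v. (- v) *\<^sub>R (inverse x * inverse x))) (at x)"
    if "x \<in> {x. x \<noteq> 0}" for x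
    using that by (auto intro!: derivative_eq_intros)
  show ?case by (rule Ck_on_SucI, erule A, rule B)
qed

lemma Ck_on_sqrt: "Ck_on k {0<..} sqrt"
proof (induction k)
  case 0 show ?case by (simp add: continuous_on_real_sqrt)
next
  case (Suc k)
  have 1: "Ck_on k {0<..} (\<lambda>x. inverse (sqrt x))"
    by (rule Ck_on_compose[OF Ck_on_inverse Suc]) auto
  have B: "Ck_on k {0<..} (\<lambda>x. (v / 2) *\<^sub>R inverse (sqrt x))" for v
    by (intro Ck_on_linear_image[OF bounded_linear_scaleR_right] 1)
  have A: "(sqrt has_derivative (\<lambda>v. (v / 2) *\<^sub>R inverse (sqrt x))) (at x)" if "x \<in> {0<..}" for x
    using that by (auto intro!: derivative_eq_intros simp: field_simps)
  show ?case by (rule Ck_on_SucI, erule A, rule B)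
qed

named_theorems smooth_rules

lemma smooth_on_continuous: "smooth_on S f \<Longrightarrow> continuous_on S f"
  unfolding smooth_on_def by (rule Ck_on_continuous) (rule spec)

lemma smooth_on_subset: "smooth_on S f \<Longrightarrow> T \<subseteq> S \<Longrightarrow> smooth_on T f"
  unfolding smooth_on_def by (intro allI, rule Ck_on_subset[of _ S f T]) blast+

lemma smooth_on_cong:
  "open S \<Longrightarrow> (\<And>x. x \<in> S \<Longrightarrow> f x = g x) \<Longrightarrow> smooth_on S f \<Longrightarrow> smooth_on S g"
  unfolding smooth_on_def by (intro allI, rule Ck_on_cong[of S f g]) blast+

lemma smooth_on_const [smooth_rules]: "smooth_on S (\<lambda>x. c)"
  by (simp add: smooth_on_def Ck_on_const)

lemma smooth_on_ident [smooth_rules]: "smooth_on S (\<lambda>x. x)"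
  by (simp add: smooth_on_def Ck_on_ident)

lemma smooth_on_linear_image:
  "bounded_linear L \<Longrightarrow> smooth_on S f \<Longrightarrow> smooth_on S (\<lambda>x. L (f x))"
  by (simp add: smooth_on_def Ck_on_linear_image)

lemma smooth_on_add [smooth_rules]: "smooth_on S f \<Longrightarrow> smooth_on S g \<Longrightarrow> smooth_on S (\<lambda>x. f x + g x)"
  by (simp add: smooth_on_def Ck_on_add)

lemma smooth_on_bilinear:
  "bounded_bilinear B \<Longrightarrow> smooth_on S f \<Longrightarrow> smooth_on S g \<Longrightarrow> smooth_on S (\<lambda>x. B (f x) (g x))"
  by (simp add: smooth_on_def Ck_on_bilinear)

lemmas smooth_on_scaleR [smooth_rules] = smooth_on_bilinear[OF bounded_bilinear_scaleR]
  and smooth_on_mult [smooth_rules] = smooth_on_bilinear[OF bounded_bilinear_mult]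
  and smooth_on_inner [smooth_rules] = smooth_on_bilinear[OF bounded_bilinear_inner]

lemma smooth_on_minus [smooth_rules]: "smooth_on S f \<Longrightarrow> smooth_on S (\<lambda>x. - f x)"
  by (rule smooth_on_linear_image[OF bounded_linear_minus[OF bounded_linear_ident]])

lemma smooth_on_diff [smooth_rules]: "smooth_on S f \<Longrightarrow> smooth_on S g \<Longrightarrow> smooth_on S (\<lambda>x. f x - g x)"
  using smooth_on_add[OF _ smooth_on_minus] by force

lemma smooth_on_sum [smooth_rules]:
  "(\<And>i. i \<in> I \<Longrightarrow> smooth_on S (f i)) \<Longrightarrow> smooth_on S (\<lambda>x. \<Sum>i\<in>I. f i x)"
  by (simp add: smooth_on_def Ck_on_sum)

lemma smooth_on_prod [smooth_rules]:
  fixes f :: "'i \<Rightarrow> 'a::euclidean_space \<Rightarrow> real"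
  shows "(\<And>i. i \<in> I \<Longrightarrow> smooth_on S (f i)) \<Longrightarrow> smooth_on S (\<lambda>x. \<Prod>i\<in>I. f i x)"
  by (induction I rule: infinite_finite_induct) (simp_all add: smooth_on_const smooth_on_mult)

lemma smooth_on_compose:
  fixes g :: "'a::euclidean_space \<Rightarrow> 'b::euclidean_space"
  shows "smooth_on T f \<Longrightarrow> smooth_on S g \<Longrightarrow> g ` S \<subseteq> T \<Longrightarrow> smooth_on S (\<lambda>x. f (g x))"
  unfolding smooth_on_def by (intro allI, rule Ck_on_compose[of _ T f S g]) blast+

lemma smooth_on_inverse_real: "smooth_on {x. x \<noteq> 0} (inverse :: real \<Rightarrow> real)"
  unfolding smooth_on_def by (rule allI) (rule Ck_on_inverse)

lemma smooth_on_sqrt: "smooth_on {0<..} sqrt"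
  unfolding smooth_on_def by (rule allI) (rule Ck_on_sqrt)

lemma smooth_on_inverse [smooth_rules]:
  fixes f :: "'a::euclidean_space \<Rightarrow> real"
  assumes "smooth_on S f" "\<And>x. x \<in> S \<Longrightarrow> f x \<noteq> 0"
  shows "smooth_on S (\<lambda>x. inverse (f x))"
  by (rule smooth_on_compose[where T="{x. x \<noteq> 0}"]) (use assms in \<open>simp_all add: smooth_on_inverse_real image_subset_iff\<close>)

lemma smooth_on_divide [smooth_rules]:
  fixes f :: "'a::euclidean_space \<Rightarrow> real"
  assumes "smooth_on S f" "smooth_on S g" "\<And>x. x \<in> S \<Longrightarrow> g x \<noteq> 0"
  shows "smooth_on S (\<lambda>x. f x / g x)"
  unfolding divide_inverse by (intro smooth_rules assms)

lemma smooth_on_sgn: "smooth_on (- {0}) (sgn :: 'a::euclidean_space \<Rightarrow> 'a)"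
proof -
  have "smooth_on (- {0}) (\<lambda>x::'a. inverse (sqrt (x \<bullet> x)) *\<^sub>R x)"
    by (intro smooth_on_scaleR smooth_on_inverse smooth_on_ident smooth_on_inner
        smooth_on_compose[OF smooth_on_sqrt]) auto
  then show ?thesis
    by (simp add: sgn_div_norm[abs_def] norm_eq_sqrt_inner)
qed

lemma smooth_on_componentwise:
  assumes "\<And>i. smooth_on S (\<lambda>x. f x $ i)"
  shows "smooth_on S (f :: _ \<Rightarrow> 'b::euclidean_space ^ 'i::finite)"
proof -
  have lin: "bounded_linear (axis i :: 'b \<Rightarrow> 'b ^ 'i)" for i
    by (intro linear_conv_bounded_linear[THEN iffD1] linearI) (simp_all add: vec_eq_iff axis_def)
  have "smooth_on S (\<lambda>x. \<Sum>i\<in>UNIV. axis i (f x $ i))"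
    by (intro smooth_on_sum smooth_on_linear_image[OF lin] assms)
  moreover have "(\<lambda>x. \<Sum>i\<in>UNIV. axis i (f x $ i)) = f"
    by (auto simp: fun_eq_iff vec_eq_iff axis_def)
  ultimately show ?thesis by simp
qed

lemma smooth_on_vec_nth [smooth_rules]:
  "smooth_on S f \<Longrightarrow> smooth_on S (\<lambda>x. f x $ i)"
  by (rule smooth_on_linear_image[OF bounded_linear_vec_nth])

lemma smooth_on_vec_lambda [smooth_rules]:
  "(\<And>i. smooth_on S (\<lambda>x. f x i)) \<Longrightarrow> smooth_on S (\<lambda>x. (\<chi> i. f x i) :: 'b::euclidean_space ^ 'i::finite)"
  by (rule smooth_on_componentwise) simp

lemma smooth_on_fst [smooth_rules]: "smooth_on S f \<Longrightarrow> smooth_on S (\<lambda>x. fst (f x))"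
  and smooth_on_snd [smooth_rules]: "smooth_on S f \<Longrightarrow> smooth_on S (\<lambda>x. snd (f x))"
  by (auto intro: smooth_on_linear_image bounded_linear_fst bounded_linear_snd)

lemma smooth_on_det [smooth_rules]:
  fixes f :: "_ \<Rightarrow> real^'i^'i::finite"
  assumes "smooth_on S f" shows "smooth_on S (\<lambda>x. det (f x))"
  unfolding det_def by (intro smooth_rules assms)

lemma smooth_on_matrix_mult [smooth_rules]:
  fixes f :: "_ \<Rightarrow> real^'k^'i" and g :: "_ \<Rightarrow> real^'j^'k::finite"
  assumes "smooth_on S f" "smooth_on S g" shows "smooth_on S (\<lambda>x. f x ** g x)"
  unfolding matrix_matrix_mult_def by (intro smooth_rules assms)

lemma smooth_on_has_derivative:
  assumes "smooth_on S f" "x \<in> S"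
  shows "(f has_derivative frechet_derivative f (at x)) (at x)"
proof -
  from assms have "Ck_on (Suc 0) S f" by (simp add: smooth_on_def del: Ck_on.simps)
  then obtain f' where "\<forall>x\<in>S. (f has_derivative f' x) (at x)" by (rule Ck_on_SucE)
  then have "f differentiable (at x)" using assms(2) unfolding differentiable_def by blast
  then show ?thesis by (rule frechet_derivative_works[THEN iffD1])
qed

section \<open>Matrices, the groups, and unipotent exponentials\<close>

lemma matrix_inv_unique:
  fixes A B :: "real^'i^'i::finite"
  assumes "A ** B = mat 1" shows "matrix_inv A = B"
proof -
  have BA: "B ** A = mat 1" using assms matrix_left_right_inverse by blast
  have "A ** matrix_inv A = mat 1 \<and> matrix_inv A ** A = mat 1"
    unfolding matrix_inv_def by (rule someI[of _ B]) (use assms BA in blast)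
  then have "matrix_inv A = matrix_inv A ** (A ** B)" using assms by (simp add: matrix_mul_rid)
  also have "\<dots> = B" using \<open>_ \<and> _\<close> by (simp add: matrix_mul_assoc matrix_mul_lid)
  finally show ?thesis .
qed

lemma matrix_inv_right [simp]:
  fixes A :: "real^'i^'i::finite"
  assumes "det A \<noteq> 0" shows "A ** matrix_inv A = mat 1"
proof -
  obtain B where "A ** B = mat 1"
    using assms unfolding invertible_det_nz[symmetric] invertible_def by blast
  then show ?thesis using matrix_inv_unique by metis
qed

lemma matrix_inv_left [simp]:
  fixes A :: "real^'i^'i::finite"
  assumes "det A \<noteq> 0" shows "matrix_inv A ** A = mat 1"
  using matrix_inv_right[OF assms] matrix_left_right_inverse by blast

lemma det_matrix_inv:
  fixes A :: "real^'i^'i::finite"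
  assumes "det A \<noteq> 0" shows "det (matrix_inv A) = 1 / det A"
  using assms det_mul[of A "matrix_inv A"] by (simp add: field_simps)

lemma matrix_inv_matrix_inv:
  fixes A :: "real^'i^'i::finite"
  assumes "det A \<noteq> 0" shows "matrix_inv (matrix_inv A) = A"
  using assms by (intro matrix_inv_unique) simp

lemma matrix_inv_mult:
  fixes A B :: "real^'i^'i::finite"
  assumes "det A \<noteq> 0" "det B \<noteq> 0"
  shows "matrix_inv (A ** B) = matrix_inv B ** matrix_inv A"
proof (rule matrix_inv_unique)
  have "A ** B ** (matrix_inv B ** matrix_inv A) = A ** (B ** matrix_inv B) ** matrix_inv A"
    by (simp only: matrix_mul_assoc)
  then show "A ** B ** (matrix_inv B ** matrix_inv A) = mat 1" using assms by simp
qed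

lemma matrix_inv_component:
  fixes A :: "real^'i^'i::finite"
  assumes "det A \<noteq> 0"
  shows "matrix_inv A $ k $ l = det (\<chi> i j. if j = k then (if i = l then 1 else 0) else A $ i $ j) / det A"
proof -
  have "A *v (matrix_inv A *v axis l 1) = axis l 1"
    using assms by (simp add: matrix_vector_mul_assoc)
  from cramer[OF assms, THEN iffD1, OF this]
  have "(matrix_inv A *v axis l 1) $ k = det (\<chi> i j. if j = k then axis l 1 $ i else A $ i $ j) / det A"
    by simp
  moreover have "(matrix_inv A *v axis l 1) $ k = matrix_inv A $ k $ l"
    by (simp add: matrix_vector_mul_component inner_axis)
  moreover have "(\<chi> i j. if j = k then axis l (1::real) $ i else A $ i $ j)
      = (\<chi> i j. if j = k then (if i = l then 1 else 0) else A $ i $ j)"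
    by (simp add: vec_eq_iff axis_def)
  ultimately show ?thesis by simp
qed

lemma open_det_nonzero: "open {g :: real^'i^'i::finite. det g \<noteq> 0}"
proof -
  have "continuous_on UNIV (det :: real^'i^'i \<Rightarrow> real)"
    by (rule smooth_on_continuous) (rule smooth_on_det, rule smooth_on_ident)
  then show ?thesis
    using open_Collect_neq[OF _ continuous_on_const[of UNIV "0::real"]] by blast
qed

text \<open>By Cramer's rule the entries are quotients of determinants.\<close>

lemma smooth_on_matrix_inv: "smooth_on {g :: real^'i^'i::finite. det g \<noteq> 0} matrix_inv"
proof -
  have *: "smooth_on {g. det g \<noteq> 0} (\<lambda>g :: real^'i^'i. if j = k then c else g $ i $ j)" for i j k :: 'i and c :: real
    by (cases "j = k") (simp_all add: smooth_on_const smooth_on_vec_nth smooth_on_ident)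
  have **: "smooth_on {g. det g \<noteq> 0}
      (\<lambda>g :: real^'i^'i. (\<chi> k l. det (\<chi> i j. if j = k then (if i = l then 1 else 0) else g $ i $ j) / det g))"
    by (intro smooth_on_vec_lambda smooth_on_divide smooth_on_det * smooth_on_ident) simp
  show ?thesis
    by (rule smooth_on_cong[OF open_det_nonzero _ **]) (simp add: vec_eq_iff matrix_inv_component)
qed

lemma SL_mult: "g \<in> SL \<Longrightarrow> h \<in> SL \<Longrightarrow> g ** h \<in> SL"
  by (simp add: SL_def det_mul)

lemma SL_inv: "g \<in> SL \<Longrightarrow> matrix_inv g \<in> SL"
  by (simp add: SL_def det_matrix_inv)

lemma SL_one: "mat 1 \<in> SL"
  by (simp add: SL_def)

lemma SL_det: "g \<in> SL \<Longrightarrow> det g = 1"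
  by (simp add: SL_def)

lemma mult_axis: "(g *v axis j 1) $ i = (g :: real^'i^'j::finite) $ i $ j"
  by (simp add: matrix_vector_mul_component inner_axis)

lemma Pgrp_SL: "g \<in> Pgrp \<Longrightarrow> g \<in> SL"
  by (simp add: Pgrp_def)

text \<open>This form lets statements about \<open>P\<close> be checked on matrix entries.\<close>

lemma Pgrp_iff:
  "g \<in> Pgrp \<longleftrightarrow> g \<in> SL \<and> 0 < g $ None $ None \<and> (\<forall>i. g $ Some i $ None = 0)"
proof -
  have "g *v axis None 1 = c *\<^sub>R axis None 1 \<longleftrightarrow> g $ None $ None = c \<and> (\<forall>i. g $ Some i $ None = 0)" for c
    by (simp add: vec_eq_iff mult_axis split_option_all) (auto simp: axis_def)
  then show ?thesis by (auto simp: Pgrp_def)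
qed

lemma Pgrp_mult: assumes "g \<in> Pgrp" "h \<in> Pgrp" shows "g ** h \<in> Pgrp"
proof -
  have "(g ** h) $ a $ None = g $ a $ None * h $ None $ None" for a
    using assms by (simp add: Pgrp_iff matrix_matrix_mult_def UNIV_option_conv sum.reindex)
  then show ?thesis using assms by (simp add: Pgrp_iff SL_mult)
qed

lemma Pgrp_inv: assumes "g \<in> Pgrp" shows "matrix_inv g \<in> Pgrp"
proof -
  obtain c where c: "c > 0" "g *v axis None 1 = c *\<^sub>R axis None 1" and g: "g \<in> SL"
    using assms by (auto simp: Pgrp_def)
  have "c *\<^sub>R (matrix_inv g *v axis None 1) = matrix_inv g *v (g *v axis None 1)"
    by (simp add: c matrix_vector_mult_scaleR)
  also have "\<dots> = axis None 1" using g by (simp add: matrix_vector_mul_assoc SL_det)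
  finally have *: "c *\<^sub>R (matrix_inv g *v axis None 1) = axis None 1" .
  have "matrix_inv g *v axis None 1 = (1/c) *\<^sub>R (c *\<^sub>R (matrix_inv g *v axis None 1))"
    using c(1) by simp
  then have "matrix_inv g *v axis None 1 = (1/c) *\<^sub>R axis None 1" unfolding * .
  moreover have "1/c > 0" using c by simp
  ultimately show ?thesis using SL_inv[OF g] unfolding Pgrp_def by blast
qed

lemma Pgrp_one: "mat 1 \<in> Pgrp"
  by (simp add: Pgrp_iff SL_one) (simp add: mat_def)

lemma Pgrp_inv_00:
  assumes "g \<in> Pgrp" shows "matrix_inv g $ None $ None = 1 / g $ None $ None"
proof -
  have "g \<in> SL" "0 < g $ None $ None" "\<And>i. g $ Some i $ None = 0"
    using assms by (auto simp: Pgrp_iff)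
  moreover have "(matrix_inv g ** g) $ None $ None = 1"
    using matrix_inv_left[of g] calculation(1) by (simp add: SL_det) (simp add: mat_def)
  ultimately show ?thesis
    by (simp add: matrix_matrix_mult_def UNIV_option_conv sum.reindex field_simps)
qed

text \<open>Only exponentials of elements of \<open>\<gg>\<^sub>-\<^sub>1\<close> and \<open>\<pp>\<^sub>+\<close> occur below, and these matrices square to zero.\<close>

lemma mexp_square_zero: assumes "N ** N = 0" shows "mexp N = mat 1 + N"
proof -
  have *: "((**) N ^^ k) (mat 1) = (if k = 0 then mat 1 else if k = 1 then N else 0)" for k
  proof (induction k)
    case (Suc k) then show ?case using assms by (cases "k = 0") (auto simp: matrix_mul_rid)
  qed simp
  have "mexp N = (\<Sum>k\<in>{0,1}. (1 / fact k) *\<^sub>R (((**) N ^^ k) (mat 1)))"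
    unfolding mexp_def by (rule suminf_finite) (auto simp: *)
  then show ?thesis by (simp add: *)
qed

lemma sl_mat_gm: "sl_mat (gm X) = (\<chi> a b. case (a, b) of (Some i, None) \<Rightarrow> X $ i | _ \<Rightarrow> 0)"
  by (simp add: sl_mat_def vec_eq_iff trace_0 trace_def split: option.split)

lemma sl_mat_gp: "sl_mat (gp Z) = (\<chi> a b. case (a, b) of (None, Some j) \<Rightarrow> Z $ j | _ \<Rightarrow> 0)"
  by (simp add: sl_mat_def vec_eq_iff trace_0 trace_def split: option.split)

lemma scaleR_matrix_mult: "(t *\<^sub>R A) ** (s *\<^sub>R B) = (t * s) *\<^sub>R (A ** (B :: real^'k^'j::finite))"
  for A :: "real^'j^'i"
  by (simp add: matrix_matrix_mult_def vec_eq_iff sum_distrib_left mult_ac)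

lemma sl_mat_gm_mult: "sl_mat (gm X) ** sl_mat (gm Y) = 0"
  by (simp add: sl_mat_gm matrix_matrix_mult_def vec_eq_iff UNIV_option_conv sum.reindex split_option_all)

lemma sl_mat_gp_mult: "sl_mat (gp Z) ** sl_mat (gp Z') = 0"
  by (simp add: sl_mat_gp matrix_matrix_mult_def vec_eq_iff UNIV_option_conv sum.reindex split_option_all)

lemma mexp_gm: "mexp (t *\<^sub>R sl_mat (gm X)) = mat 1 + t *\<^sub>R sl_mat (gm X)"
  by (rule mexp_square_zero) (simp add: scaleR_matrix_mult sl_mat_gm_mult)

lemma mexp_gp: "mexp (t *\<^sub>R sl_mat (gp Z)) = mat 1 + t *\<^sub>R sl_mat (gp Z)"
  by (rule mexp_square_zero) (simp add: scaleR_matrix_mult sl_mat_gp_mult)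

lemma flat_lift_eq: "flat_lift X = mat 1 + sl_mat (gm X)"
  using mexp_gm[of 1 X] by (simp add: flat_lift_def)

lemma sl_mat_gm_scaleR: "t *\<^sub>R sl_mat (gm X) = sl_mat (gm (t *\<^sub>R X))"
  by (simp add: sl_mat_gm vec_eq_iff split: option.split)

lemma mexp_gm_flat_lift: "mexp (t *\<^sub>R sl_mat (gm X)) = flat_lift (t *\<^sub>R X)"
  by (simp only: mexp_gm flat_lift_eq) (simp only: sl_mat_gm_scaleR)

lemma flat_lift_component: "flat_lift X $ a $ b =
   (case b of None \<Rightarrow> (case a of None \<Rightarrow> 1 | Some i \<Rightarrow> X $ i) | Some j \<Rightarrow> if a = Some j then 1 else 0)"
  by (simp add: flat_lift_eq sl_mat_gm mat_def split: option.split)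

lemma sl_mat_gm_add: "sl_mat (gm (X + Y)) = sl_mat (gm X) + sl_mat (gm Y)"
  by (simp add: sl_mat_gm vec_eq_iff split: option.split)

lemma matrix_add_rdistrib: "(A + B) ** C = A ** C + B ** (C :: real^'k^'j::finite)"
  by (simp add: matrix_matrix_mult_def vec_eq_iff sum.distrib distrib_right)

lemma flat_lift_add: "flat_lift X ** flat_lift Y = flat_lift (X + Y)"
  by (simp add: flat_lift_eq sl_mat_gm_add matrix_add_ldistrib matrix_add_rdistrib sl_mat_gm_mult add_ac)

lemma flat_lift_0: "flat_lift 0 = mat 1"
  by (simp add: vec_eq_iff mat_def flat_lift_component split: option.split)

lemma permutes_option_id:
  assumes "p permutes (UNIV :: 'n::finite option set)" "p None = None" "\<And>i. p (Some i) \<in> {None, Some i}"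
  shows "p = id"
proof -
  have "inj p" using assms(1) permutes_inj by blast
  then have "p (Some i) \<noteq> None" for i using assms(2) by (metis inj_eq option.distinct(1))
  then show ?thesis using assms(2,3) by (metis ext id_apply insertE not_None_eq singletonD)
qed

text \<open>In the Leibniz formula a permutation contributes only if it fixes \<open>None\<close> and sends each \<open>Some i\<close>
  to itself or to \<open>None\<close>; being injective, it is the identity.\<close>

lemma det_flat_lift [simp]: "det (flat_lift X) = 1"
proof -
  let ?t = "\<lambda>p. of_int (sign p) * (\<Prod>i\<in>UNIV. flat_lift X $ i $ p i)"
  have "det (flat_lift X) = (\<Sum>p\<in>{id}. ?t p)"
    unfolding det_def
  proof (rule sum.mono_neutral_right)
    show "\<forall>p\<in>{p. p permutes UNIV} - {id}. ?t p = 0"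
    proof
      fix p :: "'a option \<Rightarrow> 'a option" assume p: "p \<in> {p. p permutes UNIV} - {id}"
      then have "p None \<noteq> None \<or> (\<exists>i. p (Some i) \<notin> {None, Some i})"
        using permutes_option_id by blast
      then obtain a where a: "a = None \<and> p None \<noteq> None \<or> (\<exists>i. a = Some i \<and> p (Some i) \<notin> {None, Some i})"
        by blast
      then have "flat_lift X $ a $ p a = 0"
        by (auto simp: flat_lift_component split: option.split)
      then have "\<exists>a. flat_lift X $ a $ p a = 0" by blast
      then show "?t p = 0" by simp
    qed
  qed (auto simp: permutes_id finite_permutations)
  also have "\<dots> = 1" by (simp add: flat_lift_component UNIV_option_conv prod.reindex sign_id)
  finally show ?thesis .
qed

lemma flat_lift_SL: "flat_lift X \<in> SL"
  by (simp add: SL_def)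

lemma matrix_inv_flat_lift: "matrix_inv (flat_lift X) = flat_lift (- X)"
  by (rule matrix_inv_unique) (simp add: flat_lift_add flat_lift_0)

lemma mexp_gp_Pgrp: "mat 1 + t *\<^sub>R sl_mat (gp Z) \<in> Pgrp"
proof -
  have "mat 1 + t *\<^sub>R sl_mat (gp Z) = transpose (flat_lift (t *\<^sub>R Z))"
    by (simp add: vec_eq_iff transpose_def flat_lift_component sl_mat_gp mat_def split: option.split)
  then have "det (mat 1 + t *\<^sub>R sl_mat (gp Z)) = 1"
    by (simp only: det_transpose det_flat_lift)
  then show ?thesis unfolding Pgrp_iff SL_def by (simp add: sl_mat_gp) (simp add: mat_def)
qed

lemma flat_lift_mult_vec: "flat_lift X *v axis None 1 = (\<chi> a. case a of None \<Rightarrow> 1 | Some i \<Rightarrow> X $ i)"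
  by (simp add: vec_eq_iff mult_axis flat_lift_component split: option.split)

section \<open>Smooth functions on embedded submanifolds and charts of the special linear group\<close>

lemma smooth_nearI:
  assumes "(D, \<kappa>) \<in> charts N" "x \<in> D" "open W" "\<kappa> x \<in> W" "W \<subseteq> \<kappa> ` D" "smooth_on W (f \<circ> inv_into D \<kappa>)"
  shows "smooth_near N x f"
proof -
  have "\<exists>W. open W \<and> \<kappa> x \<in> W \<and> W \<subseteq> \<kappa> ` D \<and> smooth_on W (f \<circ> inv_into D \<kappa>)"
    using assms by (intro exI[of _ W] conjI)
  then show ?thesis unfolding smooth_near_def
    using assms(1,2) by (intro bexI[of _ "(D, \<kappa>)"]) simp_all
qed

lemma smooth_nearE:
  assumes "smooth_near N x f"
  obtains D \<kappa> W where "(D, \<kappa>) \<in> charts N" "x \<in> D" "open W" "\<kappa> x \<in> W" "W \<subseteq> \<kappa> ` D"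
    "smooth_on W (f \<circ> inv_into D \<kappa>)"
  using assms unfolding smooth_near_def by (elim bexE) (simp add: split_paired_all, blast)

text \<open>A chart of an embedded submanifold is locally the restriction of an ambient smooth map \<open>k\<close>. So a
  function that is smooth in the chart extends to the ambient space as \<open>(f \<circ> \<kappa>\<^sup>-\<^sup>1) \<circ> k\<close>. This
  reduces smoothness on \<open>SL\<close> and on the sphere to calculus in Euclidean space.\<close>

lemma smooth_near_embeddedE:
  fixes f :: "'a::euclidean_space \<Rightarrow> 'b::real_normed_vector"
  assumes "smooth_near (embedded S :: ('a, 'e::euclidean_space) manifold) x f"
  obtains W F where "open W" "x \<in> W" "smooth_on W F" "\<forall>y\<in>W \<inter> S. f y = F y"
proof -
  obtain D and \<kappa> :: "'a \<Rightarrow> 'e" and W1 where 1: "(D, \<kappa>) \<in> charts (embedded S)" "x \<in> D" "open W1" "\<kappa> x \<in> W1"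
    "W1 \<subseteq> \<kappa> ` D" "smooth_on W1 (f \<circ> inv_into D \<kappa>)"
    using assms by (rule smooth_nearE)
  then have D: "openin (top_of_set S) D" "inj_on \<kappa> D"
    and ext: "\<exists>W f. open W \<and> x \<in> W \<and> smooth_on W f \<and> (\<forall>y\<in>W \<inter> D. \<kappa> y = f y)"
    by (auto simp: embedded_def)
  obtain T where T: "open T" "D = S \<inter> T" using D(1) by (auto simp: openin_open)
  obtain W0 k where W0: "open W0" "x \<in> W0" "smooth_on W0 k" "\<forall>y\<in>W0 \<inter> D. \<kappa> y = k y"
    using ext by blast
  define W where "W = (W0 \<inter> k -` W1) \<inter> T"
  show thesis
  proof
    show "open W" unfolding W_def
      by (intro open_Int T continuous_open_preimage smooth_on_continuous W0 1)
    show "x \<in> W" using W0 1 T by (auto simp: W_def)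
    show "smooth_on W (\<lambda>y. (f \<circ> inv_into D \<kappa>) (k y))"
      by (rule smooth_on_compose[OF 1(6)], rule smooth_on_subset[OF W0(3)]) (auto simp: W_def)
    show "\<forall>y\<in>W \<inter> S. f y = (f \<circ> inv_into D \<kappa>) (k y)"
    proof
      fix y assume "y \<in> W \<inter> S"
      then have "y \<in> D" "k y = \<kappa> y" using W0 T by (auto simp: W_def)
      then show "f y = (f \<circ> inv_into D \<kappa>) (k y)" using D(2) by simp
    qed
  qed
qed

lemma embedded_chartD:
  assumes "(D, \<kappa>) \<in> charts (embedded S)"
  shows "D \<subseteq> S" "openin (top_of_set S) D" "open (\<kappa> ` D)" "inj_on \<kappa> D" "smooth_on (\<kappa> ` D) (inv_into D \<kappa>)"
  using assms by (auto simp: embedded_def dest: openin_imp_subset)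

lemma chart_preimage_open:
  assumes "(D, \<kappa>) \<in> charts (embedded S)" "open W"
  shows "open (\<kappa> ` D \<inter> inv_into D \<kappa> -` W)"
  by (intro continuous_open_preimage smooth_on_continuous embedded_chartD[OF assms(1)] assms)

text \<open>Conversely, the inverse of a chart is smooth as a map to the ambient space, so restrictions of ambient
  smooth functions are smooth at every point that lies in the domain of some chart.\<close>

lemma smooth_near_embeddedI:
  fixes \<kappa> :: "'a::euclidean_space \<Rightarrow> 'e::euclidean_space"
  assumes "(D, \<kappa>) \<in> charts (embedded S)" "x \<in> D" "open W" "x \<in> W" "smooth_on W F"
    "\<And>y. y \<in> W \<inter> S \<Longrightarrow> f y = F y"
  shows "smooth_near (embedded S :: ('a, 'e) manifold) x f"
proof -
  note ch = embedded_chartD[OF assms(1)]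
  let ?W = "\<kappa> ` D \<inter> inv_into D \<kappa> -` W"
  have 1: "open ?W" by (rule chart_preimage_open) fact+
  have "smooth_on ?W (\<lambda>z. F (inv_into D \<kappa> z))"
    by (rule smooth_on_compose[OF assms(5)], rule smooth_on_subset[OF ch(5)]) auto
  then have 3: "smooth_on ?W (f \<circ> inv_into D \<kappa>)"
  proof (rule smooth_on_cong[OF 1, rotated])
    fix z assume "z \<in> ?W"
    then have "inv_into D \<kappa> z \<in> W" "inv_into D \<kappa> z \<in> D" by (blast, blast intro: inv_into_into)
    then have "inv_into D \<kappa> z \<in> W \<inter> S" using ch(1) by blast
    then show "F (inv_into D \<kappa> z) = (f \<circ> inv_into D \<kappa>) z" using assms(6) by simp
  qed
  have 2: "\<kappa> x \<in> ?W" using assms ch by simp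
  show ?thesis by (rule smooth_nearI[OF assms(1,2) 1 2 _ 3]) blast
qed

text \<open>The chain rule for \<open>F \<circ> \<kappa>\<^sup>-\<^sup>1\<close>. It shows that the tangent vector with chart representative \<open>w\<close>
  depends only on the ambient vector \<open>d\<kappa>\<^sup>-\<^sup>1(w)\<close>.\<close>

lemma chart_has_derivative:
  assumes "(D, \<kappa>) \<in> charts (embedded S)" "x \<in> D" "open W" "x \<in> W" "smooth_on W F"
    "\<And>y. y \<in> W \<inter> S \<Longrightarrow> f y = F y"
  shows "((f \<circ> inv_into D \<kappa>) has_derivative
     (\<lambda>w. frechet_derivative F (at x) (frechet_derivative (inv_into D \<kappa>) (at (\<kappa> x)) w))) (at (\<kappa> x))"
proof -
  note ch = embedded_chartD[OF assms(1)]
  let ?W = "\<kappa> ` D \<inter> inv_into D \<kappa> -` W"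
  have 1: "open ?W" by (rule chart_preimage_open) fact+
  have 2: "\<kappa> x \<in> ?W" using assms ch by simp
  have "inv_into D \<kappa> (\<kappa> x) = x" using assms ch by simp
  then have F: "(F has_derivative frechet_derivative F (at x)) (at (inv_into D \<kappa> (\<kappa> x)))"
    using smooth_on_has_derivative[OF assms(5,4)] by simp
  have i: "(inv_into D \<kappa> has_derivative frechet_derivative (inv_into D \<kappa>) (at (\<kappa> x))) (at (\<kappa> x))"
    using 2 by (intro smooth_on_has_derivative[OF ch(5)]) blast
  have eq: "F (inv_into D \<kappa> z) = (f \<circ> inv_into D \<kappa>) z" if "z \<in> ?W" for z
  proof -
    have "inv_into D \<kappa> z \<in> W" "inv_into D \<kappa> z \<in> D" using that by (blast, blast intro: inv_into_into)
    then have "inv_into D \<kappa> z \<in> W \<inter> S" using ch(1) by blast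
    then show ?thesis using assms(6) by simp
  qed
  show ?thesis
    by (rule has_derivative_transform_within_open[OF has_derivative_compose[OF i F] 1 2 eq])
qed

lemma smooth_near_linear_image:
  assumes "smooth_near N x f" "bounded_linear L"
  shows "smooth_near N x (\<lambda>y. L (f y))"
proof -
  obtain D \<kappa> W where *: "(D, \<kappa>) \<in> charts N" "x \<in> D" "open W" "\<kappa> x \<in> W" "W \<subseteq> \<kappa> ` D"
    "smooth_on W (f \<circ> inv_into D \<kappa>)"
    using assms(1) by (rule smooth_nearE)
  have "smooth_on W (\<lambda>z. L ((f \<circ> inv_into D \<kappa>) z))"
    by (rule smooth_on_linear_image[OF assms(2) *(6)])
  then have "smooth_on W ((\<lambda>y. L (f y)) \<circ> inv_into D \<kappa>)" by (simp add: comp_def)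
  from smooth_nearI[OF *(1-5) this] show ?thesis .
qed

text \<open>The matrix whose top left entry is \<open>t\<close>, all others being those of \<open>Y\<close>; unlike for \<open>sl_mat\<close>, the
  trace is arbitrary.\<close>

definition block_mat :: "real \<Rightarrow> 'n::finite sl \<Rightarrow> 'n mat" where
  "block_mat t Y = (\<chi> a b. case (a, b) of
      (None, None) \<Rightarrow> t | (None, Some j) \<Rightarrow> snd (snd Y) $ j
    | (Some i, None) \<Rightarrow> fst Y $ i | (Some i, Some j) \<Rightarrow> fst (snd Y) $ i $ j)"

definition cofactor00 :: "'n::finite sl \<Rightarrow> real" where
  "cofactor00 Y = det (\<chi> a. if a = None then axis None 1 else block_mat 0 Y $ a)"

text \<open>The determinant is an affine function of the top left entry. Where its slope does not vanish, the
  condition \<open>det = 1\<close> can therefore be solved for that entry, and this gives explicit charts of \<open>SL\<close>.\<close>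

lemma det_block_mat: "det (block_mat t Y) = det (block_mat 0 Y) + t * cofactor00 Y"
proof -
  let ?r = "\<lambda>a. block_mat 0 Y $ a"
  have "block_mat t Y = (\<chi> a. if a = None then ?r a + t *s axis None 1 else ?r a)"
    by (simp add: vec_eq_iff block_mat_def axis_def split: option.split)
  then have "det (block_mat t Y) = det (\<chi> a. if a = None then ?r a + t *s axis None 1 else ?r a)"
    by simp
  also have "\<dots> = det (\<chi> a. if a = None then ?r a else ?r a)
      + t * det (\<chi> a. if a = None then axis None 1 else ?r a)"
    unfolding det_row_add det_row_mul ..
  finally show ?thesis by (simp add: cofactor00_def)
qed

lemma mat_sl_block_mat: "mat_sl (block_mat t Y) = Y"
  by (cases Y) (simp add: mat_sl_def mat_block_def block_mat_def vec_eq_iff)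

lemma block_mat_mat_sl: "block_mat (h $ None $ None) (mat_sl h) = h"
  by (simp add: mat_sl_def mat_block_def block_mat_def vec_eq_iff split: option.split)

lemma smooth_on_block_mat:
  assumes "smooth_on S t" "smooth_on S Y"
  shows "smooth_on S (\<lambda>y. block_mat (t y) (Y y))"
proof -
  have "smooth_on S (\<lambda>y. case (a, b) of
      (None, None) \<Rightarrow> t y | (None, Some j) \<Rightarrow> snd (snd (Y y)) $ j
    | (Some i, None) \<Rightarrow> fst (Y y) $ i | (Some i, Some j) \<Rightarrow> fst (snd (Y y)) $ i $ j)" for a b
    by (cases a; cases b; simp)
      (intro assms smooth_on_vec_nth smooth_on_fst smooth_on_snd)+
  then show ?thesis unfolding block_mat_def by (intro smooth_on_vec_lambda)
qed

lemma smooth_on_cofactor00: "smooth_on UNIV cofactor00"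
proof -
  have "smooth_on UNIV (\<lambda>Y. if a = None then axis None 1 else block_mat 0 Y $ a)" for a
    by (cases a) (simp_all add: smooth_on_const smooth_on_vec_nth smooth_on_block_mat smooth_on_ident)
  then show ?thesis unfolding cofactor00_def[abs_def]
    by (intro smooth_on_det smooth_on_vec_lambda)
qed

lemma open_cofactor00: "open {Y. cofactor00 Y \<noteq> 0}"
  using open_Collect_neq[OF smooth_on_continuous[OF smooth_on_cofactor00] continuous_on_const[of UNIV 0]]
  by blast

text \<open>The chart centred at \<open>u\<close> forgets the top left entry of \<open>u\<^sup>-\<^sup>1 g\<close>. With this choice the Maurer--Cartan
  form at \<open>u\<close> is the differential of the chart.\<close>

definition SL_coord :: "'n::finite mat \<Rightarrow> 'n mat \<Rightarrow> 'n sl" where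
  "SL_coord u g = mat_sl (matrix_inv u ** g)"

definition SL_dom :: "'n::finite mat \<Rightarrow> 'n mat set" where
  "SL_dom u = {g \<in> SL. cofactor00 (SL_coord u g) \<noteq> 0}"

definition SL_param :: "'n::finite mat \<Rightarrow> 'n sl \<Rightarrow> 'n mat" where
  "SL_param u Y = u ** block_mat ((1 - det (block_mat 0 Y)) / cofactor00 Y) Y"

lemma linear_SL_coord: "bounded_linear (SL_coord u)"
  by (intro linear_conv_bounded_linear[THEN iffD1] linearI)
    (simp_all add: SL_coord_def mat_sl_def mat_block_def vec_eq_iff matrix_add_ldistrib
      matrix_matrix_mult_def sum_distrib_left distrib_left sum.distrib mult_ac)

lemma SL_param_coord:
  assumes "u \<in> SL" "g \<in> SL_dom u" shows "SL_param u (SL_coord u g) = g"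
proof -
  let ?h = "matrix_inv u ** g"
  have "det ?h = 1" using assms SL_mult[OF SL_inv] SL_det by (auto simp: SL_dom_def)
  then have "det (block_mat 0 (mat_sl ?h)) + ?h $ None $ None * cofactor00 (mat_sl ?h) = 1"
    using det_block_mat[of "?h $ None $ None" "mat_sl ?h"] by (simp add: block_mat_mat_sl)
  then have "(1 - det (block_mat 0 (mat_sl ?h))) / cofactor00 (mat_sl ?h) = ?h $ None $ None"
    using assms by (simp add: SL_dom_def SL_coord_def field_simps)
  then have "SL_param u (SL_coord u g) = u ** ?h"
    unfolding SL_param_def SL_coord_def by (simp only: block_mat_mat_sl)
  then show ?thesis using assms by (simp add: matrix_mul_assoc SL_det)
qed

lemma SL_coord_param:
  assumes "u \<in> SL" "cofactor00 Y \<noteq> 0"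
  shows "SL_coord u (SL_param u Y) = Y" "SL_param u Y \<in> SL_dom u"
proof -
  let ?t = "(1 - det (block_mat 0 Y)) / cofactor00 Y"
  have "matrix_inv u ** (u ** block_mat ?t Y) = block_mat ?t Y"
    using assms by (simp add: matrix_mul_assoc SL_det)
  then show 1: "SL_coord u (SL_param u Y) = Y"
    by (simp add: SL_coord_def SL_param_def mat_sl_block_mat)
  have "det (block_mat ?t Y) = 1" using assms(2) by (subst det_block_mat) simp
  then have "SL_param u Y \<in> SL" using assms(1) by (simp add: SL_param_def SL_def det_mul)
  with 1 assms show "SL_param u Y \<in> SL_dom u" by (simp add: SL_dom_def)
qed

lemma SL_coord_image: "u \<in> SL \<Longrightarrow> SL_coord u ` SL_dom u = {Y. cofactor00 Y \<noteq> 0}"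
  using SL_coord_param by (force simp: SL_dom_def)

lemma SL_coord_inj: "u \<in> SL \<Longrightarrow> inj_on (SL_coord u) (SL_dom u)"
  by (rule inj_on_inverseI[of _ "SL_param u"]) (rule SL_param_coord)

lemma SL_inv_into: "u \<in> SL \<Longrightarrow> cofactor00 Y \<noteq> 0 \<Longrightarrow> inv_into (SL_dom u) (SL_coord u) Y = SL_param u Y"
  by (rule inv_into_f_eq[OF SL_coord_inj]) (simp_all add: SL_coord_param)

lemma SL_chart: assumes "u \<in> SL" shows "(SL_dom u, SL_coord u) \<in> charts SL_manifold"
proof -
  have c: "smooth_on UNIV (SL_coord u)"
    using smooth_on_linear_image[OF linear_SL_coord smooth_on_ident] .
  have "SL_dom u = SL \<inter> SL_coord u -` {Y. cofactor00 Y \<noteq> 0}" by (auto simp: SL_dom_def)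
  then have 1: "openin (top_of_set SL) (SL_dom u)"
    using open_vimage[OF open_cofactor00 smooth_on_continuous[OF c]] by (auto simp: openin_open)
  have "smooth_on {Y. cofactor00 Y \<noteq> 0} (SL_param u)"
    unfolding SL_param_def[abs_def]
    by (intro smooth_on_matrix_mult smooth_on_const smooth_on_block_mat smooth_on_divide smooth_on_diff
        smooth_on_det smooth_on_ident smooth_on_subset[OF smooth_on_cofactor00]) auto
  then have 2: "smooth_on {Y. cofactor00 Y \<noteq> 0} (inv_into (SL_dom u) (SL_coord u))"
    by (rule smooth_on_cong[OF open_cofactor00, rotated]) (simp add: SL_inv_into assms)
  have 3: "\<forall>x\<in>SL_dom u. \<exists>W f. open W \<and> x \<in> W \<and> smooth_on W f \<and> (\<forall>y\<in>W \<inter> SL_dom u. SL_coord u y = f y)"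
    using c by (intro ballI exI[of _ UNIV] exI[of _ "SL_coord u"]) simp
  show ?thesis unfolding SL_manifold_def embedded_def
    using 1 2 3 SL_coord_inj[OF assms] by (simp add: SL_coord_image[OF assms] open_cofactor00)
qed

text \<open>The curves \<open>t \<mapsto> u exp(tX)\<close> become straight lines in the chart centred at \<open>u\<close>.\<close>

lemma SL_coord_flat_lift:
  assumes "u \<in> SL"
  shows "SL_coord u (u ** flat_lift X) = (X, mat 1, 0)" "u ** flat_lift X \<in> SL_dom u"
proof -
  have "matrix_inv u ** (u ** flat_lift X) = flat_lift X"
    using assms by (simp add: matrix_mul_assoc SL_det)
  then show 1: "SL_coord u (u ** flat_lift X) = (X, mat 1, 0)"
    by (simp add: SL_coord_def mat_sl_def mat_block_def vec_eq_iff flat_lift_component mat_def)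
  have "(\<chi> a. if a = None then axis None 1 else block_mat 0 (X, mat 1, 0) $ a) = flat_lift X"
    by (simp add: vec_eq_iff flat_lift_component block_mat_def axis_def mat_def split: option.split)
  then have "cofactor00 (X, mat 1, 0) = 1" by (simp add: cofactor00_def)
  with 1 show "u ** flat_lift X \<in> SL_dom u" using assms by (simp add: SL_dom_def SL_mult flat_lift_SL)
qed

lemma SL_dom_self: "u \<in> SL \<Longrightarrow> u \<in> SL_dom u"
  using SL_coord_flat_lift(2)[of u 0] by (simp add: flat_lift_0)

lemma smooth_near_SL_iff:
  assumes "u \<in> SL"
  shows "smooth_near SL_manifold u f \<longleftrightarrow>
    (\<exists>W F. open W \<and> u \<in> W \<and> smooth_on W F \<and> (\<forall>y\<in>W \<inter> SL. f y = F y))"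
proof
  assume "smooth_near SL_manifold u f"
  then show "\<exists>W F. open W \<and> u \<in> W \<and> smooth_on W F \<and> (\<forall>y\<in>W \<inter> SL. f y = F y)"
    unfolding SL_manifold_def by (rule smooth_near_embeddedE) blast
next
  assume "\<exists>W F. open W \<and> u \<in> W \<and> smooth_on W F \<and> (\<forall>y\<in>W \<inter> SL. f y = F y)"
  then obtain W F where "open W" "u \<in> W" "smooth_on W F" "\<forall>y\<in>W \<inter> SL. f y = F y" by blast
  then show "smooth_near SL_manifold u f"
    using smooth_near_embeddedI[OF SL_chart[OF assms, unfolded SL_manifold_def] SL_dom_self[OF assms], of W F f]
    unfolding SL_manifold_def by blast
qed

section \<open>Constant vector fields on the homogeneous model\<close>

lemma smooth_near_SLE:
  assumes "smooth_near SL_manifold u f"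
  obtains W F where "open W" "u \<in> W" "smooth_on W F" "\<And>y. y \<in> W \<inter> SL \<Longrightarrow> f y = F y"
proof -
  obtain W F where "open W" "u \<in> W" "smooth_on W F" "\<forall>y\<in>W \<inter> SL. f y = F y"
    using assms unfolding SL_manifold_def by (rule smooth_near_embeddedE)
  then show thesis by (intro that[of W F]) blast+
qed

lemma smooth_near_SLI:
  assumes "u \<in> SL" "open W" "u \<in> W" "smooth_on W F" "\<And>y. y \<in> W \<Longrightarrow> y \<in> SL \<Longrightarrow> f y = F y"
  shows "smooth_near SL_manifold u f"
  unfolding smooth_near_SL_iff[OF assms(1)]
  by (intro exI[of _ W] exI[of _ F] conjI ballI assms) auto

abbreviation SL_pinv :: "'n::finite mat \<Rightarrow> 'n sl \<Rightarrow> 'n mat" where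
  "SL_pinv u \<equiv> inv_into (SL_dom u) (SL_coord u)"

lemma flat_model_sel [simp]:
  "tot flat_model = SL_manifold" "base flat_model = embedded (sphere 0 1)"
  "prj flat_model g = sgn (g *v axis None 1)" "ract flat_model g h = g ** h"
  "pts SL_manifold = SL" "pts (embedded S) = S"
  by (simp_all add: flat_model_def SL_manifold_def embedded_def)

lemma cform_flat: "cform flat_model u v = SL_coord u (\<chi> a b. v (\<lambda>h. h $ a $ b))"
  by (simp add: flat_model_def SL_coord_def)

lemma SL_coord_deriv: "frechet_derivative (SL_coord u) (at x) = SL_coord u"
  using bounded_linear_imp_has_derivative[OF linear_SL_coord] by (metis frechet_derivative_at)

lemma smooth_near_component: "u \<in> SL \<Longrightarrow> smooth_near SL_manifold u (\<lambda>h. h $ a $ b)"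
  by (rule smooth_near_SLI[OF _ open_UNIV UNIV_I smooth_on_vec_nth[OF smooth_on_vec_nth[OF smooth_on_ident]]]) simp_all

text \<open>A tangent vector is recovered from its value under the Maurer--Cartan form: it is the derivative in that
  direction in the chart centred at \<open>u\<close>. The vector may come from any chart \<open>\<kappa>\<close>; comparing the two charts
  amounts to differentiating \<open>\<kappa>\<^sup>-\<^sup>1 = \<kappa>\<^sub>u\<^sup>-\<^sup>1 \<circ> \<kappa>\<^sub>u \<circ> \<kappa>\<^sup>-\<^sup>1\<close>, where \<open>\<kappa>\<^sub>u\<close> is linear.\<close>

lemma tangent_vector_SL:
  assumes "(D, \<kappa>) \<in> charts SL_manifold" "u \<in> D"
    and v: "v = (\<lambda>f. if smooth_near SL_manifold u f
       then frechet_derivative (f \<circ> inv_into D \<kappa>) (at (\<kappa> u)) w else 0)"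
  shows "v = (\<lambda>f. if smooth_near SL_manifold u f
       then frechet_derivative (f \<circ> SL_pinv u) (at (SL_coord u u)) (cform flat_model u v) else 0)"
proof -
  have ch: "(D, \<kappa>) \<in> charts (embedded SL)" using assms by (simp add: SL_manifold_def)
  have u: "u \<in> SL" using embedded_chartD(1)[OF ch] assms by blast
  note ud = SL_dom_self[OF u]
  have ch': "(SL_dom u, SL_coord u) \<in> charts (embedded SL)" using SL_chart[OF u] by (simp add: SL_manifold_def)
  \<comment> \<open>The ambient vector that represents \<open>v\<close>.\<close>
  define m where "m = frechet_derivative (inv_into D \<kappa>) (at (\<kappa> u)) w"
  have d1: "frechet_derivative (f \<circ> inv_into D \<kappa>) (at (\<kappa> u)) w = frechet_derivative F (at u) m"
    if "open W" "u \<in> W" "smooth_on W F" "\<And>y. y \<in> W \<inter> SL \<Longrightarrow> f y = F y" for f F W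
    using fun_cong[OF frechet_derivative_at[OF chart_has_derivative[OF ch assms(2) that]], of w]
    by (simp add: m_def)
  have comp: "v (\<lambda>h. h $ a $ b) = m $ a $ b" for a b
  proof -
    have "((\<lambda>h :: 'a mat. h $ a $ b) has_derivative (\<lambda>h. h $ a $ b)) (at u)"
      by (intro bounded_linear_imp_has_derivative bounded_linear_compose[OF bounded_linear_vec_nth bounded_linear_vec_nth])
    then have "frechet_derivative (\<lambda>h :: 'a mat. h $ a $ b) (at u) = (\<lambda>h. h $ a $ b)"
      by (metis frechet_derivative_at)
    moreover have "smooth_on UNIV (\<lambda>h :: 'a mat. h $ a $ b)"
      by (rule smooth_on_vec_nth[OF smooth_on_vec_nth[OF smooth_on_ident]])
    ultimately show ?thesis using smooth_near_component[OF u, of a b]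
      d1[of UNIV "\<lambda>h. h $ a $ b" "\<lambda>h. h $ a $ b"]
      by (simp add: v)
  qed
  have cf: "cform flat_model u v = SL_coord u m"
    by (simp add: cform_flat comp)
  have m: "frechet_derivative (SL_pinv u) (at (SL_coord u u)) (SL_coord u m) = m"
  proof -
    have d: "((SL_coord u \<circ> inv_into D \<kappa>) has_derivative (\<lambda>w. SL_coord u (frechet_derivative (inv_into D \<kappa>) (at (\<kappa> u)) w))) (at (\<kappa> u))"
      using chart_has_derivative[OF ch assms(2) open_UNIV UNIV_I
        smooth_on_linear_image[OF linear_SL_coord smooth_on_ident], of "SL_coord u"]
      by (simp add: SL_coord_deriv)
    have e: "(SL_pinv u has_derivative frechet_derivative (SL_pinv u) (at (SL_coord u u)))
       (at ((SL_coord u \<circ> inv_into D \<kappa>) (\<kappa> u)))"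
    proof -
      have "(SL_coord u \<circ> inv_into D \<kappa>) (\<kappa> u) = SL_coord u u"
        using embedded_chartD(4)[OF ch] assms(2) by simp
      then show ?thesis
        using smooth_on_has_derivative[OF embedded_chartD(5)[OF ch'], of "SL_coord u u"] ud by simp
    qed
    have dd: "((\<lambda>z. SL_pinv u ((SL_coord u \<circ> inv_into D \<kappa>) z)) has_derivative
       (\<lambda>w. frechet_derivative (SL_pinv u) (at (SL_coord u u)) (SL_coord u (frechet_derivative (inv_into D \<kappa>) (at (\<kappa> u)) w)))) (at (\<kappa> u))"
      by (rule has_derivative_compose[OF d e])
    obtain T where T: "open T" "SL_dom u = SL \<inter> T"
      using embedded_chartD(2)[OF ch'] by (auto simp: openin_open)
    let ?W = "\<kappa> ` D \<inter> inv_into D \<kappa> -` T"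
    have 1: "open ?W" by (rule chart_preimage_open[OF ch T(1)])
    have 2: "\<kappa> u \<in> ?W" using embedded_chartD(4)[OF ch] assms(2) ud T by simp
    have 3: "SL_pinv u ((SL_coord u \<circ> inv_into D \<kappa>) z) = inv_into D \<kappa> z" if "z \<in> ?W" for z
    proof -
      have "inv_into D \<kappa> z \<in> D" "inv_into D \<kappa> z \<in> T" using that by (blast intro: inv_into_into, blast)
      then have "inv_into D \<kappa> z \<in> SL_dom u" using T embedded_chartD(1)[OF ch] by blast
      then show ?thesis using SL_coord_inj[OF u] by simp
    qed
    have "(inv_into D \<kappa> has_derivative
       (\<lambda>w. frechet_derivative (SL_pinv u) (at (SL_coord u u)) (SL_coord u (frechet_derivative (inv_into D \<kappa>) (at (\<kappa> u)) w)))) (at (\<kappa> u))"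
      by (rule has_derivative_transform_within_open[OF dd 1 2 3])
    from fun_cong[OF frechet_derivative_at[OF this], of w] show ?thesis by (simp add: m_def)
  qed
  have d2: "frechet_derivative (f \<circ> SL_pinv u) (at (SL_coord u u)) (SL_coord u m) = frechet_derivative F (at u) m"
    if "open W" "u \<in> W" "smooth_on W F" "\<And>y. y \<in> W \<inter> SL \<Longrightarrow> f y = F y" for f F W
    using fun_cong[OF frechet_derivative_at[OF chart_has_derivative[OF ch' ud that]], of "SL_coord u m"] m by simp
  have "v f = frechet_derivative (f \<circ> SL_pinv u) (at (SL_coord u u)) (cform flat_model u v)"
    if f: "smooth_near SL_manifold u f" for f
  proof -
    obtain W F where W: "open W" "u \<in> W" "smooth_on W F" "\<And>y. y \<in> W \<inter> SL \<Longrightarrow> f y = F y"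
      using smooth_near_SLE[OF f] by blast
    have "v f = frechet_derivative (f \<circ> inv_into D \<kappa>) (at (\<kappa> u)) w" using f by (simp add: v)
    also have "\<dots> = frechet_derivative F (at u) m" by (rule d1) fact+
    also have "\<dots> = frechet_derivative (f \<circ> SL_pinv u) (at (SL_coord u u)) (SL_coord u m)"
      by (rule d2[symmetric]) fact+
    finally show ?thesis unfolding cf .
  qed
  moreover have "v f = 0" if "\<not> smooth_near SL_manifold u f" for f
    using that by (simp add: v)
  ultimately show ?thesis by (intro ext) auto
qed

text \<open>By \<open>tangent_vector_SL\<close> the Maurer--Cartan form is injective on tangent spaces, so it is enough to
  exhibit a tangent vector with the value \<open>Y\<close>.\<close>

lemma cvf_flat:
  assumes u: "u \<in> SL"
  shows "cvf flat_model Y u = (\<lambda>f. if smooth_near SL_manifold u f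
       then frechet_derivative (f \<circ> SL_pinv u) (at (SL_coord u u)) Y else 0)"
    (is "_ = ?v Y")
proof -
  note ud = SL_dom_self[OF u]
  have ch': "(SL_dom u, SL_coord u) \<in> charts (embedded SL)" using SL_chart[OF u] by (simp add: SL_manifold_def)
  have T: "\<exists>D \<kappa> w. v = (\<lambda>f. if smooth_near SL_manifold u f
       then frechet_derivative (f \<circ> inv_into D \<kappa>) (at (\<kappa> u)) w else 0) \<and> (D, \<kappa>) \<in> charts SL_manifold \<and> u \<in> D"
    if "v \<in> tangent_space SL_manifold u" for v
    using that unfolding tangent_space_def by blast
  have *: "v = ?v (cform flat_model u v)" if mem: "v \<in> tangent_space SL_manifold u" for v
  proof -
    obtain D \<kappa> w where "v = (\<lambda>f. if smooth_near SL_manifold u f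
       then frechet_derivative (f \<circ> inv_into D \<kappa>) (at (\<kappa> u)) w else 0)" "(D, \<kappa>) \<in> charts SL_manifold" "u \<in> D"
      using T[OF mem] by (elim exE conjE)
    from tangent_vector_SL[OF this(2,3,1)] show ?thesis .
  qed
  have mem: "?v Y \<in> tangent_space SL_manifold u"
    unfolding tangent_space_def
    by (intro CollectI exI[of _ "SL_dom u"] exI[of _ "SL_coord u"] exI[of _ Y] conjI refl SL_chart u ud)
  have cf: "cform flat_model u (?v Y) = Y"
  proof -
    have d: "((SL_coord u \<circ> SL_pinv u) has_derivative (\<lambda>w. SL_coord u (frechet_derivative (SL_pinv u) (at (SL_coord u u)) w))) (at (SL_coord u u))"
      using chart_has_derivative[OF ch' ud open_UNIV UNIV_I
        smooth_on_linear_image[OF linear_SL_coord smooth_on_ident], of "SL_coord u"]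
      by (simp add: SL_coord_deriv)
    have "((\<lambda>y. y) has_derivative (\<lambda>w. SL_coord u (frechet_derivative (SL_pinv u) (at (SL_coord u u)) w))) (at (SL_coord u u))"
    proof (rule has_derivative_transform_within_open[OF d embedded_chartD(3)[OF ch']])
      show "SL_coord u u \<in> SL_coord u ` SL_dom u" using ud by blast
    qed (simp add: f_inv_into_f)
    then have e: "SL_coord u (frechet_derivative (SL_pinv u) (at (SL_coord u u)) Y) = Y"
      by (rule fun_cong[OF has_derivative_unique[OF _ has_derivative_ident]])
    have c: "?v Y (\<lambda>h. h $ a $ b) = frechet_derivative (SL_pinv u) (at (SL_coord u u)) Y $ a $ b" for a b
    proof -
      have "(SL_pinv u has_derivative frechet_derivative (SL_pinv u) (at (SL_coord u u))) (at (SL_coord u u))"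
        using smooth_on_has_derivative[OF embedded_chartD(5)[OF ch'], of "SL_coord u u"] ud by simp
      then have "(((\<lambda>h. h $ a $ b) \<circ> SL_pinv u) has_derivative (\<lambda>w. frechet_derivative (SL_pinv u) (at (SL_coord u u)) w $ a $ b)) (at (SL_coord u u))"
        unfolding comp_def
        by (rule bounded_linear.has_derivative[OF bounded_linear_compose[OF bounded_linear_vec_nth bounded_linear_vec_nth]])
      from fun_cong[OF frechet_derivative_at[OF this], of Y] show ?thesis
        using smooth_near_component[OF u] by simp
    qed
    show ?thesis unfolding cform_flat c by (simp add: e)
  qed
  have inj: "inj_on (cform flat_model u) (tangent_space SL_manifold u)"
  proof (rule inj_onI)
    fix v w assume v: "v \<in> tangent_space SL_manifold u" and w: "w \<in> tangent_space SL_manifold u"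
      and eq: "cform flat_model u v = cform flat_model u w"
    have "v = ?v (cform flat_model u w)" unfolding eq[symmetric] by (rule *[OF v])
    also have "\<dots> = w" by (rule *[OF w, symmetric])
    finally show "v = w" .
  qed
  show ?thesis unfolding cvf_def flat_model_sel 
    using inv_into_f_eq[OF inj mem] cf by blast
qed

text \<open>On the homogeneous model the constant vector field of \<open>X\<close> in \<open>\<gg>\<^sub>-\<^sub>1\<close> generates right multiplication by
  \<open>exp(tX)\<close>.\<close>

lemma cvf_flat_deriv:
  fixes f :: "'n::finite mat \<Rightarrow> real"
  assumes u: "u \<in> SL" and f: "smooth_near SL_manifold u f"
  shows "((\<lambda>t. f (u ** flat_lift (t *\<^sub>R X))) has_real_derivative cvf flat_model (gm X) u f) (at 0)"
proof -
  have ch': "(SL_dom u, SL_coord u) \<in> charts (embedded SL)" using SL_chart[OF u] by (simp add: SL_manifold_def)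
  obtain W F where W: "open W" "u \<in> W" "smooth_on W F" "\<And>y. y \<in> W \<inter> SL \<Longrightarrow> f y = F y"
    using smooth_near_SLE[OF f] by blast
  let ?c = "\<lambda>t. SL_coord u (u ** flat_lift (t *\<^sub>R X))"
  have "f \<circ> SL_pinv u differentiable (at (SL_coord u u))"
    using chart_has_derivative[OF ch' SL_dom_self[OF u] W] unfolding differentiable_def by blast
  then have D: "((f \<circ> SL_pinv u) has_derivative frechet_derivative (f \<circ> SL_pinv u) (at (SL_coord u u))) (at (?c 0))"
    by (simp add: flat_lift_0) (rule frechet_derivative_works[THEN iffD1])
  have "(?c has_derivative (\<lambda>t. t *\<^sub>R gm X)) (at 0)"
    unfolding SL_coord_flat_lift[OF u]
    by (auto intro!: derivative_eq_intros simp: scaleR_prod_def zero_prod_def)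
  from has_derivative_compose[OF this D]
  have "((\<lambda>t. (f \<circ> SL_pinv u) (?c t)) has_derivative (\<lambda>t. frechet_derivative (f \<circ> SL_pinv u) (at (SL_coord u u)) (t *\<^sub>R gm X))) (at 0)" .
  moreover have "(f \<circ> SL_pinv u) (?c t) = f (u ** flat_lift (t *\<^sub>R X))" for t
    using SL_coord_inj[OF u] SL_coord_flat_lift(2)[OF u] by simp
  moreover have "frechet_derivative (f \<circ> SL_pinv u) (at (SL_coord u u)) (t *\<^sub>R gm X)
      = cvf flat_model (gm X) u f * t" for t
    using linear_cmul[OF has_derivative_linear[OF D], of t "gm X"] f by (simp add: cvf_flat[OF u])
  ultimately show ?thesis by (simp add: has_field_derivative_def)
qed

lemma vderiv_has_vector_derivative:
  fixes s :: "'a \<Rightarrow> 'v::euclidean_space"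
  assumes "\<And>b. b \<in> Basis \<Longrightarrow> ((\<lambda>t. s (c t) \<bullet> b) has_real_derivative v (\<lambda>x. s x \<bullet> b)) F"
  shows "((\<lambda>t. s (c t)) has_vector_derivative vderiv v s) F"
proof -
  have "((\<lambda>t. \<Sum>b\<in>Basis. (s (c t) \<bullet> b) *\<^sub>R b) has_vector_derivative (\<Sum>b\<in>Basis. v (\<lambda>x. s x \<bullet> b) *\<^sub>R b)) F"
    by (intro has_vector_derivative_sum bounded_linear.has_vector_derivative[OF bounded_linear_scaleR_left]
        assms[unfolded has_real_derivative_iff_has_vector_derivative])
  then show ?thesis by (simp add: euclidean_representation vderiv_def)
qed

lemma vderiv_flat:
  fixes s :: "'n::finite mat \<Rightarrow> 'v::euclidean_space"
  assumes "u \<in> SL" "smooth_near SL_manifold u s"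
  shows "((\<lambda>t. s (u ** flat_lift (t *\<^sub>R X))) has_vector_derivative vderiv (cvf flat_model (gm X) u) s) (at 0)"
  by (intro vderiv_has_vector_derivative cvf_flat_deriv smooth_near_linear_image[OF assms(2)] assms(1)
      bounded_linear_inner_left)

section \<open>Parallel sections and solutions of BGG operators\<close>

text \<open>The properties of a representation \<open>\<V>\<close> of \<open>G\<close> and its quotient on which the arguments below depend: a
  smooth linear action of \<open>SL\<close>, and a linear \<open>P\<close>-equivariant map \<open>\<pi>\<close> to a representation on which
  \<open>exp(\<pp>\<^sub>+)\<close> acts trivially. The last property makes \<open>\<pi>\<close> vanish on \<open>\<pp>\<^sub>+ \<cdot> \<V>\<close>, so that it
  is constant on the cosets that make up the quotient.\<close>

locale bgg_module =
  fixes V :: "('n::finite, 'v::euclidean_space, 'w::euclidean_space) bgg_data" and \<pi> :: "'v \<Rightarrow> 'w"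
  assumes linear_act: "linear (bgg_act V g)"
    and smooth_act: "smooth_on {g. det g \<noteq> 0} (\<lambda>g. bgg_act V g v)"
    and act_mult: "g \<in> SL \<Longrightarrow> h \<in> SL \<Longrightarrow> bgg_act V (g ** h) v = bgg_act V g (bgg_act V h v)"
    and act_one: "bgg_act V (mat 1) v = v"
    and zero_space: "0 \<in> bgg_space V"
    and space_act: "g \<in> SL \<Longrightarrow> v \<in> bgg_space V \<Longrightarrow> bgg_act V g v \<in> bgg_space V"
    and iso: "h0_iso V = coset_map \<pi>"
    and linear_proj: "linear \<pi>"
    and proj_space: "v \<in> bgg_space V \<Longrightarrow> \<pi> v \<in> h0_space V"
    and proj_act: "g \<in> Pgrp \<Longrightarrow> \<pi> (bgg_act V g v) = h0_act V g (\<pi> v)"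
    and h0_act_gp: "h0_act V (mat 1 + t *\<^sub>R sl_mat (gp Z)) w = w"
begin

lemma bounded_linear_proj: "bounded_linear \<pi>"
  using linear_proj linear_conv_bounded_linear by blast

lemma inf_act_deriv:
  assumes "\<And>t. mexp (t *\<^sub>R sl_mat Y) = mat 1 + t *\<^sub>R sl_mat Y"
  shows "((\<lambda>t. bgg_act V (mexp (t *\<^sub>R sl_mat Y)) v) has_vector_derivative inf_act V Y v) (at 0)"
proof -
  let ?D = "frechet_derivative (\<lambda>g. bgg_act V g v) (at (mat 1))"
  let ?c = "\<lambda>t::real. mat 1 + t *\<^sub>R sl_mat Y"
  have D: "((\<lambda>g. bgg_act V g v) has_derivative ?D) (at (?c 0))"
    using smooth_on_has_derivative[OF smooth_act, of "mat 1"] by simp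
  have "(?c has_derivative (\<lambda>t. t *\<^sub>R sl_mat Y)) (at 0)"
    by (auto intro!: derivative_eq_intros)
  from has_derivative_compose[OF this D]
  have "((\<lambda>t. bgg_act V (?c t) v) has_derivative (\<lambda>t. ?D (t *\<^sub>R sl_mat Y))) (at 0)" .
  then have "((\<lambda>t. bgg_act V (?c t) v) has_vector_derivative ?D (sl_mat Y)) (at 0)"
    unfolding has_vector_derivative_def linear_cmul[OF has_derivative_linear[OF D]] .
  then have *: "((\<lambda>t. bgg_act V (mexp (t *\<^sub>R sl_mat Y)) v) has_vector_derivative ?D (sl_mat Y)) (at 0)"
    unfolding assms .
  then show ?thesis unfolding inf_act_def vector_derivative_at[OF *] .
qed

lemma inf_act_gm:
  "((\<lambda>t. bgg_act V (flat_lift (t *\<^sub>R X)) v) has_vector_derivative inf_act V (gm X) v) (at 0)"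
  using inf_act_deriv[of "gm X" v, OF mexp_gm] unfolding mexp_gm_flat_lift .

lemma inf_act_gp:
  "((\<lambda>t. bgg_act V (mat 1 + t *\<^sub>R sl_mat (gp Z)) v) has_vector_derivative inf_act V (gp Z) v) (at 0)"
  using inf_act_deriv[of "gp Z" v, OF mexp_gp] unfolding mexp_gp .

text \<open>The curve \<open>t \<mapsto> \<pi>(exp(tZ) \<cdot> v)\<close> is constant, because \<open>\<pi>\<close> is equivariant and \<open>exp(tZ)\<close> acts
  trivially on the target.\<close>

lemma proj_inf_act_gp: "\<pi> (inf_act V (gp Z) v) = 0"
proof -
  have "((\<lambda>t. \<pi> (bgg_act V (mat 1 + t *\<^sub>R sl_mat (gp Z)) v)) has_vector_derivative \<pi> (inf_act V (gp Z) v)) (at 0)"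
    by (rule bounded_linear.has_vector_derivative[OF bounded_linear_proj inf_act_gp])
  then have "((\<lambda>t::real. \<pi> v) has_vector_derivative \<pi> (inf_act V (gp Z) v)) (at 0)"
    unfolding proj_act[OF mexp_gp_Pgrp] h0_act_gp .
  from vector_derivative_unique_at[OF this has_vector_derivative_const] show ?thesis .
qed

lemma h0_proj_eq:
  assumes "v \<in> bgg_space V" shows "h0_proj V v = \<pi> v"
proof -
  let ?S = "{inf_act V (gp Z) w | Z w. w \<in> bgg_space V}"
  have 0: "\<pi> x = 0" if "x \<in> span ?S" for x
    by (rule linear_eq_0_on_span[OF linear_proj _ that]) (auto simp: proj_inf_act_gp)
  have 1: "\<pi> v' = \<pi> v" if "v' \<in> h0_class V v" for v'
    using 0[of "v' - v"] that linear_diff[OF linear_proj, of v' v] by (simp add: h0_class_def)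
  have 2: "v \<in> h0_class V v" using assms by (simp add: h0_class_def span_zero)
  have "coset_map \<pi> (h0_class V v) = \<pi> v"
    unfolding coset_map_def
  proof (rule the_equality)
    show "\<forall>v'\<in>h0_class V v. \<pi> v' = \<pi> v" using 1 by (rule ballI)
    show "w = \<pi> v" if "\<forall>v'\<in>h0_class V v. \<pi> v' = w" for w
      using bspec[OF that 2] by (rule sym)
  qed
  then show ?thesis by (simp add: h0_proj_def iso)
qed

lemma inf_act_gp_zero: "inf_act V (gp Z) 0 = 0"
proof -
  have "((\<lambda>t::real. 0) has_vector_derivative inf_act V (gp Z) 0) (at 0)"
    using inf_act_gp[of Z 0] unfolding linear_0[OF linear_act] .
  from vector_derivative_unique_at[OF this has_vector_derivative_const] show ?thesis .
qed

lemma linear_inf_act_gm: "linear (inf_act V (gm X))"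
proof (rule linearI)
  fix v w :: 'v and r :: real
  have "((\<lambda>t. bgg_act V (flat_lift (t *\<^sub>R X)) (v + w)) has_vector_derivative (inf_act V (gm X) v + inf_act V (gm X) w)) (at 0)"
    unfolding linear_add[OF linear_act] by (intro has_vector_derivative_add inf_act_gm)
  from vector_derivative_unique_at[OF inf_act_gm this]
  show "inf_act V (gm X) (v + w) = inf_act V (gm X) v + inf_act V (gm X) w" .
  have "((\<lambda>t. bgg_act V (flat_lift (t *\<^sub>R X)) (r *\<^sub>R v)) has_vector_derivative (r *\<^sub>R inf_act V (gm X) v)) (at 0)"
    unfolding linear_cmul[OF linear_act]
    by (rule bounded_linear.has_vector_derivative[OF bounded_linear_scaleR_right inf_act_gm])
  from vector_derivative_unique_at[OF inf_act_gm this]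
  show "inf_act V (gm X) (r *\<^sub>R v) = r *\<^sub>R inf_act V (gm X) v" .
qed

lemma act_flat_lift_deriv:
  "((\<lambda>t. bgg_act V (flat_lift (t *\<^sub>R X)) v) has_vector_derivative
     bgg_act V (flat_lift (t0 *\<^sub>R X)) (inf_act V (gm X) v)) (at t0 within S)"
proof -
  \<comment> \<open>Additivity of \<open>exp\<close> on \<open>\<gg>\<^sub>-\<^sub>1\<close> reduces the derivative at \<open>t0\<close> to that at 0.\<close>
  have e: "bgg_act V (flat_lift (t *\<^sub>R X)) v
      = bgg_act V (flat_lift (t0 *\<^sub>R X)) (bgg_act V (flat_lift ((t - t0) *\<^sub>R X)) v)" for t
    unfolding act_mult[OF flat_lift_SL flat_lift_SL, symmetric] flat_lift_add
    by (simp add: scaleR_left_diff_distrib)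
  have d: "((\<lambda>t. t - t0) has_vector_derivative 1) (at t0)"
    by (auto intro!: derivative_eq_intros)
  have i: "((\<lambda>t. bgg_act V (flat_lift (t *\<^sub>R X)) v) has_vector_derivative inf_act V (gm X) v) (at (t0 - t0))"
    using inf_act_gm by simp
  have "((\<lambda>t. bgg_act V (flat_lift ((t - t0) *\<^sub>R X)) v) has_vector_derivative inf_act V (gm X) v) (at t0)"
    using vector_diff_chain_at[OF d i] by (simp add: comp_def)
  then have "((\<lambda>t. bgg_act V (flat_lift (t0 *\<^sub>R X)) (bgg_act V (flat_lift ((t - t0) *\<^sub>R X)) v)) has_vector_derivative
     bgg_act V (flat_lift (t0 *\<^sub>R X)) (inf_act V (gm X) v)) (at t0)"
    by (rule bounded_linear.has_vector_derivative[OF linear_conv_bounded_linear[THEN iffD1, OF linear_act]])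
  then show ?thesis unfolding e[symmetric] by (rule has_vector_derivative_at_within)
qed

text \<open>The derivative of \<open>t \<mapsto> exp(tX) \<cdot> y(t)\<close> is \<open>exp(tX) \<cdot> (X \<cdot> y(t) + y'(t)) = 0\<close>. The curve \<open>y\<close> is
  differentiated in a basis, which replaces a product rule for the operator-valued function \<open>exp(tX)\<close>.\<close>

lemma parallel_along_flow:
  assumes y: "\<And>t. t \<in> {0..1} \<Longrightarrow> (y has_vector_derivative y' t) (at t within {0..1})"
    and eq: "\<And>t. t \<in> {0..1} \<Longrightarrow> y' t + inf_act V (gm X) (y t) = 0"
  shows "y 1 = bgg_act V (flat_lift (- X)) (y (0::real))"
proof -
  let ?A = "\<lambda>t. bgg_act V (flat_lift (t *\<^sub>R X))"
  have exp: "L w = (\<Sum>b\<in>Basis. (w \<bullet> b) *\<^sub>R L b)" if "linear L" for L :: "'v \<Rightarrow> 'v" and w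
  proof -
    have "L w = L (\<Sum>b\<in>Basis. (w \<bullet> b) *\<^sub>R b)" unfolding euclidean_representation ..
    then show ?thesis unfolding linear_sum[OF that] linear_cmul[OF that] .
  qed
  \<comment> \<open>This is the derivative of \<open>exp(tX) \<cdot> y(t)\<close>.\<close>
  have z: "((\<lambda>t. ?A t (y t)) has_vector_derivative 0) (at t within {0..1})" if t: "t \<in> {0..1}" for t
  proof -
    have "((\<lambda>t. \<Sum>b\<in>Basis. (y t \<bullet> b) *\<^sub>R ?A t b) has_vector_derivative
       (\<Sum>b\<in>Basis. (y t \<bullet> b) *\<^sub>R ?A t (inf_act V (gm X) b) + (y' t \<bullet> b) *\<^sub>R ?A t b)) (at t within {0..1})"
    proof (intro has_vector_derivative_sum has_vector_derivative_scaleR act_flat_lift_deriv)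
      fix b
      show "((\<lambda>t. y t \<bullet> b) has_real_derivative y' t \<bullet> b) (at t within {0..1})"
        unfolding has_real_derivative_iff_has_vector_derivative
        by (rule bounded_linear.has_vector_derivative[OF bounded_linear_inner_left y[OF t]])
    qed
    moreover have "(\<Sum>b\<in>Basis. (y t \<bullet> b) *\<^sub>R ?A t (inf_act V (gm X) b) + (y' t \<bullet> b) *\<^sub>R ?A t b)
        = ?A t (inf_act V (gm X) (y t)) + ?A t (y' t)"
      unfolding sum.distrib exp[OF linear_act, of _ "y' t", symmetric]
        exp[OF linear_compose[OF linear_inf_act_gm linear_act], of _ _ "y t", unfolded comp_def, symmetric] ..
    moreover have "?A t (inf_act V (gm X) (y t)) + ?A t (y' t) = 0"
      using eq[OF t] linear_add[OF linear_act, of "flat_lift (t *\<^sub>R X)" "y' t" "inf_act V (gm X) (y t)"]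
        linear_0[OF linear_act] by (simp add: add.commute)
    ultimately show ?thesis unfolding exp[OF linear_act, of _ "y _", symmetric] by simp
  qed
  have "\<exists>c. \<forall>t\<in>{0..1}. ?A t (y t) = c"
    by (rule has_derivative_zero_constant[OF convex_real_interval(5)])
      (use z in \<open>simp add: has_vector_derivative_def\<close>)
  then obtain c where c: "\<And>t. t \<in> {0..1} \<Longrightarrow> ?A t (y t) = c" by blast
  have "?A 1 (y 1) = ?A 0 (y 0)" using c[of 1] c[of 0] by simp
  then have "bgg_act V (flat_lift X) (y 1) = y 0" by (simp add: flat_lift_0 act_one)
  then have "bgg_act V (flat_lift (- X)) (y 0) = bgg_act V (flat_lift (- X) ** flat_lift X) (y 1)"
    by (simp add: act_mult flat_lift_SL)
  then show ?thesis by (simp add: flat_lift_add flat_lift_0 act_one)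
qed

lemma act_inverse_lift:
  assumes "g \<in> Pgrp"
  shows "bgg_act V (matrix_inv (flat_lift X ** g)) v = bgg_act V (matrix_inv g) (bgg_act V (flat_lift (- X)) v)"
  using Pgrp_SL[OF assms]
  by (simp add: matrix_inv_mult SL_det matrix_inv_flat_lift act_mult[symmetric] SL_inv flat_lift_SL)

text \<open>The constant vector is \<open>v = s(u\<^sub>0)\<close>, where \<open>s\<close> is a parallel section that projects to the solution.\<close>

lemma normal_solution_form:
  fixes C :: "('g, 'm, 'n) cartan_geometry"
  assumes pb: "principal_bundle C" and nc: "normal_chart C u0 B \<Phi>"
    and sol: "normal_BGG_solution C V (pts (base C)) \<alpha>"
  obtains v where "v \<in> bgg_space V"
    "\<And>X g. X \<in> B \<Longrightarrow> g \<in> Pgrp \<Longrightarrow> \<alpha> (ract C (\<Phi> X) g) = \<pi> (bgg_act V (matrix_inv (flat_lift X ** g)) v)"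
proof -
  have prj: "prj C u \<in> pts (base C)" if "u \<in> pts (tot C)" for u
    using pb that unfolding principal_bundle_def smooth_map_def by blast
  have ov: "u \<in> over C (pts (base C)) \<longleftrightarrow> u \<in> pts (tot C)" for u
    using prj by (auto simp: over_def)
  have rt: "ract C u g \<in> pts (tot C)" if "u \<in> pts (tot C)" "g \<in> Pgrp" for u g
    using pb that unfolding principal_bundle_def smooth_map_def by blast
  obtain s where s: "s \<in> sections C (pts (base C)) (bgg_space V) (bgg_act V)"
    and s2: "\<forall>u\<in>pts (tot C). h0_proj V (s u) = \<alpha> u \<and> (\<forall>X. tractor_conn C V s u X = 0)"
    using sol ov unfolding normal_BGG_solution_def tractor_sections_def by blast
  have sp: "s u \<in> bgg_space V" and sm: "smooth_near (tot C) u s"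
    and eqv: "g \<in> Pgrp \<Longrightarrow> s (ract C u g) = bgg_act V (matrix_inv g) (s u)" if "u \<in> pts (tot C)" for u g
    using s that ov unfolding sections_def by blast+
  have u0: "u0 \<in> pts (tot C)" using nc by (simp add: normal_chart_def)
  have \<Phi>: "s (\<Phi> X) = bgg_act V (flat_lift (- X)) (s u0) \<and> \<Phi> X \<in> pts (tot C)" if "X \<in> B" for X
  proof -
    have "flow1 C (gm X) u0 (\<Phi> X)" using nc that by (simp add: normal_chart_def)
    then obtain c where c: "c 0 = u0" "c 1 = \<Phi> X"
      and ct: "\<forall>t\<in>{0..1}. c t \<in> pts (tot C) \<and> (\<forall>f. smooth_near (tot C) (c t) f \<longrightarrow>
        ((f \<circ> c) has_real_derivative cvf C (gm X) (c t) f) (at t within {0..1}))"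
      unfolding flow1_def by blast
    have "((\<lambda>t. s (c t)) has_vector_derivative vderiv (cvf C (gm X) (c t)) s) (at t within {0..1})"
      if t: "t \<in> {0..1}" for t
    proof (rule vderiv_has_vector_derivative)
      fix b
      have "smooth_near (tot C) (c t) (\<lambda>x. s x \<bullet> b)"
        using smooth_near_linear_image[OF sm bounded_linear_inner_left] ct t by blast
      then show "((\<lambda>t. s (c t) \<bullet> b) has_real_derivative cvf C (gm X) (c t) (\<lambda>x. s x \<bullet> b)) (at t within {0..1})"
        using bspec[OF ct t] unfolding comp_def by blast
    qed
    moreover have "vderiv (cvf C (gm X) (c t)) s + inf_act V (gm X) (s (c t)) = 0" if "t \<in> {0..1}" for t
      using s2 ct that unfolding tractor_conn_def by blast
    ultimately have "s (c 1) = bgg_act V (flat_lift (- X)) (s (c 0))"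
      by (rule parallel_along_flow)
    moreover have "c 1 \<in> pts (tot C)" using ct by simp
    ultimately show ?thesis unfolding c by blast
  qed
  show thesis
  proof
    show "s u0 \<in> bgg_space V" using sp u0 by blast
    fix X and g :: "'n mat" assume X: "X \<in> B" and g: "g \<in> Pgrp"
    have p: "\<Phi> X \<in> pts (tot C)" using \<Phi> X by blast
    have "\<alpha> (ract C (\<Phi> X) g) = \<pi> (s (ract C (\<Phi> X) g))"
      using s2 rt[OF p g] h0_proj_eq[OF sp] by metis
    then show "\<alpha> (ract C (\<Phi> X) g) = \<pi> (bgg_act V (matrix_inv (flat_lift X ** g)) (s u0))"
      unfolding eqv[OF p g] act_inverse_lift[OF g] using \<Phi>[OF X] by simp
  qed
qed

text \<open>The section \<open>u \<mapsto> u\<^sup>-\<^sup>1 \<cdot> v\<close> is equivariant, and it is parallel because moving along a constant vector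
  field means right multiplication by \<open>exp(tX)\<close>. A parallel section satisfies both conditions in the
  definition of a BGG solution trivially.\<close>

lemma flat_solution:
  assumes v: "v \<in> bgg_space V" and W: "open W" "over flat_model U = SL \<inter> W"
    and \<alpha>: "\<And>u. u \<in> over flat_model U \<Longrightarrow> \<alpha> u = \<pi> (bgg_act V (matrix_inv u) v)"
  shows "BGG_solution flat_model V U \<alpha>"
proof -
  define s where "s u = bgg_act V (matrix_inv u) v" for u
  have ov: "u \<in> SL" if "u \<in> over flat_model U" for u
    using that by (simp add: over_def)
  have smooth: "smooth_on {g. det g \<noteq> 0} s"
    unfolding s_def[abs_def]
    by (rule smooth_on_compose[OF smooth_act smooth_on_matrix_inv]) (auto simp: det_matrix_inv)
  have op: "open {g :: 'n mat. det g \<noteq> 0}" by (rule open_det_nonzero)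
  have P: "u ** g \<in> over flat_model U" if u: "u \<in> over flat_model U" and g: "g \<in> Pgrp" for u g
  proof -
    obtain c where c: "c > 0" "g *v axis None 1 = c *\<^sub>R axis None 1" using g by (auto simp: Pgrp_def)
    have "sgn (u ** g *v axis None 1) = sgn (u *v axis None 1)"
      by (simp add: matrix_vector_mul_assoc[symmetric] c matrix_vector_mult_scaleR sgn_scaleR)
    then show ?thesis using u Pgrp_SL[OF g] by (simp add: over_def SL_mult)
  qed
  have eqv: "s (u ** g) = bgg_act V (matrix_inv g) (s u)" if "u \<in> SL" "g \<in> SL" for u g
    using that by (simp add: s_def matrix_inv_mult SL_det act_mult SL_inv)
  have sp: "s u \<in> bgg_space V" if "u \<in> SL" for u using that v by (simp add: s_def space_act SL_inv)
  have s: "s \<in> tractor_sections flat_model V U"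
    unfolding tractor_sections_def sections_def
  proof (intro CollectI ballI conjI)
    fix u assume "u \<in> over flat_model U"
    then have u: "u \<in> SL" by (rule ov)
    show "s u \<in> bgg_space V" by (rule sp[OF u])
    show "smooth_near (tot flat_model) u s"
      unfolding flat_model_sel by (rule smooth_near_SLI[OF u op _ smooth]) (simp_all add: u SL_det)
    show "s (ract flat_model u g) = bgg_act V (matrix_inv g) (s u)" if "g \<in> Pgrp" for g
      using eqv u Pgrp_SL[OF that] by simp
  qed
  have a: "\<alpha> \<in> h0_sections flat_model V U"
    unfolding h0_sections_def sections_def
  proof (intro CollectI ballI conjI)
    fix u assume uo: "u \<in> over flat_model U"
    then have u: "u \<in> SL" by (rule ov)
    show "\<alpha> u \<in> h0_space V" using proj_space[OF sp[OF u]] \<alpha>[OF uo] by (simp add: s_def)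
    have sm: "smooth_on (W \<inter> {g. det g \<noteq> 0}) (\<lambda>g. \<pi> (s g))"
      by (rule smooth_on_linear_image[OF bounded_linear_proj smooth_on_subset[OF smooth]]) blast
    show "smooth_near (tot flat_model) u \<alpha>"
      unfolding flat_model_sel
    proof (rule smooth_near_SLI[OF u open_Int[OF W(1) op] _ sm])
      show "u \<in> W \<inter> {g. det g \<noteq> 0}" using uo u W by (simp add: SL_det)
      fix y assume "y \<in> W \<inter> {g. det g \<noteq> 0}" "y \<in> SL"
      then show "\<alpha> y = \<pi> (s y)" using \<alpha>[of y] W by (simp add: s_def)
    qed
    show "\<alpha> (ract flat_model u g) = h0_act V (matrix_inv g) (\<alpha> u)" if "g \<in> Pgrp" for g
      using \<alpha>[OF P[OF uo that]] \<alpha>[OF uo] eqv[OF u Pgrp_SL[OF that]] proj_act[OF Pgrp_inv[OF that]]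
      by (simp add: s_def)
  qed
  have conn: "tractor_conn flat_model V s u X = 0" if u: "u \<in> SL" for u X
  proof -
    have "smooth_near SL_manifold u s"
      by (rule smooth_near_SLI[OF u op _ smooth]) (simp_all add: u SL_det)
    then have 1: "((\<lambda>t. s (u ** flat_lift (t *\<^sub>R X))) has_vector_derivative vderiv (cvf flat_model (gm X) u) s) (at 0)"
      by (rule vderiv_flat[OF u])
    have e: "s (u ** flat_lift (t *\<^sub>R X)) = bgg_act V (flat_lift ((- t) *\<^sub>R X)) (s u)" for t
      using eqv[OF u flat_lift_SL] by (simp add: matrix_inv_flat_lift)
    have d: "((\<lambda>t. - t) has_vector_derivative - 1) (at (0::real))"
      by (auto intro!: derivative_eq_intros)
    have i: "((\<lambda>t. bgg_act V (flat_lift (t *\<^sub>R X)) (s u)) has_vector_derivative inf_act V (gm X) (s u)) (at (- 0))"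
      using inf_act_gm by simp
    have "((\<lambda>t. bgg_act V (flat_lift ((- t) *\<^sub>R X)) (s u)) has_vector_derivative - inf_act V (gm X) (s u)) (at 0)"
      using vector_diff_chain_at[OF d i] unfolding comp_def scaleR_minus1_left .
    from vector_derivative_unique_at[OF 1[unfolded e] this] show ?thesis
      by (simp add: tractor_conn_def)
  qed
  have "BGG_splitting flat_model V U \<alpha> s"
    unfolding BGG_splitting_def
  proof (intro conjI ballI s)
    fix u assume uo: "u \<in> over flat_model U"
    then have u: "u \<in> SL" by (rule ov)
    show "h0_proj V (s u) = \<alpha> u" using h0_proj_eq[OF sp[OF u]] \<alpha>[OF uo] by (simp add: s_def)
    show "codiff1 (inf_act V) (tractor_conn flat_model V s u) = 0"
      by (simp add: codiff1_def conn[OF u] inf_act_gp_zero)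
  qed
  moreover have "tractor_conn flat_model V s u = (\<lambda>X. 0)" if "u \<in> over flat_model U" for u
    using conn[OF ov[OF that]] by blast
  ultimately show ?thesis
    unfolding BGG_solution_def first_BGG_def using a by (intro conjI exI[of _ s]) simp_all
qed

text \<open>Vanishing of the homology class means that \<open>\<nabla>s\<close> lies in the image of \<open>\<partial>\<^sup>*\<close>, hence takes values in
  \<open>\<pp>\<^sub>+ \<cdot> \<V>\<close>. Applying \<open>\<pi>\<close> leaves an equation for \<open>\<pi>(s)\<close> alone.\<close>

lemma flat_solution_parallel_proj:
  assumes sol: "BGG_solution flat_model V U \<alpha>"
  obtains s where "\<And>u. u \<in> over flat_model U \<Longrightarrow> s u \<in> bgg_space V"
    "\<And>u. u \<in> over flat_model U \<Longrightarrow> \<alpha> u = \<pi> (s u)"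
    "\<And>u g. u \<in> over flat_model U \<Longrightarrow> g \<in> Pgrp \<Longrightarrow> s (u ** g) = bgg_act V (matrix_inv g) (s u)"
    "\<And>u X. u \<in> over flat_model U \<Longrightarrow>
       ((\<lambda>t. \<pi> (s (u ** flat_lift (t *\<^sub>R X)))) has_vector_derivative - \<pi> (inf_act V (gm X) (s u))) (at 0)"
proof -
  obtain s where s: "BGG_splitting flat_model V U \<alpha> s"
    and h: "\<And>u. u \<in> over flat_model U \<Longrightarrow> homology_class V (\<lambda>X. 0) = homology_class V (tractor_conn flat_model V s u)"
    using sol unfolding BGG_solution_def first_BGG_def by auto
  have sec: "s u \<in> bgg_space V" "smooth_near SL_manifold u s" "u \<in> SL" "h0_proj V (s u) = \<alpha> u"
    "g \<in> Pgrp \<Longrightarrow> s (u ** g) = bgg_act V (matrix_inv g) (s u)" if "u \<in> over flat_model U" for u g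
    using s that unfolding BGG_splitting_def tractor_sections_def sections_def
    by (auto simp: over_def)
  have z: "(\<lambda>X. 0) \<in> codiff_image V"
    unfolding codiff_image_def
    by (intro CollectI exI[of _ "\<lambda>X Y. 0"]) (auto simp: codiff2_def inf_act_gp_zero zero_space
        bilinear_def linear_iff)
  show thesis
  proof (rule that[of s])
    fix u assume u: "u \<in> over flat_model U"
    show "s u \<in> bgg_space V" by (rule sec[OF u])
    show "\<alpha> u = \<pi> (s u)" using sec[OF u] h0_proj_eq by simp
    show "s (u ** g) = bgg_act V (matrix_inv g) (s u)" if "g \<in> Pgrp" for g
      using sec(5)[OF u that] .
    fix X
    have "tractor_conn flat_model V s u \<in> homology_class V (tractor_conn flat_model V s u)"
      unfolding homology_class_def using z by (intro CollectI exI[of _ "\<lambda>X. 0"]) simp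
    then have "tractor_conn flat_model V s u \<in> homology_class V (\<lambda>X. 0)" using h[OF u] by simp
    then have "tractor_conn flat_model V s u \<in> codiff_image V" by (auto simp: homology_class_def)
    then obtain \<psi> where \<psi>: "tractor_conn flat_model V s u = codiff2 (inf_act V) \<psi>"
      unfolding codiff_image_def by blast
    have "\<pi> (tractor_conn flat_model V s u X) = 0"
      unfolding \<psi> codiff2_def linear_sum[OF linear_proj] by (simp add: proj_inf_act_gp)
    then have "\<pi> (vderiv (cvf flat_model (gm X) u) s) = - \<pi> (inf_act V (gm X) (s u))"
      unfolding tractor_conn_def linear_add[OF linear_proj] by (simp add: eq_neg_iff_add_eq_0)
    with bounded_linear.has_vector_derivative[OF bounded_linear_proj vderiv_flat[OF sec(3)[OF u] sec(2)[OF u]], of X]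
    show "((\<lambda>t. \<pi> (s (u ** flat_lift (t *\<^sub>R X)))) has_vector_derivative - \<pi> (inf_act V (gm X) (s u))) (at 0)"
      by simp
  qed
qed

end

section \<open>Normal coordinates and normal frames\<close>

text \<open>The point \<open>u\<close> over the normal chart has normal coordinates \<open>X\<close> and differs from the normal section by
  \<open>g\<close>. The last clause says that \<open>g\<close> is the element selected by the definite description in
  \<open>normal_frame\<close>; it expresses that \<open>P\<close> acts freely on the fibre.\<close>

definition normal_data :: "('g, 'm, 'n::finite) cartan_geometry \<Rightarrow> (real^'n) set \<Rightarrow> (real^'n \<Rightarrow> 'g) \<Rightarrow>
    'g \<Rightarrow> real^'n \<Rightarrow> 'n mat \<Rightarrow> bool" where
  "normal_data C B \<Phi> u X g \<longleftrightarrow> X \<in> B \<and> g \<in> Pgrp \<and> u = ract C (\<Phi> X) g \<and>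
     ncoord C B \<Phi> (prj C u) = X \<and>
     (THE h. h \<in> Pgrp \<and> u = ract C (normal_section C B \<Phi> (prj C u)) h) = g"

lemma normal_dataI:
  assumes "X \<in> B" "inj_on (prj C \<circ> \<Phi>) B" "prj C u = prj C (\<Phi> X)"
    "g \<in> Pgrp" "u = ract C (\<Phi> X) g" "\<And>h. h \<in> Pgrp \<Longrightarrow> u = ract C (\<Phi> X) h \<Longrightarrow> h = g"
  shows "normal_data C B \<Phi> u X g"
proof -
  have n: "ncoord C B \<Phi> (prj C u) = X"
    using inv_into_f_f[OF assms(2,1)] by (simp add: ncoord_def assms(3))
  have t: "(THE h. h \<in> Pgrp \<and> u = ract C (\<Phi> X) h) = g"
    by (rule the_equality) (use assms(4-6) in blast)+
  show ?thesis unfolding normal_data_def normal_section_def n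
    by (intro conjI assms t refl)
qed

lemma normal_dataD:
  assumes "normal_data C B \<Phi> u X g"
  shows "X \<in> B" "g \<in> Pgrp" "u = ract C (\<Phi> X) g" "ncoord C B \<Phi> (prj C u) = X"
    "normal_frame C B \<Phi> \<tau> w u = \<tau> (matrix_inv g) w"
proof -
  show "X \<in> B" "g \<in> Pgrp" "u = ract C (\<Phi> X) g" "ncoord C B \<Phi> (prj C u) = X"
    using assms unfolding normal_data_def by blast+
  have *: "(THE h. h \<in> Pgrp \<and> u = ract C (normal_section C B \<Phi> (prj C u)) h) = g"
    using assms unfolding normal_data_def by blast
  show "normal_frame C B \<Phi> \<tau> w u = \<tau> (matrix_inv g) w"
    unfolding normal_frame_def * ..
qed

lemma normal_data_nframe_TM:
  "normal_data C B \<Phi> u X g \<Longrightarrow> nframe_TM C B \<Phi> i u = mat_block (matrix_inv g) *v axis i 1"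
  by (simp add: nframe_TM_def normal_dataD(5) quotient_act_def)

text \<open>The generalised homogeneous coordinates are the coordinates of the vector \<open>exp(X) g e\<^sub>0\<close>, since
  \<open>g e\<^sub>0 = g\<^sub>0\<^sub>0 e\<^sub>0\<close> and \<open>exp(X) e\<^sub>0 = e\<^sub>0 + X\<close>.\<close>

lemma normal_data_hom_coord:
  assumes "normal_data C B \<Phi> u X g"
  shows "hom_coord C B \<Phi> a u = (flat_lift X ** g) $ a $ None"
proof -
  note nd = normal_dataD[OF assms]
  note g = nd(2)
  have "hom_coord C B \<Phi> a u = (case a of None \<Rightarrow> 1 | Some i \<Rightarrow> X $ i) * g $ None $ None"
    unfolding hom_coord_def nd(4,5) density_act_def Pgrp_inv_00[OF g]
    by (simp add: power_int_minus)
  moreover have "(flat_lift X ** g) $ a $ None = flat_lift X $ a $ None * g $ None $ None"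
    using g by (simp add: Pgrp_iff matrix_matrix_mult_def UNIV_option_conv sum.reindex)
  ultimately show ?thesis by (simp add: flat_lift_component)
qed

lemma fibre_transitive:
  assumes pb: "principal_bundle C" and u: "u \<in> pts (tot C)" "u' \<in> pts (tot C)" "prj C u = prj C u'"
  shows "\<exists>g\<in>Pgrp. u = ract C u' g \<and> (\<forall>h\<in>Pgrp. u = ract C u' h \<longrightarrow> h = g)"
proof -
  define x where "x = prj C u"
  have u': "prj C u' = x" using u by (simp add: x_def)
  have ux: "prj C u = x" by (simp add: x_def)
  have "x \<in> pts (base C)"
    using pb u(1) unfolding principal_bundle_def smooth_map_def x_def by blast
  then obtain W \<tau> where W: "x \<in> W" "\<forall>y\<in>W. \<tau> y \<in> pts (tot C) \<and> prj C (\<tau> y) = y"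
    "bij_betw (\<lambda>(y, g). ract C (\<tau> y) g) (W \<times> Pgrp) (over C W)"
    using pb unfolding principal_bundle_def Let_def by blast
  have act: "prj C (ract C v g) = prj C v" "ract C (ract C v g) h = ract C v (g ** h)"
    if "v \<in> pts (tot C)" "g \<in> Pgrp" "h \<in> Pgrp" for v g h
    using pb that unfolding principal_bundle_def by blast+
  have triv: "\<exists>h\<in>Pgrp. v = ract C (\<tau> x) h" if v: "v \<in> pts (tot C)" "prj C v = x" for v
  proof -
    have "v \<in> (\<lambda>(y, g). ract C (\<tau> y) g) ` (W \<times> Pgrp)"
      using W(1,3) v by (simp add: bij_betw_def over_def)
    then obtain y h where y: "y \<in> W" "h \<in> Pgrp" "v = ract C (\<tau> y) h" by auto
    then have "prj C v = y" using act(1)[of "\<tau> y" h h] W(2) by simp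
    then have "y = x" using v(2) by simp
    then show ?thesis using y(2,3) by blast
  qed
  obtain h where h: "h \<in> Pgrp" "u = ract C (\<tau> x) h" using triv[OF u(1) ux] by blast
  obtain h' where h': "h' \<in> Pgrp" "u' = ract C (\<tau> x) h'" using triv[OF u(2) u'] by blast
  have t: "\<tau> x \<in> pts (tot C)" using W by blast
  have inj: "k = k'" if "k \<in> Pgrp" "k' \<in> Pgrp" "ract C (\<tau> x) k = ract C (\<tau> x) k'" for k k'
    using inj_onD[OF bij_betw_imp_inj_on[OF W(3)], of "(x, k)" "(x, k')"] that W(1) by simp
  have d: "det h' \<noteq> 0" using SL_det[OF Pgrp_SL[OF h'(1)]] by simp
  let ?g = "matrix_inv h' ** h"
  have g: "?g \<in> Pgrp" using h h' by (intro Pgrp_mult Pgrp_inv)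
  have "ract C u' ?g = ract C (\<tau> x) (h' ** ?g)" unfolding h'(2) by (rule act(2)[OF t h'(1) g])
  also have "h' ** ?g = h" using d by (simp add: matrix_mul_assoc)
  finally have "u = ract C u' ?g" unfolding h(2) by (rule sym)
  moreover have "k = ?g" if k: "k \<in> Pgrp" "u = ract C u' k" for k
  proof -
    have "ract C (\<tau> x) (h' ** k) = ract C (\<tau> x) h"
      unfolding act(2)[OF t h'(1) k(1), symmetric] h'(2)[symmetric] k(2)[symmetric] by (rule h(2))
    then have "h' ** k = h" by (intro inj Pgrp_mult h h' k)
    then have "matrix_inv h' ** (h' ** k) = ?g" by (rule arg_cong)
    then show ?thesis using d by (simp add: matrix_mul_assoc)
  qed
  ultimately show ?thesis using g by blast
qed

lemma normal_data_exists:
  assumes pb: "principal_bundle C" and nc: "normal_chart C u0 B \<Phi>"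
    and u: "u \<in> over C (chart_dom C B \<Phi>)"
  obtains X g where "normal_data C B \<Phi> u X g"
proof -
  obtain X where X: "X \<in> B" "prj C u = prj C (\<Phi> X)" "u \<in> pts (tot C)"
    using u by (auto simp: over_def chart_dom_def)
  have "flow1 C (gm X) u0 (\<Phi> X)" using nc X by (simp add: normal_chart_def)
  then obtain c where "c 1 = \<Phi> X" "\<forall>t\<in>{0..1::real}. c t \<in> pts (tot C)" unfolding flow1_def by blast
  then have "\<Phi> X \<in> pts (tot C)" by (metis atLeastAtMost_iff order_refl zero_le_one)
  from fibre_transitive[OF pb X(3) this X(2)] obtain g
    where "g \<in> Pgrp" "u = ract C (\<Phi> X) g" "\<forall>h\<in>Pgrp. u = ract C (\<Phi> X) h \<longrightarrow> h = g" by blast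
  then have "normal_data C B \<Phi> u X g"
    using nc X unfolding normal_chart_def by (intro normal_dataI) blast+
  then show thesis by (rule that)
qed

text \<open>The chart maps \<open>X\<close> to the ray through \<open>(1, X)\<close>, and a ray meets the affine hyperplane \<open>x\<^sub>0 = 1\<close> in at
  most one point.\<close>

lemma inj_flat_chart: "inj (prj flat_model \<circ> flat_lift)"
proof (rule injI)
  fix X Y :: "real^'n"
  let ?v = "\<lambda>X. flat_lift X *v axis None 1 :: real^'n option"
  assume "(prj flat_model \<circ> flat_lift) X = (prj flat_model \<circ> flat_lift) Y"
  then have eq: "inverse (norm (?v X)) *\<^sub>R ?v X = inverse (norm (?v Y)) *\<^sub>R ?v Y"
    by (simp add: sgn_div_norm)
  then have "(inverse (norm (?v X)) *\<^sub>R ?v X) $ None = (inverse (norm (?v Y)) *\<^sub>R ?v Y) $ None" by simp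
  then have n: "inverse (norm (?v X)) = inverse (norm (?v Y))" by (simp add: flat_lift_mult_vec)
  have "?v X $ None = 1" by (simp add: flat_lift_mult_vec)
  then have "?v X \<noteq> 0" by (metis zero_index zero_neq_one)
  then have "?v X = ?v Y" using eq unfolding n by (metis inverse_zero_imp_zero n norm_eq_zero
      real_vector.scale_left_imp_eq)
  then show "X = Y" by (simp add: flat_lift_mult_vec vec_eq_iff split_option_all)
qed

lemma prj_mult_Pgrp: "g \<in> Pgrp \<Longrightarrow> sgn (u ** g *v axis None 1) = sgn (u *v axis None 1)"
  by (auto simp: Pgrp_def matrix_vector_mul_assoc[symmetric] matrix_vector_mult_scaleR sgn_scaleR)

lemma normal_data_flatI:
  assumes "g \<in> Pgrp" shows "normal_data flat_model UNIV flat_lift (flat_lift X ** g) X g"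
proof (rule normal_dataI)
  fix h :: "'a mat" assume "flat_lift X ** g = ract flat_model (flat_lift X) h"
  then have "flat_lift (- X) ** (flat_lift X ** g) = flat_lift (- X) ** (flat_lift X ** h)" by simp
  then show "h = g" by (simp add: matrix_mul_assoc flat_lift_add flat_lift_0)
qed (simp_all add: assms inj_flat_chart prj_mult_Pgrp)

text \<open>The rays that meet the affine hyperplane \<open>x\<^sub>0 = 1\<close> are those with positive zeroth coordinate.\<close>

lemma over_flat_dom: "over flat_model flat_dom = SL \<inter> {u. 0 < u $ None $ None}" (is "?A = ?B")
proof (intro equalityI subsetI)
  fix u :: "'a mat" assume "u \<in> ?A"
  then obtain X where u: "u \<in> SL" and X: "sgn (u *v axis None 1) = sgn (flat_lift X *v axis None 1)"
    by (auto simp: over_def chart_dom_def)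
  have "sgn (flat_lift X *v axis None 1) $ None > 0"
  proof -
    have "(flat_lift X *v axis None 1) $ None = 1" by (simp add: flat_lift_mult_vec)
    then have "flat_lift X *v axis None 1 \<noteq> 0" by (metis zero_index zero_neq_one)
    then show ?thesis by (simp add: sgn_div_norm flat_lift_mult_vec)
  qed
  then have "sgn (u *v axis None 1) $ None > 0" using X by simp
  then show "u \<in> ?B" using u by (simp add: sgn_div_norm mult_axis zero_less_mult_iff)
next
  fix u :: "'a mat" assume u: "u \<in> ?B"
  let ?X = "\<chi> i. u $ Some i $ None / u $ None $ None"
  have "u *v axis None 1 = (u $ None $ None) *\<^sub>R (flat_lift ?X *v axis None 1)"
    using u by (simp add: vec_eq_iff mult_axis flat_lift_component split_option_all)
  then have "sgn (u *v axis None 1) = sgn (flat_lift ?X *v axis None 1)"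
    using u by (simp add: sgn_scaleR)
  then show "u \<in> ?A" using u by (auto simp: over_def chart_dom_def)
qed

lemma open_flat_dom: "open {u :: 'n::finite mat. 0 < u $ None $ None}"
  by (intro open_Collect_less continuous_intros)

lemma normal_data_flat:
  assumes "u \<in> over flat_model flat_dom"
  obtains X g where "normal_data flat_model UNIV flat_lift u X g" "u = flat_lift X ** g" "g \<in> Pgrp"
proof -
  have u: "u \<in> SL" "0 < u $ None $ None" using assms unfolding over_flat_dom by blast+
  define X where "X = (\<chi> i. u $ Some i $ None / u $ None $ None)"
  define g where "g = flat_lift (- X) ** u"
  have "g $ Some i $ None = 0" for i
    using u by (simp add: g_def X_def matrix_matrix_mult_def UNIV_option_conv sum.reindex flat_lift_component
        if_distrib if_distribR cong: if_cong)
  moreover have "g $ None $ None = u $ None $ None"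
    by (simp add: g_def matrix_matrix_mult_def UNIV_option_conv sum.reindex flat_lift_component)
  ultimately have g: "g \<in> Pgrp" using u by (simp add: Pgrp_iff g_def SL_mult flat_lift_SL)
  have "u = flat_lift X ** g" by (simp add: g_def matrix_mul_assoc flat_lift_add flat_lift_0)
  then show thesis using that normal_data_flatI[OF g] g by metis
qed

text \<open>Stated in the form \<open>SL \<inter> W\<close> with \<open>W\<close> open in which \<open>flat_solution\<close> takes the domain.\<close>

lemma over_sphere: "over flat_model (pts (base flat_model)) = SL \<inter> UNIV"
proof -
  have "u *v axis None 1 \<noteq> 0" if "u \<in> SL" for u :: "'n::finite mat"
  proof
    assume "u *v axis None 1 = 0"
    then have "(matrix_inv u ** u) *v axis None 1 = 0" by (simp add: matrix_vector_mul_assoc[symmetric])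
    then show False using that by (simp add: SL_det axis_eq_0_iff)
  qed
  then show ?thesis by (auto simp: over_def norm_sgn)
qed

lemma axis_component: "axis i x $ j = (if j = i then x else 0)"
  by (simp add: axis_def)

text \<open>Let \<open>c = g\<^sub>0\<^sub>0\<close>. Then \<open>g Y = c e\<^sub>i - c\<^sup>2 z e\<^sub>0\<close>, so \<open>exp(X) g exp(tY) e\<^sub>0\<close> is \<open>c (1 - tcz)\<close> times the
  vector \<open>(1, X + t/(1 - tcz) e\<^sub>i)\<close>. On rays, the curve thus moves in the direction of \<open>e\<^sub>i\<close> in the normal
  coordinates, with unit speed at \<open>t = 0\<close>.\<close>

lemma flat_curve_projection:
  fixes g :: "'n::finite mat"
  assumes g: "g \<in> Pgrp" and c: "c = g $ None $ None" and z: "z = matrix_inv g $ None $ Some i"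
    and Y: "Y = c *\<^sub>R (mat_block (matrix_inv g) *v axis i 1)" and t: "1 - t * c * z > 0"
  shows "sgn (flat_lift X ** g ** flat_lift (t *\<^sub>R Y) *v axis None 1)
    = sgn (flat_lift (X + (t / (1 - t * c * z)) *\<^sub>R axis i 1) *v axis None 1)"
proof -
  have c0: "c > 0" using g by (simp add: c Pgrp_iff)
  let ?E = "\<lambda>X. flat_lift X *v axis None 1 :: real^'n option" and ?r = "1 - t * c * z"
  have Y0: "?E Y = c *\<^sub>R (matrix_inv g *v axis (Some i) 1) + (1 - c * z) *\<^sub>R axis None 1"
    by (simp add: vec_eq_iff split_option_all flat_lift_mult_vec Y mult_axis mat_block_def z axis_component)
  have E: "?E (t *\<^sub>R Y) = (1 - t) *\<^sub>R axis None 1 + t *\<^sub>R ?E Y"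
    by (simp add: vec_eq_iff split_option_all flat_lift_mult_vec axis_component)
  have ge0: "g *v axis None 1 = c *\<^sub>R axis None 1"
    using g by (simp add: vec_eq_iff mult_axis split_option_all c Pgrp_iff axis_component)
  have "g *v (matrix_inv g *v axis (Some i) 1) = axis (Some i) 1"
    using SL_det[OF Pgrp_SL[OF g]] by (simp add: matrix_vector_mul_assoc)
  then have gE: "g *v ?E (t *\<^sub>R Y) = (c * ?r) *\<^sub>R axis None 1 + (t * c) *\<^sub>R axis (Some i) 1"
    unfolding E Y0
    by (simp add: matrix_vector_right_distrib matrix_vector_mult_scaleR ge0 scaleR_add_right)
      (simp add: algebra_simps)
  have fE: "flat_lift X *v axis (Some i) 1 = axis (Some i) 1"
    by (simp add: vec_eq_iff mult_axis split_option_all flat_lift_component axis_component)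
  have "flat_lift X ** g ** flat_lift (t *\<^sub>R Y) *v axis None 1 = flat_lift X *v (g *v ?E (t *\<^sub>R Y))"
    by (simp add: matrix_vector_mul_assoc matrix_mul_assoc)
  also have "\<dots> = (c * ?r) *\<^sub>R ?E X + (t * c) *\<^sub>R axis (Some i) 1"
    unfolding gE by (simp add: matrix_vector_right_distrib matrix_vector_mult_scaleR fE)
  also have "\<dots> = (c * ?r) *\<^sub>R ?E (X + (t / ?r) *\<^sub>R axis i 1)"
    using t by (simp add: vec_eq_iff split_option_all flat_lift_mult_vec axis_component field_simps)
  finally show ?thesis using t c0 by (simp add: sgn_scaleR)
qed

lemma smooth_on_flat_prj:
  fixes f :: "real^('n::finite option) \<Rightarrow> real"
  assumes "smooth_near (embedded (sphere 0 1) :: (real^'n option, real^'n) manifold) x f" "norm x = 1"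
  obtains S where "open S" "smooth_on S (\<lambda>h :: 'n mat. f (sgn (h *v axis None 1)))"
    "\<And>h. sgn (h *v axis None 1) = x \<Longrightarrow> h \<in> S"
proof -
  obtain W F where W: "open W" "x \<in> W" "smooth_on W F" "\<forall>y\<in>W \<inter> sphere 0 1. f y = F y"
    using assms(1) by (rule smooth_near_embeddedE)
  let ?e = "\<lambda>h :: 'n mat. h *v axis None 1" and ?N = "- {0} \<inter> sgn -` W"
  have "bounded_linear ?e"
    by (intro linear_conv_bounded_linear[THEN iffD1] linearI)
      (simp_all add: matrix_vector_mult_add_rdistrib scaleR_matrix_vector_assoc)
  then have se: "smooth_on UNIV ?e" by (rule smooth_on_linear_image[OF _ smooth_on_ident])
  have "open ?N"
    by (intro continuous_open_preimage smooth_on_continuous[OF smooth_on_sgn] W open_Compl closed_singleton)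
  then have op: "open (?e -` ?N)" by (rule open_vimage[OF _ smooth_on_continuous[OF se]])
  have "smooth_on ?N (\<lambda>y. F (sgn y))"
    by (rule smooth_on_compose[OF W(3) smooth_on_subset[OF smooth_on_sgn]]) auto
  then have s: "smooth_on (?e -` ?N) (\<lambda>h. F (sgn (?e h)))"
    by (rule smooth_on_compose[OF _ smooth_on_subset[OF se]]) auto
  show thesis
  proof (rule that[OF op])
    show "smooth_on (?e -` ?N) (\<lambda>h. f (sgn (?e h)))"
      by (rule smooth_on_cong[OF op _ s]) (use W(4) in \<open>auto simp: norm_sgn\<close>)
    show "h \<in> ?e -` ?N" if "sgn (?e h) = x" for h
      using that W(2) assms(2) by auto
  qed
qed

lemma flat_lift_has_derivative: "(flat_lift has_derivative (\<lambda>X. sl_mat (gm X))) (at X)"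
proof -
  have "bounded_linear (\<lambda>X. sl_mat (gm X))"
    by (intro linear_conv_bounded_linear[THEN iffD1] linearI) (simp_all add: sl_mat_gm_add sl_mat_gm_scaleR)
  then have "((\<lambda>X. mat 1 + sl_mat (gm X)) has_derivative (\<lambda>X. 0 + sl_mat (gm X))) (at X)"
    by (intro has_derivative_add has_derivative_const bounded_linear_imp_has_derivative)
  then show ?thesis by (simp add: flat_lift_eq[abs_def])
qed

text \<open>Both sides are derivatives at \<open>t = 0\<close> of the test function along curves that agree by
  \<open>flat_curve_projection\<close>.\<close>

lemma flat_coord_field:
  assumes "u \<in> over flat_model flat_dom"
  shows "push (tot flat_model) (base flat_model) (prj flat_model) u
            (cvf flat_model (gm (hom_coord flat_model UNIV flat_lift None u *\<^sub>R
               nframe_TM flat_model UNIV flat_lift i u)) u)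
          = coord_field flat_model UNIV flat_lift i (prj flat_model u)"
proof -
  obtain X g where nd: "normal_data flat_model UNIV flat_lift u X g" and u: "u = flat_lift X ** g" and g: "g \<in> Pgrp"
    using normal_data_flat[OF assms] by blast
  have uSL: "u \<in> SL" using u g Pgrp_SL SL_mult flat_lift_SL by metis
  define c z Y where "c = g $ None $ None" and "z = matrix_inv g $ None $ Some i"
    and "Y = c *\<^sub>R (mat_block (matrix_inv g) *v axis i 1)"
  note key = flat_curve_projection[OF g c_def z_def Y_def, of _ X]
  have "hom_coord flat_model UNIV flat_lift None u = c"
    unfolding normal_data_hom_coord[OF nd] using g
    by (simp add: c_def matrix_matrix_mult_def UNIV_option_conv sum.reindex flat_lift_component Pgrp_iff)
  then have Y: "hom_coord flat_model UNIV flat_lift None u *\<^sub>R nframe_TM flat_model UNIV flat_lift i u = Y"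
    by (simp add: Y_def normal_data_nframe_TM[OF nd])
  let ?p = "\<lambda>h :: 'a mat. sgn (h *v axis None 1)"
  have "push (tot flat_model) (base flat_model) (prj flat_model) u (cvf flat_model (gm Y) u) f
        = coord_field flat_model UNIV flat_lift i (prj flat_model u) f" for f
  proof (cases "smooth_near (embedded (sphere 0 1) :: (real^'a option, real^'a) manifold) (?p u) f")
    case False
    then show ?thesis by (simp add: push_def coord_field_def)
  next
    case True
    have "norm (?p u) = 1" using uSL over_sphere by (auto simp: over_def)
    from smooth_on_flat_prj[OF True this] obtain S where S: "open S" "smooth_on S (\<lambda>h. f (?p h))"
      "\<And>h. ?p h = ?p u \<Longrightarrow> h \<in> S" by blast
    have sm: "smooth_near SL_manifold u (f \<circ> ?p)"
      by (rule smooth_near_SLI[OF uSL S(1) S(3)[OF refl] S(2)]) simp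
    have L: "((\<lambda>t. f (?p (u ** flat_lift (t *\<^sub>R Y)))) has_real_derivative cvf flat_model (gm Y) u (f \<circ> ?p)) (at 0)"
      using cvf_flat_deriv[OF uSL sm, of Y] by (simp add: comp_def)
    have "flat_lift X \<in> S" using u g by (intro S(3)) (simp add: prj_mult_Pgrp)
    from has_derivative_compose[OF flat_lift_has_derivative smooth_on_has_derivative[OF S(2) this]]
    have "(\<lambda>X. f (?p (flat_lift X))) differentiable (at X)" by (rule differentiableI)
    then have c2: "((\<lambda>X. f (?p (flat_lift X))) has_derivative frechet_derivative (\<lambda>X. f (?p (flat_lift X))) (at X))
        (at (X + (0 / (1 - 0 * c * z)) *\<^sub>R axis i 1))" (is "(_ has_derivative ?D) _")
      by (simp add: frechet_derivative_works[THEN iffD1])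
    have c1: "((\<lambda>t. X + (t / (1 - t * c * z)) *\<^sub>R axis i 1) has_derivative (\<lambda>t. t *\<^sub>R axis i 1)) (at (0::real))"
      by (auto intro!: derivative_eq_intros)
    have o: "open {t::real. 1 - t * c * z > 0}"
      by (intro open_Collect_less continuous_intros)
    have "((\<lambda>t. f (?p (u ** flat_lift (t *\<^sub>R Y)))) has_derivative (\<lambda>t. ?D (t *\<^sub>R axis i 1))) (at 0)"
      by (rule has_derivative_transform_within_open[OF has_derivative_compose[OF c1 c2] o]) (simp_all add: key u)
    then have "((\<lambda>t. f (?p (u ** flat_lift (t *\<^sub>R Y)))) has_real_derivative ?D (axis i 1)) (at 0)"
      unfolding has_field_derivative_def linear_cmul[OF has_derivative_linear[OF c2]]
      by (simp add: mult.commute[of _ "?D _"])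
    from DERIV_unique[OF L this] have "cvf flat_model (gm Y) u (f \<circ> ?p) = ?D (axis i 1)" .
    then show ?thesis using True
      by (simp add: push_def coord_field_def comp_def normal_dataD(4)[OF nd, simplified])
  qed
  then show ?thesis unfolding Y by (rule ext)
qed

section \<open>The tensor representations as BGG data\<close>

text \<open>The matrix coefficients of \<open>g\<close> on the tensor power.\<close>

definition tensor_kernel :: "real^'i^'i \<Rightarrow> ('r::finite \<Rightarrow> 'i::finite) \<Rightarrow> ('r \<Rightarrow> 'i) \<Rightarrow> real" where
  "tensor_kernel g s s' = (\<Prod>a\<in>UNIV. g $ s a $ s' a)"

lemma tensor_act_kernel: "tensor_act g t = (\<chi> s. \<Sum>s'\<in>UNIV. tensor_kernel g s s' * t $ s')"
  by (simp add: tensor_act_def tensor_kernel_def)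

lemma mixed_act_kernel: "mixed_act g t = (\<chi> q. \<Sum>q'\<in>UNIV.
    tensor_kernel (dual_mat g) (fst q) (fst q') * tensor_kernel g (snd q) (snd q') * t $ q')"
  by (simp add: mixed_act_def tensor_kernel_def)

lemma prod_sum_funs:
  fixes f :: "'r::finite \<Rightarrow> 'i::finite \<Rightarrow> real"
  shows "(\<Prod>a\<in>UNIV. \<Sum>i\<in>UNIV. f a i) = (\<Sum>s\<in>UNIV. \<Prod>a\<in>UNIV. f a (s a))"
  using prod_sum_PiE[of UNIV "\<lambda>_::'r. UNIV :: 'i set" f] by (simp add: PiE_def extensional_def)

lemma tensor_kernel_mult:
  "tensor_kernel (g ** h) s s'' = (\<Sum>s'\<in>UNIV. tensor_kernel g s s' * tensor_kernel h s' s'')"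
  by (simp add: tensor_kernel_def matrix_matrix_mult_def prod_sum_funs prod.distrib)

lemma tensor_kernel_one: "tensor_kernel (mat 1) s s' = (if s = s' then 1 else 0)"
proof (cases "s = s'")
  case False
  then obtain a where "s a \<noteq> s' a" by auto
  then have "\<exists>a\<in>UNIV. (mat 1 :: real^'a^'a) $ s a $ s' a = 0" by (auto simp: mat_def)
  then show ?thesis using False unfolding tensor_kernel_def by (simp add: prod_zero_iff)
qed (simp add: tensor_kernel_def mat_def)

lemma tensor_kernel_permute:
  assumes "p permutes UNIV" shows "tensor_kernel g (s \<circ> p) (s' \<circ> p) = tensor_kernel g s s'"
  unfolding tensor_kernel_def comp_def by (rule prod.permute[OF assms, symmetric, unfolded comp_def])

lemma sum_permute_funs:
  fixes f :: "('r::finite \<Rightarrow> 'i::finite) \<Rightarrow> real"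
  assumes "p permutes UNIV" shows "(\<Sum>s\<in>UNIV. f (s \<circ> p)) = (\<Sum>s\<in>UNIV. f s)"
proof (rule sum.reindex_bij_betw)
  have "(s \<circ> p) \<circ> inv p = s" "(s \<circ> inv p) \<circ> p = s" for s :: "'r \<Rightarrow> 'i"
    using permutes_inv_o[OF assms] by (simp_all add: comp_assoc)
  then show "bij_betw (\<lambda>s :: 'r \<Rightarrow> 'i. s \<circ> p) UNIV UNIV"
    by (intro bij_betw_byWitness[where f' = "\<lambda>s. s \<circ> inv p"]) auto
qed

lemma tensor_act_permute:
  assumes "p permutes UNIV"
  shows "tensor_act g t $ (s \<circ> p) = (\<Sum>s'\<in>UNIV. tensor_kernel g s s' * t $ (s' \<circ> p))"
proof -
  have "tensor_act g t $ (s \<circ> p) = (\<Sum>s'\<in>UNIV. tensor_kernel g (s \<circ> p) (s' \<circ> p) * t $ (s' \<circ> p))"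
    by (simp add: tensor_act_kernel sum_permute_funs[OF assms, of "\<lambda>s'. tensor_kernel g (s \<circ> p) s' * t $ s'"])
  then show ?thesis by (simp add: tensor_kernel_permute[OF assms])
qed

lemma linear_tensor_act: "linear (tensor_act g)"
  by (rule linearI) (simp_all add: tensor_act_kernel vec_eq_iff distrib_left sum.distrib sum_distrib_left mult_ac)

lemma linear_mixed_act: "linear (mixed_act g)"
  by (rule linearI) (simp_all add: mixed_act_kernel vec_eq_iff distrib_left sum.distrib sum_distrib_left mult_ac)

lemma tensor_act_mult: "tensor_act (g ** h) t = tensor_act g (tensor_act h t)"
proof -
  have "(\<Sum>s''\<in>UNIV. tensor_kernel (g ** h) s s'' * t $ s'')
      = (\<Sum>s'\<in>UNIV. tensor_kernel g s s' * (\<Sum>s''\<in>UNIV. tensor_kernel h s' s'' * t $ s''))" for s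
    unfolding tensor_kernel_mult sum_distrib_right sum_distrib_left
    by (subst sum.swap) (simp add: mult_ac)
  then show ?thesis by (simp add: tensor_act_kernel)
qed

lemma tensor_act_one: "tensor_act (mat 1) t = t"
  by (simp add: tensor_act_kernel tensor_kernel_one vec_eq_iff if_distrib if_distribR cong: if_cong)

lemma dual_mat_mult: "g \<in> SL \<Longrightarrow> h \<in> SL \<Longrightarrow> dual_mat (g ** h) = dual_mat g ** dual_mat h"
  by (simp add: dual_mat_def matrix_inv_mult SL_det matrix_transpose_mul)

lemma dual_mat_one: "dual_mat (mat 1) = mat 1"
proof -
  have "matrix_inv (mat 1 :: real^'a^'a) = mat 1" by (rule matrix_inv_unique) simp
  then show ?thesis by (simp add: dual_mat_def transpose_mat)
qed

lemma sum_UNIV_prod: "(\<Sum>q\<in>UNIV. f q) = (\<Sum>a\<in>UNIV. \<Sum>b\<in>UNIV. f (a, b))"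
  for f :: "'a::finite \<times> 'b::finite \<Rightarrow> real"
  by (simp add: sum.cartesian_product UNIV_Times_UNIV[symmetric] del: UNIV_Times_UNIV)

lemma mixed_act_slices:
  "mixed_act g t $ (k, s) = (\<Sum>k'\<in>UNIV. tensor_kernel (dual_mat g) k k' * tensor_act g (\<chi> s'. t $ (k', s')) $ s)"
  by (simp add: mixed_act_kernel sum_UNIV_prod tensor_act_kernel sum_distrib_left mult_ac)

lemma mixed_act_mult:
  assumes "g \<in> SL" "h \<in> SL" shows "mixed_act (g ** h) t = mixed_act g (mixed_act h t)"
proof -
  have "mixed_act g (mixed_act h t) $ (k, s) = mixed_act (g ** h) t $ (k, s)" for k s
  proof -
    let ?t = "\<lambda>k. \<chi> s. t $ (k, s)"
    have 1: "(\<chi> s. mixed_act h t $ (k', s))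
        = (\<Sum>k''\<in>UNIV. tensor_kernel (dual_mat h) k' k'' *\<^sub>R tensor_act h (?t k''))" for k'
      by (simp add: vec_eq_iff mixed_act_slices)
    have "mixed_act g (mixed_act h t) $ (k, s) = (\<Sum>k'\<in>UNIV. \<Sum>k''\<in>UNIV.
        tensor_kernel (dual_mat g) k k' * tensor_kernel (dual_mat h) k' k'' * tensor_act (g ** h) (?t k'') $ s)"
      unfolding mixed_act_slices[of g] 1 linear_sum[OF linear_tensor_act] linear_cmul[OF linear_tensor_act]
      by (simp add: tensor_act_mult sum_distrib_left mult_ac)
    also have "\<dots> = (\<Sum>k''\<in>UNIV. tensor_kernel (dual_mat (g ** h)) k k'' * tensor_act (g ** h) (?t k'') $ s)"
      unfolding dual_mat_mult[OF assms] tensor_kernel_mult sum_distrib_right by (rule sum.swap)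
    finally show ?thesis by (simp add: mixed_act_slices)
  qed
  then show ?thesis by (simp add: vec_eq_iff split_paired_all)
qed

lemma mixed_act_one: "mixed_act (mat 1) t = t"
  by (simp add: vec_eq_iff split_paired_all mixed_act_slices dual_mat_one tensor_act_one tensor_kernel_one
      if_distrib if_distribR cong: if_cong)

lemma smooth_on_tensor_kernel:
  assumes "smooth_on S f" shows "smooth_on S (\<lambda>g. tensor_kernel (f g) s s')"
  unfolding tensor_kernel_def by (intro smooth_on_prod smooth_on_vec_nth assms)

lemma smooth_on_tensor_act:
  assumes "smooth_on S f" shows "smooth_on S (\<lambda>g. tensor_act (f g) t)"
  unfolding tensor_act_kernel
  by (intro smooth_on_vec_lambda smooth_on_sum smooth_on_mult smooth_on_tensor_kernel smooth_on_const assms)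

lemma smooth_on_dual_mat: "smooth_on {g :: real^'i^'i::finite. det g \<noteq> 0} dual_mat"
  unfolding dual_mat_def[abs_def] transpose_def
  by (intro smooth_on_vec_lambda smooth_on_vec_nth smooth_on_matrix_inv)

lemma smooth_on_mixed_act: "smooth_on {g. det g \<noteq> 0} (\<lambda>g. mixed_act g t)"
  unfolding mixed_act_kernel
  by (intro smooth_on_vec_lambda smooth_on_sum smooth_on_mult smooth_on_tensor_kernel smooth_on_const
      smooth_on_dual_mat smooth_on_ident)

lemma alternating_tensor_act: "t \<in> alternating \<Longrightarrow> tensor_act g t \<in> alternating"
  by (simp add: alternating_def tensor_act_permute) (simp add: tensor_act_kernel sum_distrib_left mult_ac)

lemma symmetric_tensor_act: "t \<in> symmetric \<Longrightarrow> tensor_act g t \<in> symmetric"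
  by (simp add: symmetric_def tensor_act_permute) (simp add: tensor_act_kernel)

text \<open>If \<open>m\<close> preserves the line of \<open>e\<^sub>0\<close>, it acts on tensors modulo those containing a factor \<open>e\<^sub>0\<close>.\<close>

lemma tensor_act_top:
  fixes m :: "'n::finite mat" and t :: "real^('r::finite \<Rightarrow> 'n option)"
  assumes "\<And>i. m $ Some i $ None = 0"
  shows "(\<chi> s. tensor_act m t $ (Some \<circ> s)) = tensor_act (mat_block m) (\<chi> s. t $ (Some \<circ> s))"
proof -
  have "(\<Sum>s'\<in>UNIV. tensor_kernel m (Some \<circ> s) s' * t $ s')
      = (\<Sum>s'\<in>UNIV. tensor_kernel (mat_block m) s s' * t $ (Some \<circ> s'))" for s :: "'r \<Rightarrow> 'n"
  proof -
    have "(\<Sum>s'\<in>UNIV. tensor_kernel m (Some \<circ> s) s' * t $ s')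
        = (\<Sum>s'\<in>range (\<lambda>s''. Some \<circ> s''). tensor_kernel m (Some \<circ> s) s' * t $ s')"
    proof (rule sum.mono_neutral_right)
      show "\<forall>s'\<in>UNIV - range (\<lambda>s''. Some \<circ> s''). tensor_kernel m (Some \<circ> s) s' * t $ s' = 0"
      proof
        fix s' :: "'r \<Rightarrow> 'n option" assume s': "s' \<in> UNIV - range (\<lambda>s''. Some \<circ> s'')"
        have "\<exists>a. s' a = None"
        proof (rule ccontr)
          assume "\<nexists>a. s' a = None"
          then have "s' = Some \<circ> (\<lambda>a. the (s' a))" by (auto simp: fun_eq_iff)
          then show False using s' by blast
        qed
        then obtain a where "s' a = None" by blast
        then have "\<exists>a\<in>UNIV. m $ (Some \<circ> s) a $ s' a = 0" using assms by (intro bexI[of _ a]) simp_all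
        then show "tensor_kernel m (Some \<circ> s) s' * t $ s' = 0"
          unfolding tensor_kernel_def by (simp add: prod_zero_iff)
      qed
    qed auto
    also have "\<dots> = (\<Sum>s''\<in>UNIV. tensor_kernel m (Some \<circ> s) (Some \<circ> s'') * t $ (Some \<circ> s''))"
      by (subst sum.reindex) (auto simp: inj_on_def fun_eq_iff)
    finally show ?thesis by (simp add: tensor_kernel_def mat_block_def)
  qed
  then show ?thesis by (simp add: tensor_act_kernel)
qed

lemma Pgrp_top: "g \<in> Pgrp \<Longrightarrow> g $ Some i $ None = 0"
  by (simp add: Pgrp_iff)

lemma mat_block_gp: "mat_block (mat 1 + t *\<^sub>R sl_mat (gp Z)) = mat 1"
  by (simp add: mat_block_def vec_eq_iff sl_mat_gp mat_def)

lemma gp_00: "(mat 1 + t *\<^sub>R sl_mat (gp Z)) $ None $ None = 1"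
  by (simp add: sl_mat_gp mat_def)

text \<open>On the line of \<open>e\<^sub>0\<close> the group \<open>P\<close> acts by scalars, so the value of a form at \<open>(e\<^sub>0, \<dots>, e\<^sub>0)\<close> is
  multiplied by a power of such a scalar.\<close>

lemma tensor_kernel_dual_Pgrp:
  assumes "g \<in> Pgrp"
  shows "tensor_kernel (dual_mat g) (\<lambda>_::'k::finite. None) k'
    = (if k' = (\<lambda>_. None) then density_act (int CARD('k)) g 1 else 0)"
proof (cases "k' = (\<lambda>_. None)")
  case True
  then show ?thesis
    by (simp add: tensor_kernel_def dual_mat_def transpose_def Pgrp_inv_00[OF assms] density_act_def
        power_int_minus power_divide inverse_eq_divide)
next
  case False
  then obtain a i where "k' a = Some i" by (auto simp: fun_eq_iff)
  then have "\<exists>a\<in>UNIV. dual_mat g $ None $ k' a = 0"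
    using Pgrp_top[OF Pgrp_inv[OF assms]] by (intro bexI[of _ a]) (simp_all add: dual_mat_def transpose_def)
  then show ?thesis using False unfolding tensor_kernel_def by (simp add: prod_zero_iff)
qed

lemma density_act_one: "density_act w g y = density_act w g 1 * y"
  by (simp add: density_act_def)

lemma bgg_module_ext: "bgg_module (ext_bgg :: ('n::finite, real^('r::finite \<Rightarrow> 'n option), _) bgg_data)
    (\<lambda>t. \<chi> s. t $ (Some \<circ> s))"
proof (rule bgg_module.intro)
  show "linear (\<lambda>t. \<chi> s. t $ (Some \<circ> s) :: real^('r \<Rightarrow> 'n))"
    by (rule linearI) (simp_all add: vec_eq_iff)
  show "(\<chi> s. v $ (Some \<circ> s)) \<in> h0_space ext_bgg"
    if "v \<in> bgg_space ext_bgg" for v :: "real^('r \<Rightarrow> 'n option)"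
    using that by (simp add: ext_bgg_def alternating_def comp_assoc[symmetric])
qed (simp_all add: ext_bgg_def linear_tensor_act smooth_on_tensor_act smooth_on_ident tensor_act_mult
    tensor_act_one alternating_tensor_act tensor_act_top Pgrp_top mat_block_gp, simp add: alternating_def)

lemma bgg_module_sym: "bgg_module (sym_bgg :: ('n::finite, real^('k::finite \<Rightarrow> 'n option), _) bgg_data)
    (\<lambda>t. t $ (\<lambda>_. None))"
proof (rule bgg_module.intro)
  show "linear (\<lambda>t :: real^('k \<Rightarrow> 'n option). t $ (\<lambda>_. None))"
    by (rule linearI) simp_all
  show "bgg_act sym_bgg g v $ (\<lambda>_. None) = h0_act (sym_bgg :: ('n, real^('k \<Rightarrow> 'n option), real) bgg_data) g (v $ (\<lambda>_. None))"
    if "g \<in> Pgrp" for g and v :: "real^('k \<Rightarrow> 'n option)"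
    by (simp add: sym_bgg_def tensor_act_kernel tensor_kernel_dual_Pgrp[OF that] if_distrib if_distribR
        density_act_one[of _ _ "v $ _"] cong: if_cong)
  show "h0_act (sym_bgg :: ('n, real^('k \<Rightarrow> 'n option), real) bgg_data) (mat 1 + t *\<^sub>R sl_mat (gp Z)) w = w" for t and Z :: "real^'n" and w
    unfolding sym_bgg_def by (simp add: density_act_def gp_00 del: vector_add_component)
qed (simp_all add: sym_bgg_def linear_tensor_act smooth_on_tensor_act smooth_on_dual_mat tensor_act_mult
    tensor_act_one symmetric_tensor_act dual_mat_mult dual_mat_one, simp add: symmetric_def)

lemma alternating_wedge: "(wedge vs :: real^('r::{finite,linorder} \<Rightarrow> 'i::finite)) \<in> alternating"
proof -
  have "det (\<chi> a b. vs ! card {c::'r. c < b} $ s (p a))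
      = of_int (sign p) * det (\<chi> a b. vs ! card {c::'r. c < b} $ s a)"
    if "p permutes UNIV" for p and s :: "'r \<Rightarrow> 'i"
    using det_permute_rows[OF that, of "\<chi> a b. vs ! card {c::'r. c < b} $ s a"] by simp
  then show ?thesis by (simp add: alternating_def wedge_def)
qed

text \<open>The highest weight vector is alternating in its last \<open>r\<close> slots, and this is preserved by the group and
  by linear combinations.\<close>

lemma cartan_product_slices:
  fixes t :: "real^(('k::finite \<Rightarrow> 'n::{finite,linorder} option) \<times> ('r::{finite,linorder} \<Rightarrow> 'n option))"
  assumes "t \<in> cartan_product" shows "(\<chi> s. t $ (k, s)) \<in> alternating"
  using assms unfolding cartan_product_def
proof (induction arbitrary: k rule: span_induct_alt)
  case base then show ?case by (simp add: alternating_def)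
next
  case (step c x y)
  then obtain g where x: "x = mixed_act g highest_weight_vector" by blast
  have hw: "(\<chi> s. (highest_weight_vector :: real^(('k \<Rightarrow> 'n option) \<times> ('r \<Rightarrow> 'n option))) $ (k', s)) \<in> alternating" for k'
  proof -
    let ?w = "wedge (take CARD('r) (map (\<lambda>a. axis a 1) (None # map Some (sorted_list_of_set UNIV)))) :: real^('r \<Rightarrow> 'n option)"
    have "?w $ (s \<circ> p) = of_int (sign p) * ?w $ s" if "p permutes UNIV" for p s
      using alternating_wedge that unfolding alternating_def by blast
    then show ?thesis
      unfolding alternating_def highest_weight_vector_def by (simp only: mem_Collect_eq vec_lambda_beta fst_conv snd_conv mult.left_commute) simp
  qed
  have sub: "subspace (alternating :: (real^('r \<Rightarrow> 'n option)) set)"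
    by (auto simp: subspace_def alternating_def algebra_simps)
  have "(\<chi> s. x $ (k, s)) = (\<Sum>k'\<in>UNIV. tensor_kernel (dual_mat g) k k' *\<^sub>R
      tensor_act g (\<chi> s'. highest_weight_vector $ (k', s')))"
    by (simp add: x vec_eq_iff mixed_act_slices)
  also have "\<dots> \<in> alternating"
    by (intro subspace_sum[OF sub] subspace_scale[OF sub] alternating_tensor_act hw)
  finally have "c *\<^sub>R (\<chi> s. x $ (k, s)) + (\<chi> s. y $ (k, s)) \<in> alternating"
    by (intro subspace_add[OF sub] subspace_scale[OF sub] step)
  moreover have "(\<chi> s. (c *\<^sub>R x + y) $ (k, s)) = c *\<^sub>R (\<chi> s. x $ (k, s)) + (\<chi> s. y $ (k, s))"
    by (simp add: vec_eq_iff)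
  ultimately show ?case by simp
qed

lemma cartan_product_act:
  assumes "g \<in> SL" "t \<in> cartan_product" shows "mixed_act g t \<in> cartan_product"
  using assms(2) unfolding cartan_product_def
proof (induction rule: span_induct_alt)
  case base then show ?case by (simp add: linear_0[OF linear_mixed_act] span_zero)
next
  case (step c x y)
  then obtain h where "h \<in> SL" "x = mixed_act h highest_weight_vector" by blast
  then have "mixed_act g x = mixed_act (g ** h) highest_weight_vector" "g ** h \<in> SL"
    using assms(1) by (simp_all add: mixed_act_mult SL_mult)
  then have "mixed_act g x \<in> span ((\<lambda>g. mixed_act g highest_weight_vector) ` SL)"
    by (metis (no_types, lifting) imageI span_base)
  then show ?case unfolding linear_add[OF linear_mixed_act] linear_cmul[OF linear_mixed_act]
    by (intro span_add span_scale step)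
qed

lemma bgg_module_mixed: "bgg_module (mixed_bgg :: ('n::{finite,linorder},
    real^(('k::finite \<Rightarrow> 'n option) \<times> ('r::{finite,linorder} \<Rightarrow> 'n option)), _) bgg_data)
    (\<lambda>t. \<chi> s. t $ ((\<lambda>_. None), Some \<circ> s))"
proof (rule bgg_module.intro)
  show "linear (\<lambda>t :: real^(('k \<Rightarrow> 'n option) \<times> ('r \<Rightarrow> 'n option)). (\<chi> s. t $ ((\<lambda>_. None), Some \<circ> s)) :: real^('r \<Rightarrow> 'n))"
    by (rule linearI) (simp_all add: vec_eq_iff)
  show "(\<chi> s. bgg_act mixed_bgg g v $ ((\<lambda>_. None), Some \<circ> s)) = h0_act (mixed_bgg :: ('n, real^(('k \<Rightarrow> 'n option) \<times> ('r \<Rightarrow> 'n option)), real^('r \<Rightarrow> 'n)) bgg_data) g (\<chi> s. v $ ((\<lambda>_. None), Some \<circ> s))"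
    if "g \<in> Pgrp" for g and v :: "real^(('k \<Rightarrow> 'n option) \<times> ('r \<Rightarrow> 'n option))"
  proof -
    have "(\<chi> s. tensor_act g (\<chi> s'. v $ ((\<lambda>_. None), s')) $ (Some \<circ> s))
       = tensor_act (mat_block g) (\<chi> s. v $ ((\<lambda>_. None), Some \<circ> s))"
      using tensor_act_top[OF Pgrp_top[OF that], of "\<chi> s'. v $ ((\<lambda>_. None), s')"] by simp
    then show ?thesis
      by (simp add: mixed_bgg_def mixed_act_slices tensor_kernel_dual_Pgrp[OF that] if_distrib if_distribR
        vec_eq_iff cong: if_cong)
  qed
  show "h0_act (mixed_bgg :: ('n, real^(('k \<Rightarrow> 'n option) \<times> ('r \<Rightarrow> 'n option)), real^('r \<Rightarrow> 'n)) bgg_data) (mat 1 + t *\<^sub>R sl_mat (gp Z)) w = w" for t and Z :: "real^'n::_" and w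
    unfolding mixed_bgg_def by (simp add: density_act_def gp_00 mat_block_gp tensor_act_one del: vector_add_component)
  show "(\<chi> s. v $ ((\<lambda>_. None), Some \<circ> s)) \<in> h0_space (mixed_bgg :: ('n, real^(('k \<Rightarrow> 'n option) \<times> ('r \<Rightarrow> 'n option)), real^('r \<Rightarrow> 'n)) bgg_data)"
    if "v \<in> bgg_space mixed_bgg" for v :: "real^(('k \<Rightarrow> 'n option) \<times> ('r \<Rightarrow> 'n option))"
    using cartan_product_slices[of v "\<lambda>_. None"] that
    by (simp add: mixed_bgg_def alternating_def comp_assoc[symmetric])
qed (simp_all add: mixed_bgg_def linear_mixed_act smooth_on_mixed_act mixed_act_mult
    mixed_act_one cartan_product_act, simp add: cartan_product_def span_zero)

section \<open>Wedge products and normal frames of exterior powers\<close>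

text \<open>Zero-based rank, which is the list index of the vector that \<open>wedge\<close> puts into a slot.\<close>

definition position :: "'r::{finite,linorder} \<Rightarrow> nat" where
  "position b = card {c. c < b}"

lemma position_bij: "bij_betw (position :: 'r::{finite,linorder} \<Rightarrow> nat) UNIV {..<CARD('r)}"
proof -
  have mono: "position b < position b'" if "b < b'" for b b' :: 'r
    unfolding position_def using that by (intro psubset_card_mono) auto
  have inj: "inj (position :: 'r \<Rightarrow> nat)"
    by (rule injI) (metis mono less_irrefl linorder_neqE)
  have "position b < CARD('r)" for b :: 'r
    unfolding position_def by (intro psubset_card_mono) auto
  then have "range (position :: 'r \<Rightarrow> nat) \<subseteq> {..<CARD('r)}" by auto
  moreover have "card (range (position :: 'r \<Rightarrow> nat)) = card {..<CARD('r)}"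
    using inj by (simp add: card_image)
  ultimately have "range (position :: 'r \<Rightarrow> nat) = {..<CARD('r)}" by (intro card_subset_eq) auto
  with inj show ?thesis by (simp add: bij_betw_def)
qed

lemma position_less: "position (b :: 'r::{finite,linorder}) < CARD('r)"
  using bij_betwE[OF position_bij] by blast

lemma wedge_position: "wedge vs $ s = det (\<chi> a b. vs ! position b $ s a)"
  by (simp add: wedge_def position_def)

text \<open>Expand each entry of \<open>g v\<close> in the Leibniz formula and distribute the product over the sums.\<close>

lemma tensor_act_wedge:
  assumes "length vs = CARD('r::{finite,linorder})"
  shows "tensor_act g (wedge vs :: real^('r \<Rightarrow> 'i::finite)) = wedge (map ((*v) g) vs)"
proof -
  have "tensor_act g (wedge vs :: real^('r \<Rightarrow> 'i)) $ s = wedge (map ((*v) g) vs) $ s" for s :: "'r \<Rightarrow> 'i"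
  proof -
    let ?v = "\<lambda>b. vs ! position b" and ?P = "{p :: 'r \<Rightarrow> 'r. p permutes UNIV}"
    have "wedge (map ((*v) g) vs) $ s
        = (\<Sum>p\<in>?P. of_int (sign p) * (\<Prod>a\<in>UNIV. \<Sum>i\<in>UNIV. g $ s a $ i * ?v (p a) $ i))"
      using position_less[where 'r='r] assms by (simp add: wedge_position det_def matrix_vector_mult_def)
    also have "\<dots> = (\<Sum>f\<in>UNIV. \<Sum>p\<in>?P. of_int (sign p) * (\<Prod>a\<in>UNIV. g $ s a $ f a * ?v (p a) $ f a))"
      unfolding prod_sum_funs sum_distrib_left by (rule sum.swap)
    also have "\<dots> = (\<Sum>f\<in>UNIV. tensor_kernel g s f * wedge vs $ f)"
      by (simp add: wedge_position det_def tensor_kernel_def prod.distrib sum_distrib_left mult_ac)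
    finally show ?thesis by (simp add: tensor_act_kernel)
  qed
  then show ?thesis by (simp add: vec_eq_iff)
qed

lemma wedge_top:
  assumes "length vs = CARD('r::{finite,linorder})"
  shows "(\<chi> s. (wedge vs :: real^('r \<Rightarrow> 'n::finite option)) $ (Some \<circ> s)) = wedge (map (\<lambda>y. \<chi> i. y $ Some i) vs)"
  using position_less[where 'r='r] assms by (simp add: vec_eq_iff wedge_position)

text \<open>Multilinearity of the determinant in the column that belongs to the least slot.\<close>

lemma wedge_head_sum:
  assumes "Suc (length vs) = CARD('r::{finite,linorder})"
  shows "(wedge ((\<Sum>j\<in>UNIV. c j *\<^sub>R v j) # vs) :: real^('r \<Rightarrow> 'i::finite))
     = (\<Sum>j\<in>(UNIV :: 'j::finite set). c j *\<^sub>R wedge (v j # vs))"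
proof -
  have "0 \<in> position ` (UNIV :: 'r set)" using position_bij[where 'r='r] assms by (auto simp: bij_betw_def)
  then obtain b0 :: 'r where b0: "position b0 = 0" by auto
  have b0': "position b = 0 \<longleftrightarrow> b = b0" for b
    using b0 position_bij[where 'r='r] by (metis UNIV_I bij_betw_inv_into_left)
  have head: "wedge (w # vs) $ s = det (\<chi> b. if b = b0 then (\<chi> a. w $ s a) else (\<chi> a. vs ! (position b - 1) $ s a))"
    for w and s :: "'r \<Rightarrow> 'i"
  proof -
    have "(\<chi> b. if b = b0 then (\<chi> a. w $ s a) else (\<chi> a. vs ! (position b - 1) $ s a))
        = transpose (\<chi> a b. (w # vs) ! position b $ s a)"
      by (simp add: vec_eq_iff transpose_def nth_Cons' b0')
    then show ?thesis by (simp only: wedge_position det_transpose)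
  qed
  have "wedge ((\<Sum>j\<in>UNIV. c j *\<^sub>R v j) # vs) $ s = (\<Sum>j\<in>UNIV. c j * wedge (v j # vs) $ s)" for s :: "'r \<Rightarrow> 'i"
  proof -
    let ?r = "\<lambda>b. \<chi> a. vs ! (position b - 1) $ s a"
    have e: "(\<chi> a. (\<Sum>j\<in>UNIV. c j *\<^sub>R v j) $ s a) = (\<Sum>j\<in>UNIV. c j *s (\<chi> a. v j $ s a) :: (real, 'r) vec)"
      by (simp add: vec_eq_iff)
    have "wedge ((\<Sum>j\<in>UNIV. c j *\<^sub>R v j) # vs) $ s
        = det (\<chi> b. if b = b0 then (\<Sum>j\<in>UNIV. c j *s (\<chi> a. v j $ s a)) else ?r b)"
      unfolding head e ..
    also have "\<dots> = (\<Sum>j\<in>UNIV. det (\<chi> b. if b = b0 then c j *s (\<chi> a. v j $ s a) else ?r b))"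
      by (rule det_linear_row_sum[where a = "\<lambda>_ j. c j *s (\<chi> a. v j $ s a)"]) simp
    also have "\<dots> = (\<Sum>j\<in>UNIV. c j * wedge (v j # vs) $ s)"
      unfolding head det_row_mul ..
    finally show ?thesis .
  qed
  then show ?thesis by (simp add: vec_eq_iff)
qed

text \<open>Exchanging the two slots changes the sign but not the index tuple.\<close>

lemma alternating_eq_zero:
  assumes "v \<in> alternating" "a \<noteq> b" "s a = s b" shows "v $ s = 0"
proof -
  have "v $ (s \<circ> Transposition.transpose a b) = of_int (sign (Transposition.transpose a b)) * v $ s"
    using assms(1) permutes_swap_id[of a UNIV b] unfolding alternating_def by blast
  moreover have "s \<circ> Transposition.transpose a b = s"
    using assms(3) by (auto simp: fun_eq_iff Transposition.transpose_def)
  ultimately show ?thesis using assms(2) by (simp add: sign_swap_id)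
qed

lemma subspace_alternating: "subspace alternating"
  by (auto simp: subspace_def alternating_def algebra_simps)

text \<open>An enumeration of each subset of the index set, so that \<open>\<Lambda>\<^sup>r\<close> has a basis indexed by subsets. It is
  kept abstract because the index type \<open>'n option\<close> carries no order.\<close>

locale set_enumeration =
  fixes L :: "'i::finite set \<Rightarrow> 'i list"
  assumes L: "set (L K) = K" "distinct (L K)"
begin

lemma length_L: "length (L K) = card K"
  using L distinct_card by metis

text \<open>If the subsets differ, some index of \<open>K'\<close> is missing in \<open>K\<close>, and the matrix has a zero row.\<close>

lemma basis_wedge:
  assumes "card K = CARD('r::{finite,linorder})" "card K' = CARD('r)"
  shows "(wedge (map (\<lambda>i. axis i 1) (L K)) :: real^('r \<Rightarrow> 'i)) $ (\<lambda>a. L K' ! position a) = (if K = K' then 1 else 0)"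
proof -
  have "wedge (map (\<lambda>i. axis i 1) (L K)) $ (\<lambda>a::'r. L K' ! position a)
      = det (\<chi> a b. if L K' ! position a = L K ! position b then 1 else 0 :: ((real, 'r) vec, 'r) vec)"
    using position_less[where 'r='r] by (simp add: wedge_position length_L assms axis_component)
  also have "\<dots> = (if K = K' then 1 else 0)"
  proof (cases "K = K'")
    case True
    have "L K ! position a = L K ! position b \<longleftrightarrow> a = b" for a b :: 'r
    proof -
      have "L K ! position a = L K ! position b \<longleftrightarrow> position a = position b"
        using nth_eq_iff_index_eq[OF L(2)[of K]] position_less[of a] position_less[of b] by (simp add: length_L assms)
      then show ?thesis using bij_betw_imp_inj_on[OF position_bij] by (auto dest: injD)
    qed
    then have "(\<chi> a b. if L K ! position a = L K ! position b then 1 else 0 :: ((real, 'r) vec, 'r) vec) = mat 1"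
      by (simp add: mat_def)
    then show ?thesis using True by simp
  next
    case False
    have "\<not> K' \<subseteq> K" using False assms card_subset_eq[of K K'] by (metis finite)
    then obtain i where i: "i \<in> K'" "i \<notin> K" by blast
    then obtain n where n: "n < length (L K')" "L K' ! n = i" using L(1) by (metis in_set_conv_nth)
    then have "n \<in> position ` (UNIV :: 'r set)" using position_bij[where 'r='r] by (simp add: length_L assms bij_betw_def)
    then obtain a :: 'r where a: "n = position a" by blast
    have "L K ! position b \<noteq> i" for b :: 'r
      using i(2) L(1) position_less[of b] by (metis length_L assms(1) nth_mem)
    then have "row a (\<chi> a b. if L K' ! position a = L K ! position b then 1 else 0 :: ((real, 'r) vec, 'r) vec) = 0"
      using n a by (simp add: row_def vec_eq_iff) metis
    then show ?thesis using False det_zero_row(1) by metis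
  qed
  finally show ?thesis .
qed

text \<open>The difference of the two sides is alternating and vanishes on the chosen enumerations. It vanishes on
  tuples with a repeated index by alternation, and every other tuple is a permutation of an
  enumeration.\<close>

lemma alternating_expansion:
  fixes v :: "real^('r::{finite,linorder} \<Rightarrow> 'i)"
  assumes v: "v \<in> alternating"
  shows "v = (\<Sum>K | card K = CARD('r). v $ (\<lambda>a. L K ! position a) *\<^sub>R wedge (map (\<lambda>i. axis i 1) (L K)))"
    (is "v = ?w")
proof -
  have w: "?w \<in> alternating"
    by (intro subspace_sum[OF subspace_alternating] subspace_scale[OF subspace_alternating] alternating_wedge)
  have vw: "v - ?w \<in> alternating" by (rule subspace_diff[OF subspace_alternating v w])
  have e: "?w $ (\<lambda>a. L K ! position a) = v $ (\<lambda>a. L K ! position a)" if K: "card K = CARD('r)" for K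
  proof -
    have "?w $ (\<lambda>a. L K ! position a) = (\<Sum>K' | card K' = CARD('r). v $ (\<lambda>a. L K' ! position a) *
        (wedge (map (\<lambda>i. axis i 1) (L K')) :: real^('r \<Rightarrow> 'i)) $ (\<lambda>a. L K ! position a))"
      by simp
    also have "\<dots> = (\<Sum>K' | card K' = CARD('r). if K' = K then v $ (\<lambda>a. L K' ! position a) else 0)"
      by (rule sum.cong) (simp_all add: basis_wedge K)
    also have "\<dots> = v $ (\<lambda>a. L K ! position a)" using K by simp
    finally show ?thesis .
  qed
  have "(v - ?w) $ s = 0" for s
  proof (cases "inj s")
    case False
    then obtain a b where "a \<noteq> b" "s a = s b" by (auto simp: inj_def)
    then show ?thesis by (rule alternating_eq_zero[OF vw])
  next
    case True
    let ?K = "range s" let ?en = "\<lambda>a::'r. L ?K ! position a"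
    have K: "card ?K = CARD('r)" using True by (simp add: card_image)
    have "bij_betw ?en UNIV ?K"
    proof -
      have "bij_betw ((!) (L ?K)) {..<CARD('r)} ?K"
        using bij_betw_nth[OF L(2)[of ?K] refl] L(1) by (simp add: length_L K lessThan_atLeast0)
      from bij_betw_trans[OF position_bij this] show ?thesis by (simp add: comp_def)
    qed
    moreover have "bij_betw s UNIV ?K" using True by (simp add: bij_betw_def)
    ultimately have p: "bij_betw (inv_into UNIV ?en \<circ> s) UNIV UNIV"
      using bij_betw_trans bij_betw_inv_into by blast
    have "?en \<circ> (inv_into UNIV ?en \<circ> s) = s"
      using \<open>bij_betw ?en UNIV ?K\<close> by (auto simp: fun_eq_iff bij_betw_def intro!: f_inv_into_f)
    moreover have "(inv_into UNIV ?en \<circ> s) permutes UNIV" by (rule bij_imp_permutes[OF p]) simp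
    ultimately have "(v - ?w) $ s = of_int (sign (inv_into UNIV ?en \<circ> s)) * (v - ?w) $ ?en"
      using vw unfolding alternating_def by (metis (mono_tags, lifting) mem_Collect_eq)
    also have "(v - ?w) $ ?en = 0" using e[OF K] by simp
    finally show ?thesis by simp
  qed
  then have "v - ?w = 0" unfolding vec_eq_iff zero_index by (rule allI)
  then show ?thesis by (simp only: right_minus_eq)
qed

end

definition option_list :: "'n::{finite,linorder} option set \<Rightarrow> 'n option list" where
  "option_list K = (if None \<in> K then [None] else []) @ map Some (sorted_list_of_set {i. Some i \<in> K})"

interpretation option_enum: set_enumeration option_list
proof
  show "set (option_list K) = K" for K :: "'n::{finite,linorder} option set"
  proof (rule set_eqI)
    show "x \<in> set (option_list K) \<longleftrightarrow> x \<in> K" for x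
      by (cases x) (auto simp: option_list_def)
  qed
  show "distinct (option_list K)" for K :: "'n::{finite,linorder} option set"
    by (auto simp: option_list_def distinct_map)
qed

lemma option_list_Some: "option_list (Some ` I) = map Some (sorted_list_of_set I)"
proof -
  have "{i. Some i \<in> Some ` I} = I" by auto
  then show ?thesis by (auto simp: option_list_def)
qed

lemma option_list_None: "option_list (insert None (Some ` J)) = None # map Some (sorted_list_of_set J)"
proof -
  have "{i. Some i \<in> insert None (Some ` J)} = J" by auto
  then show ?thesis by (simp add: option_list_def)
qed

text \<open>The subsets of \<open>{0, \<dots>, n}\<close> with \<open>r\<close> elements are the \<open>I\<close> and the \<open>{0} \<union> J\<close> of the theorem.\<close>

lemma sum_option_subsets:
  fixes f :: "'n::finite option set \<Rightarrow> 'b::comm_monoid_add"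
  shows "(\<Sum>K | card K = CARD('r::finite). f K)
    = (\<Sum>I\<in>idx TYPE('r). f (Some ` I)) + (\<Sum>J\<in>idx' TYPE('r). f (insert None (Some ` J)))"
proof -
  have c1: "card (Some ` I) = card I" for I :: "'n set" by (simp add: card_image)
  have c2: "card (insert None (Some ` J)) = Suc (card J)" for J :: "'n set"
    by (subst card_insert_disjoint) (auto simp: card_image)
  have dec: "K = Some ` {i. Some i \<in> K}" if "None \<notin> K" for K :: "'n option set"
  proof (rule set_eqI)
    show "x \<in> K \<longleftrightarrow> x \<in> Some ` {i. Some i \<in> K}" for x using that by (cases x) auto
  qed
  have dec': "K = insert None (Some ` {i. Some i \<in> K})" if "None \<in> K" for K :: "'n option set"
  proof (rule set_eqI)
    show "x \<in> K \<longleftrightarrow> x \<in> insert None (Some ` {i. Some i \<in> K})" for x using that by (cases x) auto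
  qed
  have split: "{K :: 'n option set. card K = CARD('r)} = ((`) Some) ` idx TYPE('r) \<union> (\<lambda>J. insert None (Some ` J)) ` idx' TYPE('r)"
  proof (intro equalityI subsetI)
    fix K :: "'n option set" assume K: "K \<in> {K. card K = CARD('r)}"
    show "K \<in> ((`) Some) ` idx TYPE('r) \<union> (\<lambda>J. insert None (Some ` J)) ` idx' TYPE('r)"
    proof (cases "None \<in> K")
      case True
      have "card K = Suc (card {i. Some i \<in> K})" using arg_cong[OF dec'[OF True], of card] unfolding c2 .
      then have "{i. Some i \<in> K} \<in> idx' TYPE('r)" using K by (simp add: idx'_def)
      then show ?thesis using dec'[OF True] by blast
    next
      case False
      have "card K = card {i. Some i \<in> K}" using arg_cong[OF dec[OF False], of card] unfolding c1 .
      then have "{i. Some i \<in> K} \<in> idx TYPE('r)" using K by (simp add: idx_def)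
      then show ?thesis using dec[OF False] by blast
    qed
  qed (auto simp: idx_def idx'_def c1 c2)
  have "(\<Sum>K | card K = CARD('r). f K) = (\<Sum>K\<in>((`) Some) ` idx TYPE('r). f K)
      + (\<Sum>K\<in>(\<lambda>J. insert None (Some ` J)) ` idx' TYPE('r). f K)"
    unfolding split by (rule sum.union_disjoint) auto
  also have "\<dots> = (\<Sum>I\<in>idx TYPE('r). f (Some ` I)) + (\<Sum>J\<in>idx' TYPE('r). f (insert None (Some ` J)))"
  proof -
    have "inj_on ((`) Some) A" for A :: "'n set set" by (auto intro!: inj_onI simp: inj_image_eq_iff)
    moreover have "inj_on (\<lambda>J. insert None (Some ` J)) A" for A :: "'n set set"
    proof (rule inj_onI)
      fix I J :: "'n set" assume "insert None (Some ` I) = insert None (Some ` J)"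
      then have "Some ` I = Some ` J" by (auto simp: set_eq_iff)
      then show "I = J" by (simp add: inj_image_eq_iff)
    qed
    ultimately show ?thesis by (simp add: sum.reindex)
  qed
  finally show ?thesis .
qed

text \<open>The element of \<open>\<Lambda>\<^sup>r \<real>\<^sup>n\<^sup>+\<^sup>1\<close> that gives rise to the linear combination with coefficients \<open>c\<close> and \<open>d\<close>.
  The sign comes from \<open>exp(-X) e\<^sub>0 = e\<^sub>0 - X\<close>.\<close>

definition comb_tensor :: "('n::{finite,linorder} set \<Rightarrow> real) \<Rightarrow> ('n set \<Rightarrow> real) \<Rightarrow>
    real^('r::{finite,linorder} \<Rightarrow> 'n option)" where
  "comb_tensor c d =
     (\<Sum>I\<in>idx TYPE('r). c I *\<^sub>R wedge (map (\<lambda>a. axis a 1) (option_list (Some ` I))))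
   - (\<Sum>J\<in>idx' TYPE('r). d J *\<^sub>R wedge (map (\<lambda>a. axis a 1) (option_list (insert None (Some ` J)))))"

lemma comb_tensor_sum: "(comb_tensor c d :: real^('r::{finite,linorder} \<Rightarrow> 'n::{finite,linorder} option))
   = (\<Sum>K | card K = CARD('r). (if None \<in> K then - d {i. Some i \<in> K} else c {i. Some i \<in> K})
        *\<^sub>R wedge (map (\<lambda>a. axis a 1) (option_list K)))"
proof -
  have "{i. Some i \<in> Some ` I} = I" for I :: "'n set" by auto
  then show ?thesis unfolding comb_tensor_def sum_option_subsets
    by (simp add: image_iff sum_negf)
qed

lemma comb_tensor_alternating: "comb_tensor c d \<in> alternating"
  unfolding comb_tensor_sum
  by (intro subspace_sum[OF subspace_alternating] subspace_scale[OF subspace_alternating] alternating_wedge)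

lemma alternating_comb_tensor:
  fixes v :: "real^('r::{finite,linorder} \<Rightarrow> 'n::{finite,linorder} option)"
  assumes "v \<in> alternating"
  shows "v = comb_tensor (\<lambda>I. v $ (\<lambda>a. option_list (Some ` I) ! position a))
     (\<lambda>J. - v $ (\<lambda>a. option_list (insert None (Some ` J)) ! position a))"
  using option_enum.alternating_expansion[OF assms]
  unfolding comb_tensor_def sum_option_subsets by (simp add: sum_negf)

lemma comb_tensor_component:
  assumes "card K = CARD('r::{finite,linorder})"
  shows "(comb_tensor c d :: real^('r \<Rightarrow> 'n::{finite,linorder} option)) $ (\<lambda>a. option_list K ! position a)
    = (if None \<in> K then - d {i. Some i \<in> K} else c {i. Some i \<in> K})" (is "_ = ?f K")
proof -
  have "(comb_tensor c d :: real^('r \<Rightarrow> 'n option)) $ (\<lambda>a. option_list K ! position a)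
     = (\<Sum>K' | card K' = CARD('r). ?f K' * (wedge (map (\<lambda>a. axis a 1) (option_list K')) :: real^('r \<Rightarrow> 'n option)) $ (\<lambda>a. option_list K ! position a))"
    unfolding comb_tensor_sum by simp
  also have "\<dots> = (\<Sum>K' | card K' = CARD('r). if K' = K then ?f K' else 0)"
    by (rule sum.cong) (simp_all add: option_enum.basis_wedge assms)
  also have "\<dots> = ?f K" using assms by simp
  finally show ?thesis .
qed

lemma comb_tensor_eq_zero:
  fixes c d :: "'n::{finite,linorder} set \<Rightarrow> real"
  assumes "(comb_tensor c d :: real^('r::{finite,linorder} \<Rightarrow> 'n option)) = 0"
  shows "I \<in> idx TYPE('r) \<Longrightarrow> c I = 0" "J \<in> idx' TYPE('r) \<Longrightarrow> d J = 0"
proof -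
  assume I: "I \<in> idx TYPE('r)"
  have "card (Some ` I) = CARD('r)" using I by (simp add: idx_def card_image)
  from comb_tensor_component[OF this, of c d] show "c I = 0"
    unfolding assms by (simp add: image_iff)
next
  assume J: "J \<in> idx' TYPE('r)"
  have "card (insert None (Some ` J)) = CARD('r)"
    using J by (subst card_insert_disjoint) (auto simp: idx'_def card_image)
  from comb_tensor_component[OF this, of c d] show "d J = 0"
    unfolding assms by (simp add: image_iff)
qed

text \<open>Modulo \<open>e\<^sub>0\<close>, the matrix \<open>(exp(X) g)\<^sup>-\<^sup>1 = g\<^sup>-\<^sup>1 exp(-X)\<close> sends \<open>e\<^sub>i\<close> to the value of \<open>\<xi>\<^sub>i\<close> and \<open>e\<^sub>0\<close>
  to \<open>- \<Sum>\<^sub>j x\<^sub>j \<xi>\<^sub>j\<close>, and wedge products of vectors are mapped factor by factor.\<close>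

lemma wedge_comb_comb_tensor:
  assumes nd: "normal_data C B \<Phi> u X g"
  shows "(wedge_comb C B \<Phi> c d u :: real^('r::{finite,linorder} \<Rightarrow> 'n::{finite,linorder}))
    = (\<chi> s. tensor_act (matrix_inv (flat_lift X ** g)) (comb_tensor (\<lambda>I. c I u) (\<lambda>J. d J u)) $ (Some \<circ> s))"
proof -
  note N = normal_dataD[OF nd]
  let ?m = "matrix_inv (flat_lift X ** g)"
  let ?T = "\<lambda>t :: real^('r \<Rightarrow> 'n option). \<chi> s. tensor_act ?m t $ (Some \<circ> s) :: (real, 'r \<Rightarrow> 'n) vec"
  let ?f = "\<lambda>i. mat_block (matrix_inv g) *v axis i 1"
  let ?p = "\<lambda>y :: (real, 'n option) vec. \<chi> i. y $ Some i :: (real, 'n) vec"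
  have lin: "linear ?T"
    by (rule linearI) (simp_all add: vec_eq_iff linear_add[OF linear_tensor_act] linear_cmul[OF linear_tensor_act])
  have m: "?m = matrix_inv g ** flat_lift (- X)"
    using SL_det[OF Pgrp_SL[OF N(2)]] by (simp add: matrix_inv_mult matrix_inv_flat_lift)
  have p1: "?p (?m *v axis (Some i) 1) = ?f i" for i
  proof -
    have "flat_lift (- X) *v axis (Some i) 1 = axis (Some i) 1"
      by (simp add: vec_eq_iff mult_axis flat_lift_component axis_component split: option.split)
    then have "?m *v axis (Some i) 1 = matrix_inv g *v axis (Some i) 1"
      by (simp add: m matrix_vector_mul_assoc[symmetric])
    then show ?thesis by (simp add: vec_eq_iff mult_axis mat_block_def)
  qed
  have p2: "?p (?m *v axis None 1) = (\<Sum>j\<in>UNIV. (- X $ j) *\<^sub>R ?f j)"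
    using Pgrp_top[OF Pgrp_inv[OF N(2)]] unfolding m
    by (simp add: vec_eq_iff mult_axis mat_block_def matrix_matrix_mult_def UNIV_option_conv sum.reindex
        flat_lift_component mult.commute)
  have w: "?T (wedge vs) = wedge (map (\<lambda>v. ?p (?m *v v)) vs)" if "length vs = CARD('r)" for vs
    using wedge_top[of "map ((*v) ?m) vs", where 'r='r] that by (simp add: tensor_act_wedge comp_def)
  have neg: "(wedge (- (\<Sum>j\<in>UNIV. X $ j *\<^sub>R ?f j) # vs) :: (real, 'r \<Rightarrow> 'n) vec)
      = - (\<Sum>j\<in>UNIV. X $ j *\<^sub>R wedge (?f j # vs))" if "Suc (length vs) = CARD('r)" for vs
    using wedge_head_sum[of vs "\<lambda>j. - X $ j" ?f, where 'r='r] that by (simp add: sum_negf)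
  have F: "frame_wedge C B \<Phi> I u = ?T (wedge (map (\<lambda>a. axis a 1) (option_list (Some ` I))))"
    if "I \<in> idx TYPE('r)" for I
    using that by (subst w)
      (simp_all add: option_list_Some idx_def comp_def p1 frame_wedge_def normal_data_nframe_TM[OF nd])
  have E: "euler_wedge C B \<Phi> J u = - ?T (wedge (map (\<lambda>a. axis a 1) (option_list (insert None (Some ` J)))))"
    if "J \<in> idx' TYPE('r)" for J
    using that by (subst w)
      (simp_all add: option_list_None idx'_def comp_def p1 p2 euler_wedge_def normal_data_nframe_TM[OF nd]
        neg N(4) sum_negf)
  have "?T (comb_tensor (\<lambda>I. c I u) (\<lambda>J. d J u))
     = (\<Sum>I\<in>idx TYPE('r). c I u *\<^sub>R frame_wedge C B \<Phi> I u) + (\<Sum>J\<in>idx' TYPE('r). d J u *\<^sub>R euler_wedge C B \<Phi> J u)"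
    unfolding comb_tensor_def linear_diff[OF lin] linear_sum[OF lin] linear_cmul[OF lin]
    by (simp add: F E sum_negf)
  then show ?thesis by (simp add: wedge_comb_def)
qed

section \<open>The first BGG equation on exterior powers over the homogeneous model\<close>

text \<open>If \<open>v = \<sigma> + e\<^sub>0 \<and> \<rho>\<close> with \<open>\<sigma>\<close> and \<open>\<rho>\<close> in the exterior algebra of \<open>\<real>\<^sup>n\<close>, this is \<open>X \<and> \<rho>\<close>. Working
  with \<open>v\<close> instead of \<open>\<rho>\<close> avoids a type with \<open>r - 1\<close> elements.\<close>

definition e0_part :: "real^'n \<Rightarrow> real^('r::finite \<Rightarrow> 'n::finite option) \<Rightarrow> real^('r \<Rightarrow> 'n)" where
  "e0_part X v = (\<chi> s. \<Sum>a\<in>UNIV. X $ s a * v $ ((Some \<circ> s)(a := None)))"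

lemma linear_e0_part: "linear (e0_part X)"
  by (rule linearI) (simp_all add: e0_part_def vec_eq_iff distrib_left sum.distrib sum_distrib_left mult_ac)

lemma e0_part_scaleR: "e0_part (t *\<^sub>R X) v = t *\<^sub>R e0_part X v"
  by (simp add: e0_part_def vec_eq_iff sum_distrib_left mult_ac)

lemma e0_part_add: "e0_part (X + Y) v = e0_part X v + e0_part Y v"
  by (simp add: e0_part_def vec_eq_iff distrib_right sum.distrib)

text \<open>In the expansion of \<open>exp(X) \<cdot> v\<close>, the slots in which \<open>v\<close> is evaluated at \<open>e\<^sub>0\<close> receive \<open>X\<close>. Terms with
  two such slots vanish because \<open>v\<close> is alternating.\<close>

lemma tensor_act_flat_lift_top:
  fixes v :: "real^('r::finite \<Rightarrow> 'n::finite option)"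
  assumes v: "v \<in> alternating"
  shows "(\<chi> s. tensor_act (flat_lift X) v $ (Some \<circ> s)) = (\<chi> s. v $ (Some \<circ> s)) + e0_part X v"
proof -
  have "tensor_act (flat_lift X) v $ (Some \<circ> s) = v $ (Some \<circ> s) + (\<Sum>a\<in>UNIV. X $ s a * v $ ((Some \<circ> s)(a := None)))"
    for s :: "'r \<Rightarrow> 'n"
  proof -
    let ?u = "\<lambda>a. (Some \<circ> s)(a := None)"
    let ?t = "\<lambda>s'. tensor_kernel (flat_lift X) (Some \<circ> s) s' * v $ s'"
    \<comment> \<open>The index tuples that contribute are \<open>s\<close> itself and \<open>s\<close> with one slot replaced by 0.\<close>
    have inj: "inj ?u"
    proof (rule injI)
      fix a b assume "?u a = ?u b"
      then have "?u a a = ?u b a" by simp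
      then show "a = b" by (simp split: if_splits)
    qed
    have ni: "Some \<circ> s \<notin> range ?u"
    proof
      assume "Some \<circ> s \<in> range ?u"
      then obtain a where "Some \<circ> s = ?u a" by blast
      then have "(Some \<circ> s) a = ?u a a" by simp
      then show False by simp
    qed
    have zero: "?t s' = 0" if s': "s' \<notin> insert (Some \<circ> s) (range ?u)" for s'
    proof (cases "\<exists>a. s' a \<noteq> None \<and> s' a \<noteq> Some (s a)")
      case True
      then obtain a where "s' a \<noteq> None" "s' a \<noteq> Some (s a)" by blast
      then have "\<exists>a\<in>UNIV. flat_lift X $ (Some \<circ> s) a $ s' a = 0"
        by (intro bexI[of _ a]) (auto simp: flat_lift_component split: option.split)
      then show ?thesis unfolding tensor_kernel_def by (simp add: prod_zero_iff)
    next
      case False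
      then have s'': "s' a = None \<or> s' a = Some (s a)" for a by blast
      have "\<exists>a. s' a = None"
      proof (rule ccontr)
        assume "\<nexists>a. s' a = None"
        then have "s' b = Some (s b)" for b using s''[of b] by blast
        then have "s' = Some \<circ> s" by (simp add: fun_eq_iff)
        then show False using s' by blast
      qed
      then obtain a where a: "s' a = None" by blast
      have "\<exists>b. b \<noteq> a \<and> s' b = None"
      proof (rule ccontr)
        assume "\<nexists>b. b \<noteq> a \<and> s' b = None"
        then have "s' b = ?u a b" for b using s''[of b] a by (cases "b = a") auto
        then have "s' = ?u a" by (rule ext)
        then show False using s' by blast
      qed
      then obtain b where "b \<noteq> a" "s' b = None" by blast
      then show ?thesis using alternating_eq_zero[OF v, of a b s'] a by simp
    qed
    have t1: "?t (Some \<circ> s) = v $ (Some \<circ> s)"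
      by (simp add: tensor_kernel_def flat_lift_component)
    have t2: "?t (?u a) = X $ s a * v $ ?u a" for a
    proof -
      have "tensor_kernel (flat_lift X) (Some \<circ> s) (?u a) = (\<Prod>b\<in>UNIV. if b = a then X $ s a else 1)"
        unfolding tensor_kernel_def by (rule prod.cong) (simp_all add: flat_lift_component)
      then show ?thesis by simp
    qed
    have "(\<Sum>s'\<in>UNIV. ?t s') = (\<Sum>s'\<in>insert (Some \<circ> s) (range ?u). ?t s')"
      by (rule sum.mono_neutral_right) (simp_all add: zero)
    also have "\<dots> = ?t (Some \<circ> s) + (\<Sum>a\<in>UNIV. ?t (?u a))"
      using ni inj by (simp add: sum.reindex)
    also have "\<dots> = v $ (Some \<circ> s) + (\<Sum>a\<in>UNIV. X $ s a * v $ ?u a)"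
      unfolding t1 t2 ..
    finally show ?thesis by (simp add: tensor_act_kernel)
  qed
  then show ?thesis by (simp add: e0_part_def vec_eq_iff)
qed

lemma proj_inf_act_ext:
  fixes v :: "real^('r::finite \<Rightarrow> 'n::finite option)"
  assumes v: "v \<in> alternating"
  shows "(\<chi> s. inf_act ext_bgg (gm X) v $ (Some \<circ> s)) = e0_part X v"
proof -
  interpret bgg_module "ext_bgg :: ('n, real^('r \<Rightarrow> 'n option), _) bgg_data" "\<lambda>t. \<chi> s. t $ (Some \<circ> s)"
    by (rule bgg_module_ext)
  have e: "(\<chi> s. bgg_act ext_bgg (flat_lift (t *\<^sub>R X)) v $ (Some \<circ> s))
      = (\<chi> s. v $ (Some \<circ> s)) + t *\<^sub>R e0_part X v" for t
    using tensor_act_flat_lift_top[OF v] by (simp add: ext_bgg_def e0_part_scaleR)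
  have "((\<lambda>t. (\<chi> s. v $ (Some \<circ> s)) + t *\<^sub>R e0_part X v) has_vector_derivative
      (\<chi> s. inf_act ext_bgg (gm X) v $ (Some \<circ> s))) (at 0)"
    using bounded_linear.has_vector_derivative[OF bounded_linear_proj inf_act_gm[of X v]] unfolding e .
  moreover have "((\<lambda>t. (\<chi> s. v $ (Some \<circ> s)) + t *\<^sub>R e0_part X v) has_vector_derivative e0_part X v) (at 0)"
    by (auto intro!: derivative_eq_intros)
  ultimately show ?thesis by (rule vector_derivative_unique_at)
qed

text \<open>The component of \<open>X \<and> w\<close> with indices \<open>j, s\<^sub>1, \<dots>, s\<^sub>r\<close>. The index \<open>j\<close> is kept apart from the tuple \<open>s\<close>
  so that no type with \<open>r + 1\<close> elements is needed.\<close>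

definition ext_mult :: "real^'n \<Rightarrow> real^('r::finite \<Rightarrow> 'n::finite) \<Rightarrow> 'n \<Rightarrow> ('r \<Rightarrow> 'n) \<Rightarrow> real" where
  "ext_mult X w j s = X $ j * w $ s - (\<Sum>a\<in>UNIV. X $ s a * w $ (s(a := j)))"

lemma ext_mult_linear:
  "ext_mult X (w + w') j s = ext_mult X w j s + ext_mult X w' j s"
  "ext_mult X (c *\<^sub>R w) j s = c * ext_mult X w j s"
  "ext_mult (X + Y) w j s = ext_mult X w j s + ext_mult Y w j s"
  "ext_mult (c *\<^sub>R X) w j s = c * ext_mult X w j s"
  by (simp_all add: ext_mult_def algebra_simps sum.distrib sum_distrib_left)

text \<open>This is \<open>X \<and> X \<and> \<rho> = 0\<close>: the terms that remove \<open>X\<close> twice are antisymmetric in the two slots, and the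
  other terms cancel.\<close>

lemma ext_mult_e0_part:
  fixes v :: "real^('r::finite \<Rightarrow> 'n::finite option)"
  assumes v: "v \<in> alternating"
  shows "ext_mult X (e0_part X v) j s = 0"
proof -
  let ?f = "\<lambda>a b. X $ s a * (X $ s b * v $ ((Some \<circ> s(a := j))(b := None)))"
  have anti: "?f a b = - ?f b a" if "a \<noteq> b" for a b
  proof -
    let ?p = "Transposition.transpose a b"
    have "v $ ((Some \<circ> s(a := j))(b := None) \<circ> ?p) = of_int (sign ?p) * v $ ((Some \<circ> s(a := j))(b := None))"
      using v permutes_swap_id[of a UNIV b] unfolding alternating_def by blast
    moreover have "(Some \<circ> s(a := j))(b := None) \<circ> ?p = (Some \<circ> s(b := j))(a := None)"
      using that by (auto simp: fun_eq_iff Transposition.transpose_def)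
    ultimately have "v $ ((Some \<circ> s(b := j))(a := None)) = - v $ ((Some \<circ> s(a := j))(b := None))"
      using that by (simp add: sign_swap_id)
    then show ?thesis by simp
  qed
  have off: "(\<Sum>a\<in>UNIV. \<Sum>b\<in>UNIV - {a}. ?f a b) = 0"
  proof -
    let ?S = "\<Sum>a\<in>UNIV. \<Sum>b\<in>UNIV. if a = b then 0 else ?f a b"
    have 1: "(\<Sum>a\<in>UNIV. \<Sum>b\<in>UNIV - {a}. ?f a b) = ?S"
      by (intro sum.cong refl sum.mono_neutral_cong_left) auto
    have "?S = (\<Sum>a\<in>UNIV. \<Sum>b\<in>UNIV. if b = a then 0 else ?f b a)" by (rule sum.swap)
    also have "\<dots> = (\<Sum>a\<in>UNIV. \<Sum>b\<in>UNIV. - (if a = b then 0 else ?f a b))"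
    proof (intro sum.cong refl)
      fix a b
      show "(if b = a then 0 else ?f b a) = - (if a = b then 0 else ?f a b)"
      proof (cases "a = b")
        case False
        then have "?f b a = - ?f a b" by (intro anti) simp
        then show ?thesis using False False[symmetric] by (simp only: if_False)
      qed simp
    qed
    also have "\<dots> = - ?S" by (simp add: sum_negf)
    finally show ?thesis using 1 by simp
  qed
  have "(\<Sum>a\<in>UNIV. X $ s a * e0_part X v $ (s(a := j)))
      = (\<Sum>a\<in>UNIV. X $ s a * (X $ j * v $ ((Some \<circ> s)(a := None)))) + (\<Sum>a\<in>UNIV. \<Sum>b\<in>UNIV - {a}. ?f a b)"
  proof -
    have "X $ s a * e0_part X v $ (s(a := j))
        = X $ s a * (X $ j * v $ ((Some \<circ> s)(a := None))) + (\<Sum>b\<in>UNIV - {a}. ?f a b)" for a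
    proof -
      have u: "(Some \<circ> s(a := j))(a := None) = (Some \<circ> s)(a := None)" by auto
      have "e0_part X v $ (s(a := j)) = (\<Sum>b\<in>UNIV. X $ (s(a := j)) b * v $ ((Some \<circ> s(a := j))(b := None)))"
        by (simp add: e0_part_def)
      also have "\<dots> = X $ j * v $ ((Some \<circ> s)(a := None))
          + (\<Sum>b\<in>UNIV - {a}. X $ (s(a := j)) b * v $ ((Some \<circ> s(a := j))(b := None)))"
        by (subst sum.remove[of _ a]) (simp_all add: u)
      also have "(\<Sum>b\<in>UNIV - {a}. X $ (s(a := j)) b * v $ ((Some \<circ> s(a := j))(b := None)))
          = (\<Sum>b\<in>UNIV - {a}. X $ s b * v $ ((Some \<circ> s(a := j))(b := None)))"
        by (rule sum.cong) auto
      finally show ?thesis by (simp only: distrib_left sum_distrib_left)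
    qed
    then show ?thesis by (simp add: sum.distrib)
  qed
  then show ?thesis unfolding off
    by (simp add: ext_mult_def) (simp add: e0_part_def sum_distrib_left mult_ac)
qed

text \<open>Since \<open>r < n\<close>, for every tuple \<open>s\<close> there is an index \<open>j\<close> outside its range, and the component of
  \<open>e\<^sub>j \<and> w\<close> with indices \<open>j, s\<close> is that of \<open>w\<close> with indices \<open>s\<close>.\<close>

lemma ext_mult_nondegenerate:
  fixes w :: "real^('r::finite \<Rightarrow> 'n::finite)"
  assumes "CARD('r) < CARD('n)" "\<And>X j s. ext_mult X w j s = 0"
  shows "w = 0"
proof -
  have "w $ s = 0" for s
  proof -
    have "card (range s) < CARD('n)" using assms(1) card_image_le[of UNIV s] by simp
    then obtain j where j: "j \<notin> range s" by (metis UNIV_eq_I less_irrefl)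
    then have "s a \<noteq> j" for a by blast
    then have "ext_mult (axis j 1) w j s = w $ s"
      by (simp add: ext_mult_def axis_component)
    then show ?thesis using assms(2) by simp
  qed
  then show ?thesis by (simp add: vec_eq_iff)
qed

text \<open>In terms of forms the hypothesis is \<open>d\<sigma>(X) = - X \<and> \<rho>\<close>. The difference \<open>\<tau>\<close> between \<open>\<sigma>\<close> and the
  claimed solution satisfies an equation of the same kind, with \<open>\<tau>(0) = 0\<close>. Hence \<open>X \<and> \<tau>\<close> is constant
  on lines in direction \<open>X\<close>. This gives \<open>x \<and> \<tau>(x) = 0\<close> and then \<open>x \<and> \<tau>(y) = - y \<and> \<tau>(x)\<close>, so by
  nondegeneracy \<open>\<tau>\<close> is homogeneous of degree one, hence equal to its derivative at 0, which is 0.\<close>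

lemma affine_from_gradient:
  fixes \<sigma> :: "real^'n::finite \<Rightarrow> real^('r::finite \<Rightarrow> 'n)" and \<rho> :: "real^'n \<Rightarrow> real^('r \<Rightarrow> 'n option)"
  assumes card: "CARD('r) < CARD('n)" and \<rho>: "\<And>x. \<rho> x \<in> alternating"
    and d: "\<And>x X. ((\<lambda>t. \<sigma> (x + t *\<^sub>R X)) has_vector_derivative - e0_part X (\<rho> x)) (at 0)"
  shows "\<sigma> x = \<sigma> 0 - e0_part x (\<rho> 0)"
proof -
  define \<tau> where "\<tau> x = \<sigma> x - \<sigma> 0 + e0_part x (\<rho> 0)" for x
  have e0: "e0_part 0 v = 0" for v :: "real^('r \<Rightarrow> 'n option)" by (simp add: e0_part_def vec_eq_iff)
  have \<tau>0: "\<tau> 0 = 0" by (simp add: \<tau>_def e0)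
  have d\<tau>: "((\<lambda>t. \<tau> (x + t *\<^sub>R X)) has_vector_derivative e0_part X (\<rho> 0 - \<rho> x)) (at 0)" for x X
  proof -
    have "((\<lambda>t. \<sigma> (x + t *\<^sub>R X) - \<sigma> 0 + (e0_part x (\<rho> 0) + t *\<^sub>R e0_part X (\<rho> 0)))
        has_vector_derivative (- e0_part X (\<rho> x) - 0 + (0 + e0_part X (\<rho> 0)))) (at 0)"
      by (intro has_vector_derivative_add has_vector_derivative_diff has_vector_derivative_const d)
        (auto intro!: derivative_eq_intros)
    then show ?thesis
      by (simp add: \<tau>_def e0_part_add e0_part_scaleR linear_diff[OF linear_e0_part])
  qed
  have d\<tau>': "((\<lambda>t. \<tau> (x + t *\<^sub>R X)) has_vector_derivative e0_part X (\<rho> 0 - \<rho> (x + t0 *\<^sub>R X))) (at t0)" for x X t0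
  proof -
    have a: "((\<lambda>t. t - t0) has_vector_derivative 1) (at t0)"
      by (auto intro!: derivative_eq_intros)
    have b: "((\<lambda>t. \<tau> ((x + t0 *\<^sub>R X) + t *\<^sub>R X)) has_vector_derivative e0_part X (\<rho> 0 - \<rho> (x + t0 *\<^sub>R X))) (at (t0 - t0))"
      using d\<tau>[of "x + t0 *\<^sub>R X" X] by simp
    have c: "(x + t0 *\<^sub>R X) + (t - t0) *\<^sub>R X = x + t *\<^sub>R X" for t
      by (simp add: scaleR_left_diff_distrib)
    show ?thesis using vector_diff_chain_at[OF a b] unfolding comp_def c by simp
  qed
  \<comment> \<open>\<open>X \<and> \<tau>\<close> does not change in direction \<open>X\<close>, as \<open>X \<and> d\<tau>(X) = 0\<close>.\<close>
  have const: "ext_mult X (\<tau> (x + X)) j s = ext_mult X (\<tau> x) j s" for X x j s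
  proof -
    have bl: "bounded_linear (\<lambda>w :: real^('r \<Rightarrow> 'n). ext_mult X w j s)"
      by (intro linear_conv_bounded_linear[THEN iffD1] linearI) (simp_all add: ext_mult_linear)
    have al: "\<rho> 0 - \<rho> y \<in> alternating" for y
      by (intro subspace_diff[OF subspace_alternating] \<rho>)
    have "((\<lambda>t. ext_mult X (\<tau> (x + t *\<^sub>R X)) j s) has_real_derivative 0) (at t)" for t
      using bounded_linear.has_vector_derivative[OF bl d\<tau>'[of x X t]]
      unfolding ext_mult_e0_part[OF al] has_real_derivative_iff_has_vector_derivative .
    then have "\<forall>t. ((\<lambda>t. ext_mult X (\<tau> (x + t *\<^sub>R X)) j s) has_real_derivative 0) (at t)" by (rule allI)
    from DERIV_isconst_all[OF this, of 1 0]
    show ?thesis by simp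
  qed
  have self: "ext_mult X (\<tau> X) j s = 0" for X j s
    using const[of X 0 j s] ext_mult_linear(2)[of X 0 0 j s] by (simp add: \<tau>0)
  \<comment> \<open>Apply \<open>const\<close> with \<open>X = y - x\<close>; the diagonal terms vanish by \<open>self\<close>.\<close>
  have anti: "ext_mult x (\<tau> y) j s = - ext_mult y (\<tau> x) j s" for x y j s
  proof -
    have "ext_mult (y + (-1) *\<^sub>R x) (\<tau> y) j s = ext_mult (y + (-1) *\<^sub>R x) (\<tau> x) j s"
      using const[of "y - x" x j s] by simp
    then show ?thesis unfolding ext_mult_linear self by simp
  qed
  have hom: "\<tau> (c *\<^sub>R y) = c *\<^sub>R \<tau> y" for c y
  proof -
    have "ext_mult X (\<tau> (c *\<^sub>R y) + (- c) *\<^sub>R \<tau> y) j s = 0" for X j s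
      unfolding ext_mult_linear anti[of X] by simp
    then have "\<tau> (c *\<^sub>R y) + (- c) *\<^sub>R \<tau> y = 0" by (rule ext_mult_nondegenerate[OF card])
    then show ?thesis by simp
  qed
  have "\<tau> x = 0"
  proof -
    have "((\<lambda>t. t *\<^sub>R \<tau> x) has_vector_derivative e0_part x (\<rho> 0 - \<rho> 0)) (at 0)"
      using d\<tau>[of 0 x] by (simp add: hom)
    moreover have "((\<lambda>t. t *\<^sub>R \<tau> x) has_vector_derivative \<tau> x) (at 0)"
      by (auto intro!: derivative_eq_intros)
    ultimately show ?thesis using vector_derivative_unique_at linear_0[OF linear_e0_part] by fastforce
  qed
  then show ?thesis by (simp add: \<tau>_def algebra_simps)
qed

text \<open>Restricted to the normal section, the solution is a function of \<open>x\<close> to which \<open>affine_from_gradient\<close>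
  applies, where the value at \<open>exp(x)\<close> of the splitting supplies \<open>\<rho>\<close>. The constant vector is the value of
  the splitting at the unit element.\<close>

lemma flat_ext_solution:
  fixes \<alpha> :: "'n::finite mat \<Rightarrow> real^('r::finite \<Rightarrow> 'n)"
  assumes card: "CARD('r) < CARD('n)" and sol: "BGG_solution flat_model ext_bgg flat_dom \<alpha>"
  obtains v where "v \<in> alternating"
    "\<And>X g. g \<in> Pgrp \<Longrightarrow> \<alpha> (flat_lift X ** g) = (\<chi> s. tensor_act (matrix_inv (flat_lift X ** g)) v $ (Some \<circ> s))"
proof -
  interpret bgg_module "ext_bgg :: ('n, real^('r \<Rightarrow> 'n option), _) bgg_data" "\<lambda>t. \<chi> s. t $ (Some \<circ> s)"
    by (rule bgg_module_ext)
  let ?\<pi> = "\<lambda>t :: real^('r \<Rightarrow> 'n option). \<chi> s. t $ (Some \<circ> s) :: real^('r \<Rightarrow> 'n)"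
  obtain s where s: "\<And>u. u \<in> over flat_model flat_dom \<Longrightarrow> s u \<in> bgg_space ext_bgg"
    "\<And>u. u \<in> over flat_model flat_dom \<Longrightarrow> \<alpha> u = ?\<pi> (s u)"
    "\<And>u g. u \<in> over flat_model flat_dom \<Longrightarrow> g \<in> Pgrp \<Longrightarrow> s (u ** g) = bgg_act ext_bgg (matrix_inv g) (s u)"
    "\<And>u X. u \<in> over flat_model flat_dom \<Longrightarrow>
       ((\<lambda>t. ?\<pi> (s (u ** flat_lift (t *\<^sub>R X)))) has_vector_derivative - ?\<pi> (inf_act ext_bgg (gm X) (s u))) (at 0)"
    using flat_solution_parallel_proj[OF sol] by blast
  have ov: "flat_lift X ** g \<in> over flat_model flat_dom" if "g \<in> Pgrp" for X :: "real^'n" and g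
  proof -
    have "(flat_lift X ** g) $ None $ None = g $ None $ None"
      by (simp add: matrix_matrix_mult_def UNIV_option_conv sum.reindex flat_lift_component)
    then show ?thesis using that unfolding over_flat_dom by (simp add: SL_mult flat_lift_SL Pgrp_iff)
  qed
  have ov1: "flat_lift X \<in> over flat_model flat_dom" for X :: "real^'n"
    using ov[OF Pgrp_one, of X] by simp
  have alt: "s (flat_lift X) \<in> alternating" for X using s(1)[OF ov1[of X]] by (simp add: ext_bgg_def)
  have "((\<lambda>t. ?\<pi> (s (flat_lift (x + t *\<^sub>R X)))) has_vector_derivative - e0_part X (s (flat_lift x))) (at 0)" for x X
    using s(4)[OF ov1[of x], of X] unfolding flat_lift_add proj_inf_act_ext[OF alt] .
  from affine_from_gradient[OF card alt this]
  have aff: "?\<pi> (s (flat_lift x)) = ?\<pi> (s (flat_lift 0)) - e0_part x (s (flat_lift 0))" for x .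
  define v where "v = s (flat_lift 0)"
  show thesis
  proof
    show v: "v \<in> alternating" unfolding v_def by (rule alt)
    fix X g assume g: "g \<in> (Pgrp :: 'n mat set)"
    have m: "e0_part (- X) v = - e0_part X v" using e0_part_scaleR[of "-1" X v] by simp
    have "?\<pi> (s (flat_lift X)) = ?\<pi> (bgg_act ext_bgg (flat_lift (- X)) v)"
      using aff[of X] tensor_act_flat_lift_top[OF v, of "- X"] by (simp add: ext_bgg_def v_def[symmetric] m)
    moreover have "\<alpha> (flat_lift X ** g) = h0_act ext_bgg (matrix_inv g) (?\<pi> (s (flat_lift X)))"
      unfolding s(2)[OF ov[OF g]] s(3)[OF ov1 g] by (rule proj_act[OF Pgrp_inv[OF g]])
    ultimately have "\<alpha> (flat_lift X ** g) = ?\<pi> (bgg_act ext_bgg (matrix_inv (flat_lift X ** g)) v)"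
      unfolding act_inverse_lift[OF g] proj_act[OF Pgrp_inv[OF g]] by simp
    then show "\<alpha> (flat_lift X ** g) = ?\<pi> (tensor_act (matrix_inv (flat_lift X ** g)) v)"
      by (simp add: ext_bgg_def)
  qed
qed

text \<open>At \<open>X = 0\<close> the part without \<open>e\<^sub>0\<close> vanishes. For the remaining part \<open>e\<^sub>0 \<and> \<rho>\<close>, choose \<open>X = e\<^sub>j\<close> with \<open>j\<close>
  outside the indices of a given component of \<open>\<rho>\<close>; then this component occurs in \<open>X \<and> \<rho>\<close>.\<close>

lemma alternating_zero_if_tops_zero:
  fixes v :: "real^('r::finite \<Rightarrow> 'n::finite option)"
  assumes card: "CARD('r) < CARD('n)" and v: "v \<in> alternating"
    and z: "\<And>X. (\<chi> s. tensor_act (flat_lift X) v $ (Some \<circ> s)) = 0"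
  shows "v = 0"
proof -
  have t: "(\<chi> s. v $ (Some \<circ> s)) + e0_part X v = 0" for X
    using z tensor_act_flat_lift_top[OF v] by simp
  have e0: "e0_part 0 v = 0" by (simp add: e0_part_def vec_eq_iff)
  have top: "(\<chi> s. v $ (Some \<circ> s)) = 0" using t[of 0] e0 by simp
  then have top': "v $ (Some \<circ> s) = 0" for s by (simp add: vec_eq_iff)
  have low: "(\<Sum>a\<in>UNIV. X $ s a * v $ ((Some \<circ> s)(a := None))) = 0" for X s
    using t[of X] unfolding top by (simp add: e0_part_def vec_eq_iff)
  have "v $ s' = 0" for s'
  proof (cases "\<exists>a. s' a = None")
    case False
    then have "s' = Some \<circ> (\<lambda>a. the (s' a))" by (auto simp: fun_eq_iff)
    then show ?thesis using top' by metis
  next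
    case True
    then obtain a where a: "s' a = None" by blast
    show ?thesis
    proof (cases "\<exists>b. b \<noteq> a \<and> s' b = None")
      case True
      then show ?thesis using alternating_eq_zero[OF v] a by metis
    next
      case False
      let ?r = "(\<lambda>b. the (s' b)) ` (UNIV - {a})"
      have "card ?r < CARD('n)"
        using card card_image_le[of "UNIV - {a}" "\<lambda>b. the (s' b)"] by simp
      then obtain j where j: "j \<notin> ?r" by (metis UNIV_eq_I less_irrefl)
      define s where "s b = (if b = a then j else the (s' b))" for b
      have s': "(Some \<circ> s)(a := None) = s'" using False a by (auto simp: fun_eq_iff s_def)
      have "axis j 1 $ s b = (if b = a then 1 else (0::real))" for b
        using j by (auto simp: s_def axis_component)
      then have "(\<Sum>b\<in>UNIV. axis j 1 $ s b * v $ ((Some \<circ> s)(b := None))) = (\<Sum>b\<in>UNIV. if b = a then v $ s' else 0)"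
        using s' by (intro sum.cong) (simp_all del: fun_upd_apply)
      then show ?thesis using low[of "axis j 1" s] by simp
    qed
  qed
  then show ?thesis by (simp add: vec_eq_iff)
qed

section \<open>Homogeneous polynomials as symmetric tensors\<close>

text \<open>An index tuple determines a monomial; its exponents are the multiplicities of the indices.\<close>

lemma prod_fibres:
  fixes y :: "'i::finite \<Rightarrow> real" and s :: "'k::finite \<Rightarrow> 'i"
  shows "(\<Prod>a\<in>UNIV. y (s a)) = (\<Prod>i\<in>UNIV. y i ^ card {a. s a = i})"
proof -
  have "(\<Prod>a\<in>UNIV. y (s a)) = (\<Prod>i\<in>UNIV. \<Prod>a | a \<in> UNIV \<and> s a = i. y (s a))"
    by (rule prod.group[symmetric]) auto
  also have "\<dots> = (\<Prod>i\<in>UNIV. y i ^ card {a. s a = i})"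
    by (rule prod.cong) simp_all
  finally show ?thesis .
qed

lemma sum_card_fibres: "(\<Sum>i\<in>UNIV. card {a. s a = i}) = CARD('k)" for s :: "'k::finite \<Rightarrow> 'i::finite"
proof -
  have "(\<Sum>i\<in>UNIV. \<Sum>a | a \<in> UNIV \<and> s a = i. (1::nat)) = (\<Sum>a\<in>(UNIV :: 'k set). 1)"
    by (rule sum.group) auto
  then show ?thesis by simp
qed

lemma finite_multi_indices: "finite {m :: 'i::finite \<Rightarrow> nat. (\<Sum>i\<in>UNIV. m i) = d}"
proof (rule finite_subset)
  show "{m :: 'i \<Rightarrow> nat. (\<Sum>i\<in>UNIV. m i) = d} \<subseteq> PiE UNIV (\<lambda>_. {..d})"
  proof
    fix m :: "'i \<Rightarrow> nat" assume "m \<in> {m. (\<Sum>i\<in>UNIV. m i) = d}"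
    then have "m i \<le> d" for i using member_le_sum[of i UNIV m] by simp
    then show "m \<in> PiE UNIV (\<lambda>_. {..d})" by (simp add: PiE_def Pi_def)
  qed
qed (simp add: finite_PiE)

lemma sum_over_multi_indices:
  fixes f :: "('k::finite \<Rightarrow> 'i::finite) \<Rightarrow> real"
  shows "(\<Sum>m | (\<Sum>i\<in>UNIV. m i) = CARD('k). \<Sum>s | (\<lambda>i. card {a. s a = i}) = m. f s) = (\<Sum>s\<in>UNIV. f s)"
proof -
  have "(\<Sum>m\<in>{m. (\<Sum>i\<in>UNIV. m i) = CARD('k)}. \<Sum>s | s \<in> UNIV \<and> (\<lambda>i. card {a. s a = i}) = m. f s) = (\<Sum>s\<in>UNIV. f s)"
    by (rule sum.group) (auto simp: finite_multi_indices sum_card_fibres)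
  then show ?thesis by simp
qed

lemma homogeneous_polynomial_tensor:
  fixes t :: "('k::finite \<Rightarrow> 'i::finite) \<Rightarrow> real"
  shows "homogeneous_polynomial CARD('k) (\<lambda>y. \<Sum>s\<in>UNIV. t s * (\<Prod>a\<in>UNIV. y (s a)))"
  unfolding homogeneous_polynomial_def
proof (intro exI ext)
  fix y :: "'i \<Rightarrow> real"
  show "(\<Sum>s\<in>UNIV. t s * (\<Prod>a\<in>UNIV. y (s a))) = (\<Sum>m | (\<Sum>i\<in>UNIV. m i) = CARD('k).
      (\<Sum>s | (\<lambda>i. card {a. s a = i}) = m. t s) * (\<Prod>i\<in>UNIV. y i ^ m i))"
    unfolding sum_over_multi_indices[of "\<lambda>s. t s * (\<Prod>a\<in>UNIV. y (s a))", symmetric] sum_distrib_right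
    by (intro sum.cong refl) (auto simp: prod_fibres)
qed

text \<open>This makes the number of index tuples with given multiplicities nonzero, so that one can divide by it.\<close>

lemma multi_index_realised:
  fixes m :: "'i::finite \<Rightarrow> nat"
  assumes "(\<Sum>i\<in>UNIV. m i) = CARD('k::finite)"
  shows "\<exists>s :: 'k \<Rightarrow> 'i. (\<lambda>i. card {a. s a = i}) = m"
proof -
  \<comment> \<open>The disjoint union of blocks of sizes \<open>m i\<close> has as many elements as \<open>'k\<close>.\<close>
  let ?S = "Sigma (UNIV :: 'i set) (\<lambda>i. {..<m i})"
  have "card ?S = CARD('k)" using assms by (simp add: card_SigmaI)
  then obtain h where h: "bij_betw h (UNIV :: 'k set) ?S"
    using finite_same_card_bij[of "UNIV :: 'k set" ?S] by auto
  have "card {a. fst (h a) = i} = m i" for i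
  proof -
    have "h ` {a. fst (h a) = i} = {i} \<times> {..<m i}"
    proof (intro equalityI subsetI)
      fix z assume "z \<in> h ` {a. fst (h a) = i}"
      then obtain a where a: "z = h a" "fst (h a) = i" by blast
      have "h a \<in> ?S" using bij_betwE[OF h] by blast
      then show "z \<in> {i} \<times> {..<m i}" using a by (cases z) auto
    next
      fix z assume z: "z \<in> {i} \<times> {..<m i}"
      then have "z \<in> h ` UNIV" using h by (auto simp: bij_betw_def)
      then obtain a where a: "z = h a" by blast
      then have "fst (h a) = i" using z by auto
      then show "z \<in> h ` {a. fst (h a) = i}" unfolding a by (intro imageI CollectI)
    qed
    moreover have "inj_on h {a. fst (h a) = i}"
      using h by (auto simp: bij_betw_def intro: inj_on_subset)
    ultimately show ?thesis using card_image[of h "{a. fst (h a) = i}"] by simp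
  qed
  then show ?thesis by (intro exI[of _ "\<lambda>a. fst (h a)"]) auto
qed

text \<open>The coefficient of a monomial is distributed equally among the index tuples that give this monomial.\<close>

lemma homogeneous_polynomial_symmetric:
  fixes q :: "('i::finite \<Rightarrow> real) \<Rightarrow> real"
  assumes "homogeneous_polynomial CARD('k::finite) q"
  obtains t :: "real^('k::finite \<Rightarrow> 'i)" where "t \<in> symmetric" "\<And>y. q y = (\<Sum>s\<in>UNIV. t $ s * (\<Prod>a\<in>UNIV. y (s a)))"
proof -
  obtain c where q: "q = (\<lambda>y. \<Sum>m | (\<Sum>i\<in>UNIV. m i) = CARD('k). c m * (\<Prod>i\<in>UNIV. y i ^ m i))"
    using assms unfolding homogeneous_polynomial_def by blast
  define cnt where "cnt s = (\<lambda>i. card {a. s a = i})" for s :: "'k \<Rightarrow> 'i"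
  define t :: "real^('k \<Rightarrow> 'i)" where "t = (\<chi> s. c (cnt s) / card {s'. cnt s' = cnt s})"
  show thesis
  proof (rule that[of t])
    have "cnt (s \<circ> p) = cnt s" if p: "p permutes UNIV" for s p
    proof
      fix i
      have "bij p" using p by (rule permutes_bij)
      then have "p ` {a. s (p a) = i} = {a. s a = i}"
        by (auto simp: image_iff) (metis bij_pointE)
      moreover have "inj_on p {a. s (p a) = i}" using permutes_inj_on[OF p] .
      ultimately show "cnt (s \<circ> p) i = cnt s i" using card_image[of p "{a. s (p a) = i}"] by (simp add: cnt_def)
    qed
    then show "t \<in> symmetric" by (simp add: symmetric_def t_def)
    fix y
    have "(\<Sum>s\<in>UNIV. t $ s * (\<Prod>a\<in>UNIV. y (s a)))
        = (\<Sum>m | (\<Sum>i\<in>UNIV. m i) = CARD('k). \<Sum>s | cnt s = m. t $ s * (\<Prod>a\<in>UNIV. y (s a)))"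
      unfolding cnt_def by (rule sum_over_multi_indices[symmetric])
    also have "\<dots> = (\<Sum>m | (\<Sum>i\<in>UNIV. m i) = CARD('k). c m * (\<Prod>i\<in>UNIV. y i ^ m i))"
    proof (rule sum.cong[OF refl])
      fix m :: "'i \<Rightarrow> nat" assume "m \<in> {m. (\<Sum>i\<in>UNIV. m i) = CARD('k)}"
      then obtain s0 :: "'k \<Rightarrow> 'i" where "cnt s0 = m" using multi_index_realised[of m] by (auto simp: cnt_def)
      then have "{s :: 'k \<Rightarrow> 'i. cnt s = m} \<noteq> {}" by blast
      then have n: "card {s :: 'k \<Rightarrow> 'i. cnt s = m} \<noteq> 0" by simp
      have "(\<Sum>s | cnt s = m. t $ s * (\<Prod>a\<in>UNIV. y (s a)))
          = (\<Sum>s | cnt s = m. c m / card {s' :: 'k \<Rightarrow> 'i. cnt s' = m} * (\<Prod>i\<in>UNIV. y i ^ m i))"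
        by (rule sum.cong) (auto simp: t_def prod_fibres cnt_def)
      then show "(\<Sum>s | cnt s = m. t $ s * (\<Prod>a\<in>UNIV. y (s a))) = c m * (\<Prod>i\<in>UNIV. y i ^ m i)"
        using n by simp
    qed
    finally show "q y = (\<Sum>s\<in>UNIV. t $ s * (\<Prod>a\<in>UNIV. y (s a)))" by (simp add: q)
  qed
qed

section \<open>Solutions in normal coordinates\<close>

text \<open>The dual of \<open>(exp(X) g)\<^sup>-\<^sup>1\<close> is the transpose of \<open>exp(X) g\<close>, so acting with it and evaluating at \<open>e\<^sub>0\<close> in all
  slots amounts to evaluating at \<open>exp(X) g e\<^sub>0\<close>, whose coordinates are the \<open>X\<^sup>a\<close>.\<close>

lemma tensor_kernel_hom_coord:
  assumes "normal_data C B \<Phi> u X g"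
  shows "tensor_kernel (dual_mat (matrix_inv (flat_lift X ** g))) (\<lambda>_. None) k
    = (\<Prod>a\<in>UNIV. hom_coord C B \<Phi> (k a) u)"
proof -
  have "det (flat_lift X ** g) \<noteq> 0"
    using SL_det[OF Pgrp_SL[OF normal_dataD(2)[OF assms]]] by (simp add: det_mul)
  then show ?thesis
    by (simp add: tensor_kernel_def dual_mat_def matrix_inv_matrix_inv transpose_def normal_data_hom_coord[OF assms])
qed

lemma sym_act_hom_coord:
  assumes "normal_data C B \<Phi> u X g"
  shows "bgg_act sym_bgg (matrix_inv (flat_lift X ** g)) t $ (\<lambda>_. None)
    = (\<Sum>s\<in>UNIV. t $ s * (\<Prod>a\<in>UNIV. hom_coord C B \<Phi> (s a) u))"
  by (simp add: sym_bgg_def tensor_act_kernel tensor_kernel_hom_coord[OF assms] mult.commute)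

text \<open>For each tuple \<open>k\<close> of indices in the symmetric factor, the slice of \<open>t\<close> is an alternating tensor and
  contributes its combination of the sections in (1), multiplied by the monomial of \<open>k\<close>.\<close>

lemma mixed_act_hom_coord:
  fixes t :: "real^(('k::finite \<Rightarrow> 'n::{finite,linorder} option) \<times> ('r::{finite,linorder} \<Rightarrow> 'n option))"
  assumes nd: "normal_data C B \<Phi> u X g" and t: "t \<in> cartan_product"
    and c: "\<And>k I. c k I = t $ (k, \<lambda>a. option_list (Some ` I) ! position a)"
    and d: "\<And>k J. d k J = - t $ (k, \<lambda>a. option_list (insert None (Some ` J)) ! position a)"
  shows "(\<chi> s. mixed_act (matrix_inv (flat_lift X ** g)) t $ ((\<lambda>_. None), Some \<circ> s))
    = wedge_comb C B \<Phi> (\<lambda>I u. \<Sum>k\<in>UNIV. c k I * (\<Prod>a\<in>UNIV. hom_coord C B \<Phi> (k a) u))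
        (\<lambda>J u. \<Sum>k\<in>UNIV. d k J * (\<Prod>a\<in>UNIV. hom_coord C B \<Phi> (k a) u)) u"
proof -
  let ?h = "\<lambda>k. \<Prod>a\<in>UNIV. hom_coord C B \<Phi> (k a) u" and ?m = "matrix_inv (flat_lift X ** g)"
  have "(\<chi> s'. t $ (k, s')) = comb_tensor (c k) (d k)" for k
    using alternating_comb_tensor[OF cartan_product_slices[OF t, of k]] by (simp add: c[abs_def] d[abs_def])
  then have "(\<chi> s. mixed_act ?m t $ ((\<lambda>_. None), Some \<circ> s))
      = (\<Sum>k\<in>UNIV. ?h k *\<^sub>R (\<chi> s. tensor_act ?m (comb_tensor (c k) (d k)) $ (Some \<circ> s)))"
    by (simp add: mixed_act_slices tensor_kernel_hom_coord[OF nd] vec_eq_iff)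
  also have "\<dots> = (\<Sum>k\<in>UNIV. ?h k *\<^sub>R wedge_comb C B \<Phi> (\<lambda>I _. c k I) (\<lambda>J _. d k J) u)"
    by (simp only: wedge_comb_comb_tensor[OF nd])
  also have "\<dots> = wedge_comb C B \<Phi> (\<lambda>I u. \<Sum>k\<in>UNIV. c k I * (\<Prod>a\<in>UNIV. hom_coord C B \<Phi> (k a) u))
        (\<lambda>J u. \<Sum>k\<in>UNIV. d k J * (\<Prod>a\<in>UNIV. hom_coord C B \<Phi> (k a) u)) u"
    unfolding wedge_comb_def scaleR_add_right sum.distrib scaleR_sum_right scaleR_sum_left scaleR_scaleR
    by (intro arg_cong2[of _ _ _ _ "(+)"]) (subst sum.swap, simp add: mult.commute)+
  finally show ?thesis .
qed

lemma ext_normal_solution: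
  fixes C :: "('g, 'm, 'n::{finite,linorder}) cartan_geometry" and \<alpha> :: "'g \<Rightarrow> real^('r::{finite,linorder} \<Rightarrow> 'n)"
  assumes pb: "principal_bundle C" and nc: "normal_chart C u0 B \<Phi>"
    and sol: "normal_BGG_solution C ext_bgg (pts (base C)) \<alpha>"
  shows "\<exists>c d. \<forall>u\<in>over C (chart_dom C B \<Phi>). \<alpha> u = wedge_comb C B \<Phi> (\<lambda>I _. c I) (\<lambda>J _. d J) u"
proof -
  obtain v where v: "v \<in> bgg_space (ext_bgg :: ('n, real^('r \<Rightarrow> 'n option), real^('r \<Rightarrow> 'n)) bgg_data)"
    "\<And>X g. X \<in> B \<Longrightarrow> g \<in> Pgrp \<Longrightarrow> \<alpha> (ract C (\<Phi> X) g)
       = (\<chi> s. bgg_act ext_bgg (matrix_inv (flat_lift X ** g)) v $ (Some \<circ> s))"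
    using bgg_module.normal_solution_form[OF bgg_module_ext pb nc sol] by blast
  then have "v \<in> alternating" by (simp add: ext_bgg_def)
  from alternating_comb_tensor[OF this] obtain c d where cd: "v = comb_tensor c d" by blast
  have "\<alpha> u = wedge_comb C B \<Phi> (\<lambda>I _. c I) (\<lambda>J _. d J) u" if u: "u \<in> over C (chart_dom C B \<Phi>)" for u
  proof -
    obtain X g where nd: "normal_data C B \<Phi> u X g" using normal_data_exists[OF pb nc u] .
    note N = normal_dataD[OF nd]
    show ?thesis using v(2)[OF N(1,2)] unfolding N(3)[symmetric] wedge_comb_comb_tensor[OF nd]
      by (simp add: ext_bgg_def cd)
  qed
  then show ?thesis by blast
qed

lemma sym_normal_solution:
  fixes C :: "('g, 'm, 'n::finite) cartan_geometry"
  assumes pb: "principal_bundle C" and nc: "normal_chart C u0 B \<Phi>"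
    and sol: "normal_BGG_solution C (sym_bgg :: ('n, real^('k::finite \<Rightarrow> 'n option), real) bgg_data) (pts (base C)) \<alpha>"
  shows "\<exists>q. homogeneous_polynomial CARD('k) q \<and>
             (\<forall>u\<in>over C (chart_dom C B \<Phi>). \<alpha> u = q (\<lambda>a. hom_coord C B \<Phi> a u))"
proof -
  obtain t where "t \<in> bgg_space (sym_bgg :: ('n, real^('k \<Rightarrow> 'n option), real) bgg_data)"
    and t: "\<And>X g. X \<in> B \<Longrightarrow> g \<in> Pgrp \<Longrightarrow> \<alpha> (ract C (\<Phi> X) g)
       = bgg_act (sym_bgg :: ('n, real^('k \<Rightarrow> 'n option), real) bgg_data) (matrix_inv (flat_lift X ** g)) t $ (\<lambda>_. None)"
    using bgg_module.normal_solution_form[OF bgg_module_sym pb nc sol] by blast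
  let ?q = "\<lambda>y. \<Sum>s\<in>UNIV. t $ s * (\<Prod>a\<in>UNIV. y (s a))"
  have "\<alpha> u = ?q (\<lambda>a. hom_coord C B \<Phi> a u)" if u: "u \<in> over C (chart_dom C B \<Phi>)" for u
  proof -
    obtain X g where nd: "normal_data C B \<Phi> u X g" using normal_data_exists[OF pb nc u] .
    note N = normal_dataD[OF nd]
    show ?thesis using t[OF N(1,2)] unfolding N(3)[symmetric] sym_act_hom_coord[OF nd] .
  qed
  then show ?thesis
    by (intro exI[of _ ?q] conjI ballI homogeneous_polynomial_tensor)
qed

lemma mixed_normal_solution:
  fixes C :: "('g, 'm, 'n::{finite,linorder}) cartan_geometry" and \<alpha> :: "'g \<Rightarrow> real^('r::{finite,linorder} \<Rightarrow> 'n)"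
  assumes pb: "principal_bundle C" and nc: "normal_chart C u0 B \<Phi>"
    and sol: "normal_BGG_solution C (mixed_bgg :: ('n, real^(('k::finite \<Rightarrow> 'n option) \<times> ('r \<Rightarrow> 'n option)), real^('r \<Rightarrow> 'n)) bgg_data)
      (pts (base C)) \<alpha>"
  shows "\<exists>q q'. (\<forall>I. homogeneous_polynomial CARD('k) (q I)) \<and> (\<forall>J. homogeneous_polynomial CARD('k) (q' J)) \<and>
     (\<forall>u\<in>over C (chart_dom C B \<Phi>). \<alpha> u = wedge_comb C B \<Phi>
        (\<lambda>I u. q I (\<lambda>a. hom_coord C B \<Phi> a u)) (\<lambda>J u. q' J (\<lambda>a. hom_coord C B \<Phi> a u)) u)"
proof -
  let ?V = "mixed_bgg :: ('n, real^(('k \<Rightarrow> 'n option) \<times> ('r \<Rightarrow> 'n option)), real^('r \<Rightarrow> 'n)) bgg_data"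
  obtain t where "t \<in> bgg_space ?V"
    and t: "\<And>X g. X \<in> B \<Longrightarrow> g \<in> Pgrp \<Longrightarrow> \<alpha> (ract C (\<Phi> X) g)
       = (\<chi> s. bgg_act ?V (matrix_inv (flat_lift X ** g)) t $ ((\<lambda>_. None), Some \<circ> s))"
    using bgg_module.normal_solution_form[OF bgg_module_mixed pb nc sol] by blast
  then have tc: "t \<in> cartan_product" by (simp add: mixed_bgg_def)
  define c where "c k I = t $ (k, \<lambda>a. option_list (Some ` I) ! position a)" for k I
  define d where "d k J = - t $ (k, \<lambda>a. option_list (insert None (Some ` J)) ! position a)" for k J
  let ?q = "\<lambda>c I y. \<Sum>k\<in>UNIV. c k I * (\<Prod>a\<in>UNIV. y (k a)) :: real"
  have "\<alpha> u = wedge_comb C B \<Phi> (\<lambda>I u. ?q c I (\<lambda>a. hom_coord C B \<Phi> a u)) (\<lambda>J u. ?q d J (\<lambda>a. hom_coord C B \<Phi> a u)) u"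
    if u: "u \<in> over C (chart_dom C B \<Phi>)" for u
  proof -
    obtain X g where nd: "normal_data C B \<Phi> u X g" using normal_data_exists[OF pb nc u] .
    note N = normal_dataD[OF nd]
    have "\<alpha> u = (\<chi> s. mixed_act (matrix_inv (flat_lift X ** g)) t $ ((\<lambda>_. None), Some \<circ> s))"
      using t[OF N(1,2)] unfolding N(3)[symmetric] by (simp add: mixed_bgg_def)
    then show ?thesis unfolding mixed_act_hom_coord[OF nd tc c_def d_def] .
  qed
  moreover have "homogeneous_polynomial CARD('k) (?q c I)" "homogeneous_polynomial CARD('k) (?q d I)" for I
    by (rule homogeneous_polynomial_tensor)+
  ultimately show ?thesis by (intro exI[of _ "?q c"] exI[of _ "?q d"] conjI allI ballI)
qed

text \<open>The section \<open>u \<mapsto> u\<^sup>-\<^sup>1 \<cdot> v\<close> is defined on all of \<open>SL\<close>, so the solution extends to the whole sphere.\<close>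

lemma flat_comb_solution:
  fixes c d :: "'n::{finite,linorder} set \<Rightarrow> real"
  shows "\<exists>\<alpha> :: 'n mat \<Rightarrow> real^('r::{finite,linorder} \<Rightarrow> 'n).
      BGG_solution flat_model ext_bgg (pts (base flat_model)) \<alpha> \<and>
      (\<forall>u\<in>over flat_model flat_dom. \<alpha> u = wedge_comb flat_model UNIV flat_lift (\<lambda>I _. c I) (\<lambda>J _. d J) u)"
proof (intro exI conjI ballI)
  let ?V = "ext_bgg :: ('n, real^('r \<Rightarrow> 'n option), real^('r \<Rightarrow> 'n)) bgg_data"
  let ?\<alpha> = "\<lambda>u. (\<chi> s. bgg_act ?V (matrix_inv u) (comb_tensor c d) $ (Some \<circ> s)) :: real^('r \<Rightarrow> 'n)"
  have "comb_tensor c d \<in> bgg_space ?V" by (simp add: ext_bgg_def comb_tensor_alternating)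
  from bgg_module.flat_solution[OF bgg_module_ext this open_UNIV over_sphere refl]
  show "BGG_solution flat_model ext_bgg (pts (base flat_model)) ?\<alpha>" .
  fix u :: "'n mat" assume "u \<in> over flat_model flat_dom"
  then obtain X g where nd: "normal_data flat_model UNIV flat_lift u X g" and u: "u = flat_lift X ** g"
    by (rule normal_data_flat)
  show "?\<alpha> u = wedge_comb flat_model UNIV flat_lift (\<lambda>I _. c I) (\<lambda>J _. d J) u"
    unfolding wedge_comb_comb_tensor[OF nd] by (simp add: ext_bgg_def u)
qed

lemma flat_ext_solutions:
  fixes \<alpha> :: "'n::{finite,linorder} mat \<Rightarrow> real^('r::{finite,linorder} \<Rightarrow> 'n)"
  assumes card: "CARD('r) < CARD('n)"
  shows "BGG_solution flat_model ext_bgg flat_dom \<alpha> \<longleftrightarrow>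
    (\<exists>c d. \<forall>u\<in>over flat_model flat_dom.
       \<alpha> u = wedge_comb flat_model UNIV flat_lift (\<lambda>I _. c I) (\<lambda>J _. d J) u)"
proof
  assume "BGG_solution flat_model ext_bgg flat_dom \<alpha>"
  then obtain v where v: "v \<in> alternating" and
    \<alpha>: "\<And>X g. g \<in> Pgrp \<Longrightarrow> \<alpha> (flat_lift X ** g) = (\<chi> s. tensor_act (matrix_inv (flat_lift X ** g)) v $ (Some \<circ> s))"
    using flat_ext_solution[OF card] by blast
  from alternating_comb_tensor[OF v] obtain c d where cd: "v = comb_tensor c d" by blast
  have "\<alpha> u = wedge_comb flat_model UNIV flat_lift (\<lambda>I _. c I) (\<lambda>J _. d J) u"
    if ou: "u \<in> over flat_model flat_dom" for u
  proof -
    obtain X g where nd: "normal_data flat_model UNIV flat_lift u X g" and u: "u = flat_lift X ** g" and g: "g \<in> Pgrp"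
      using normal_data_flat[OF ou] .
    show ?thesis unfolding wedge_comb_comb_tensor[OF nd] using \<alpha>[OF g, of X] by (simp add: u cd)
  qed
  then show "\<exists>c d. \<forall>u\<in>over flat_model flat_dom.
       \<alpha> u = wedge_comb flat_model UNIV flat_lift (\<lambda>I _. c I) (\<lambda>J _. d J) u" by blast
next
  assume "\<exists>c d. \<forall>u\<in>over flat_model flat_dom.
       \<alpha> u = wedge_comb flat_model UNIV flat_lift (\<lambda>I _. c I) (\<lambda>J _. d J) u"
  then obtain c d where \<alpha>: "\<And>u. u \<in> over flat_model flat_dom \<Longrightarrow>
       \<alpha> u = wedge_comb flat_model UNIV flat_lift (\<lambda>I _. c I) (\<lambda>J _. d J) u" by blast
  have m: "comb_tensor c d \<in> bgg_space (ext_bgg :: ('n, real^('r \<Rightarrow> 'n option), real^('r \<Rightarrow> 'n)) bgg_data)"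
    by (simp add: ext_bgg_def comb_tensor_alternating)
  show "BGG_solution flat_model ext_bgg flat_dom \<alpha>"
  proof (rule bgg_module.flat_solution[OF bgg_module_ext m open_flat_dom over_flat_dom])
    fix u :: "'n mat" assume ou: "u \<in> over flat_model flat_dom"
    then obtain X g where nd: "normal_data flat_model UNIV flat_lift u X g" and u: "u = flat_lift X ** g"
      by (rule normal_data_flat)
    show "\<alpha> u = (\<chi> s. bgg_act ext_bgg (matrix_inv u) (comb_tensor c d) $ (Some \<circ> s))"
      unfolding \<alpha>[OF ou] wedge_comb_comb_tensor[OF nd] by (simp add: ext_bgg_def u)
  qed
qed

lemma flat_comb_independent:
  fixes c d :: "'n::{finite,linorder} set \<Rightarrow> real"
  assumes card: "CARD('r::{finite,linorder}) < CARD('n)"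
    and z: "\<forall>u\<in>over flat_model (flat_dom :: (real^('n option)) set).
       (wedge_comb flat_model UNIV flat_lift (\<lambda>I _. c I) (\<lambda>J _. d J) u :: real^('r \<Rightarrow> 'n)) = 0"
  shows "I \<in> idx TYPE('r) \<Longrightarrow> c I = 0" "J \<in> idx' TYPE('r) \<Longrightarrow> d J = 0"
proof -
  let ?v = "comb_tensor c d :: real^('r \<Rightarrow> 'n option)"
  have "(\<chi> s. tensor_act (flat_lift X) ?v $ (Some \<circ> s)) = 0" for X
  proof -
    have nd: "normal_data flat_model UNIV flat_lift (flat_lift (- X)) (- X) (mat 1)"
      using normal_data_flatI[OF Pgrp_one, of "- X"] by simp
    have "flat_lift (- X) \<in> over flat_model flat_dom"
      by (simp add: over_flat_dom flat_lift_SL flat_lift_component)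
    with z have "(wedge_comb flat_model UNIV flat_lift (\<lambda>I _. c I) (\<lambda>J _. d J) (flat_lift (- X)) :: real^('r \<Rightarrow> 'n)) = 0"
      by blast
    then show ?thesis unfolding wedge_comb_comb_tensor[OF nd] by (simp add: matrix_inv_flat_lift)
  qed
  from alternating_zero_if_tops_zero[OF card comb_tensor_alternating this] have "?v = 0" .
  then show "I \<in> idx TYPE('r) \<Longrightarrow> c I = 0" "J \<in> idx' TYPE('r) \<Longrightarrow> d J = 0"
    using comb_tensor_eq_zero by blast+
qed

lemma flat_sym_solution:
  fixes q :: "('n::finite option \<Rightarrow> real) \<Rightarrow> real"
  assumes q: "homogeneous_polynomial CARD('k::finite) q"
  shows "\<exists>\<alpha>. BGG_solution flat_model
              (sym_bgg :: ('n, real^('k \<Rightarrow> 'n option), real) bgg_data) (pts (base flat_model)) \<alpha> \<and>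
             (\<forall>u\<in>over flat_model flat_dom. \<alpha> u = q (\<lambda>a. hom_coord flat_model UNIV flat_lift a u))"
proof -
  let ?V = "sym_bgg :: ('n, real^('k \<Rightarrow> 'n option), real) bgg_data"
  obtain t :: "real^('k \<Rightarrow> 'n option)" where t: "t \<in> symmetric"
    and qt: "\<And>y. q y = (\<Sum>s\<in>UNIV. t $ s * (\<Prod>a\<in>UNIV. y (s a)))"
    using homogeneous_polynomial_symmetric[OF q] by blast
  have m: "t \<in> bgg_space ?V" using t by (simp add: sym_bgg_def)
  let ?\<alpha> = "\<lambda>u. bgg_act ?V (matrix_inv u) t $ (\<lambda>_. None)"
  have "BGG_solution flat_model ?V (pts (base flat_model)) ?\<alpha>"
    by (rule bgg_module.flat_solution[OF bgg_module_sym m open_UNIV over_sphere refl])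
  moreover have "?\<alpha> u = q (\<lambda>a. hom_coord flat_model UNIV flat_lift a u)"
    if ou: "u \<in> over flat_model flat_dom" for u
  proof -
    obtain X g where nd: "normal_data flat_model UNIV flat_lift u X g" and u: "u = flat_lift X ** g"
      using normal_data_flat[OF ou] .
    show ?thesis using sym_act_hom_coord[OF nd, of t] unfolding u[symmetric] qt .
  qed
  ultimately show ?thesis by blast
qed

lemma frame_wedge_solution:
  fixes I :: "'n::{finite,linorder} set"
  assumes I: "I \<in> idx TYPE('r::{finite,linorder})"
  shows "\<exists>\<alpha> :: 'n mat \<Rightarrow> real^('r \<Rightarrow> 'n).
      BGG_solution flat_model ext_bgg (pts (base flat_model)) \<alpha> \<and>
      (\<forall>u\<in>over flat_model flat_dom. \<alpha> u = frame_wedge flat_model UNIV flat_lift I u)"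
proof -
  have "(frame_wedge flat_model UNIV flat_lift I u :: real^('r \<Rightarrow> 'n))
      = wedge_comb flat_model UNIV flat_lift (\<lambda>I' _. if I' = I then 1 else 0) (\<lambda>_ _. 0) u" for u
    using I by (simp add: wedge_comb_def if_distrib if_distribR cong: if_cong)
  then show ?thesis by (simp only:) (rule flat_comb_solution)
qed

lemma euler_wedge_solution:
  fixes J :: "'n::{finite,linorder} set"
  assumes J: "J \<in> idx' TYPE('r::{finite,linorder})"
  shows "\<exists>\<alpha> :: 'n mat \<Rightarrow> real^('r \<Rightarrow> 'n).
      BGG_solution flat_model ext_bgg (pts (base flat_model)) \<alpha> \<and>
      (\<forall>u\<in>over flat_model flat_dom. \<alpha> u = euler_wedge flat_model UNIV flat_lift J u)"
proof -
  have "(euler_wedge flat_model UNIV flat_lift J u :: real^('r \<Rightarrow> 'n))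
      = wedge_comb flat_model UNIV flat_lift (\<lambda>_ _. 0) (\<lambda>J' _. if J' = J then 1 else 0) u" for u
    using J by (simp add: wedge_comb_def if_distrib if_distribR cong: if_cong)
  then show ?thesis by (simp only:) (rule flat_comb_solution)
qed

theorem theorem3p2:
  fixes C :: "('g, 'm, 'n::{finite,linorder}) cartan_geometry"
    and ori :: "('m set \<times> ('m \<Rightarrow> real^'n::_)) set" and cls :: "'m connection set"
    and u\<^sub>0 :: 'g and B :: "(real^'n::_) set" and \<Phi> :: "real^'n::_ \<Rightarrow> 'g"
  assumes "2 \<le> CARD('n)"
    and "oriented_projective_structure (base C) ori cls"
    and "canonical_cartan_geometry C ori cls"
    and "normal_chart C u\<^sub>0 B \<Phi>"
  shows
    \<comment> \<open>The three conjuncts are (1), (2), (3), with \<open>r = CARD('r)\<close> and \<open>k - 1 = CARD('k)\<close>.\<close>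
    "(CARD('r::{finite,linorder}) < CARD('n) \<longrightarrow>
       (\<forall>\<alpha> :: 'g \<Rightarrow> real^('r \<Rightarrow> 'n). normal_BGG_solution C ext_bgg (pts (base C)) \<alpha> \<longrightarrow>
          (\<exists>c d. \<forall>u\<in>over C (chart_dom C B \<Phi>). \<alpha> u = wedge_comb C B \<Phi> (\<lambda>I _. c I) (\<lambda>J _. d J) u)) \<and>
       (\<forall>i. \<forall>u\<in>over flat_model (flat_dom :: (real^('n option)) set).
          push (tot flat_model) (base flat_model) (prj flat_model) u
            (cvf flat_model (gm (hom_coord flat_model UNIV flat_lift None u *\<^sub>R
               nframe_TM flat_model UNIV flat_lift i u)) u)
          = coord_field flat_model UNIV flat_lift i (prj flat_model u)) \<and>
       (\<forall>I\<in>idx TYPE('r). \<exists>\<alpha> :: 'n mat \<Rightarrow> real^('r \<Rightarrow> 'n).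
          BGG_solution flat_model ext_bgg (pts (base flat_model)) \<alpha> \<and>
          (\<forall>u\<in>over flat_model flat_dom. \<alpha> u = frame_wedge flat_model UNIV flat_lift I u)) \<and>
       (\<forall>J\<in>idx' TYPE('r). \<exists>\<alpha> :: 'n mat \<Rightarrow> real^('r \<Rightarrow> 'n).
          BGG_solution flat_model ext_bgg (pts (base flat_model)) \<alpha> \<and>
          (\<forall>u\<in>over flat_model flat_dom. \<alpha> u = euler_wedge flat_model UNIV flat_lift J u)) \<and>
       (\<forall>\<alpha> :: 'n mat \<Rightarrow> real^('r \<Rightarrow> 'n). BGG_solution flat_model ext_bgg flat_dom \<alpha> \<longleftrightarrow>
          (\<exists>c d. \<forall>u\<in>over flat_model flat_dom.
             \<alpha> u = wedge_comb flat_model UNIV flat_lift (\<lambda>I _. c I) (\<lambda>J _. d J) u)) \<and>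
       (\<forall>c d. (\<forall>u\<in>over flat_model (flat_dom :: (real^('n option)) set).
             (wedge_comb flat_model UNIV flat_lift (\<lambda>I _. c I) (\<lambda>J _. d J) u :: real^('r \<Rightarrow> 'n)) = 0) \<longrightarrow>
          (\<forall>I\<in>idx TYPE('r). c I = 0) \<and> (\<forall>J\<in>idx' TYPE('r). d J = 0))) \<and>
     (\<forall>\<alpha>. normal_BGG_solution C
             (sym_bgg :: ('n, real^('k::finite \<Rightarrow> 'n option), real) bgg_data) (pts (base C)) \<alpha> \<longrightarrow>
          (\<exists>q. homogeneous_polynomial CARD('k) q \<and>
             (\<forall>u\<in>over C (chart_dom C B \<Phi>). \<alpha> u = q (\<lambda>a. hom_coord C B \<Phi> a u)))) \<and>
     (\<forall>q. homogeneous_polynomial CARD('k) q \<longrightarrow>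
          (\<exists>\<alpha>. BGG_solution flat_model
              (sym_bgg :: ('n, real^('k \<Rightarrow> 'n option), real) bgg_data) (pts (base flat_model)) \<alpha> \<and>
             (\<forall>u\<in>over flat_model flat_dom. \<alpha> u = q (\<lambda>a. hom_coord flat_model UNIV flat_lift a u)))) \<and>
     (CARD('r) < CARD('n) \<longrightarrow>
       (\<forall>\<alpha>. normal_BGG_solution C
             (mixed_bgg :: ('n, real^(('k \<Rightarrow> 'n option) \<times> ('r \<Rightarrow> 'n option)), real^('r \<Rightarrow> 'n)) bgg_data)
             (pts (base C)) \<alpha> \<longrightarrow>
          (\<exists>q q'. (\<forall>I. homogeneous_polynomial CARD('k) (q I)) \<and>
             (\<forall>J. homogeneous_polynomial CARD('k) (q' J)) \<and>
             (\<forall>u\<in>over C (chart_dom C B \<Phi>). \<alpha> u = wedge_comb C B \<Phi>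
                (\<lambda>I u. q I (\<lambda>a. hom_coord C B \<Phi> a u)) (\<lambda>J u. q' J (\<lambda>a. hom_coord C B \<Phi> a u)) u))))"
proof -
  have pb: "principal_bundle C"
    using assms(3) by (simp add: canonical_cartan_geometry_def cartan_geometry_def)
  show ?thesis
    by (intro conjI impI allI ballI;
        erule ext_normal_solution[OF pb assms(4)] flat_coord_field frame_wedge_solution euler_wedge_solution
          flat_ext_solutions flat_comb_independent(1) flat_comb_independent(2)
          sym_normal_solution[OF pb assms(4)] flat_sym_solution mixed_normal_solution[OF pb assms(4)];
        assumption)
qed

end
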